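(* Let $\Bbbk$, $A$, $f$, $A_f$ be as in the context. Let $M$ be an $A$-module and let $$\cdots\to Q_1\xrightarrow{\delta_1}Q_0\xrightarrow{\delta_0}M\to0$$ be a minimal projective resolution of $M$. Suppose that $T_i\colon Q_i\to Q_{i-1}$ ($i>0$) are $\Bbbk$-linear maps such that for every $i>0$: (i) $T_i(ax)-aT_i(x)=(-1)^{i+1}\bigl(f_{Q_{i-1}}(a\otimes\delta_i(x))-\delta_i(f_{Q_i}(a\otimes x))\bigr)$ for all $a\in A$, $x\in Q_i$; (ii) $T_i\delta_{i+1}=\delta_iT_{i+1}$. For $m\ge1$ define $u_m,v_m\colon\bigoplus_{i=0}^mQ_i\to\bigoplus_{i=0}^{m-1}Q_i$ by letting, for $1\le i\le m$, the component in $Q_{i-1}$ of $u_m(x_0,\dots,x_m)$ be $\delta_i(x_i)$ and the component in $Q_{i-1}$ of $v_m(x_0,\dots,x_m)$ be $(-1)^{i-1}(x_{i-1}+T_i(x_i))$. Put $\hat\delta_0=(0,\delta_0,0)$ and $\hat\delta_m=(u_m,v_m,u_m)$ for $m\ge1$. Then $$\cdots\to\bigoplus_{i=0}^m\hat Q_i\xrightarrow{\hat\delta_m}\bigoplus_{i=0}^{m-1}\hat Q_i\to\cdots\to\hat Q_0\oplus\hat Q_1\xrightarrow{\hat\delta_1}\hat Q_0\xrightarrow{\hat\delta_0}M\to0$$ is a minimal projective resolution of the $A_f$-module $M=(0,M,0,0)$.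
   Context: Setting. $\Bbbk$ is an algebraically closed field, $A$ a finite dimensional associative unital $\Bbbk$-algebra, all modules are finite dimensional left modules. $1=\sum_{i=1}^n e_i$ is a decomposition into primitive orthogonal idempotents such that $P_i=Ae_i$ form a complete set of representatives of isomorphism classes of indecomposable projective $A$-modules. $f\colon A\otimes_\Bbbk A\to A$ is a Hochschild $2$-cocycle: $af(b\otimes c)-f(ab\otimes c)+f(a\otimes bc)-f(a\otimes b)c=0$. $A_f=A[t]/(t^2)\simeq A\oplus A$ is the algebra with product $(a_0+a_1t)(b_0+b_1t)=a_0b_0+(a_0b_1+a_1b_0+f(a_0\otimes b_0))t$. $A_f$-modules. $\operatorname{mod}A_f$ is identified with the category of tuples $(M_0,M_1,T_M,f_M)$, $M_0,M_1\in\operatorname{mod}A$, $T_M\in\operatorname{Hom}_A(M_0,M_1)$ a monomorphism, $f_M\in\operatorname{Hom}_\Bbbk(A\otimes_\Bbbk M_0,M_1)$ with $af_M(b\otimes m)-f_M(ab\otimes m)+f_M(a\otimes bm)-f(a\otimes b)T_M(m)=0$; the tuple corresponds to $M_0\oplus M_1$ with $(a+bt)(m_0,m_1)=(am_0,\,am_1+bT_M(m_0)+f_M(a\otimes m_0))$. Morphisms $(M_0,M_1,T_M,f_M)\to(N_0,N_1,T_N,f_N)$ are triples $(u_0,u_1,u_2)$, $u_0\in\operatorname{Hom}_A(M_0,N_0)$, $u_2\in\operatorname{Hom}_A(M_1,N_1)$, $u_1\in\operatorname{Hom}_\Bbbk(M_0,N_1)$, with $T_Nu_0=u_2T_M$ and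 $u_1(am)=au_1(m)-u_2(f_M(a\otimes m))+f_N(a\otimes u_0(m))$, corresponding to $(m_0,m_1)\mapsto(u_0(m_0),u_1(m_0)+u_2(m_1))$; composition is $(v_0,v_1,v_2)(u_0,u_1,u_2)=(v_0u_0,\,v_2u_1+v_1u_0,\,v_2u_2)$. An $A$-module $M$ is viewed as the $A_f$-module $(0,M,0,0)$. Projectives. Every projective $A$-module $Q$ is taken with a decomposition $Q=\bigoplus_{r=1}^m Ae_{i_r}$; $f_Q\colon A\otimes Q\to Q$ is $f_Q(a\otimes x)=\sum_r f(a\otimes x_r)e_{i_r}$ for $x=\sum_r x_r$, $x_r\in Ae_{i_r}$, and $\hat Q=(Q,Q,\mathrm{Id},f_Q)$, a projective $A_f$-module; $\bigoplus_i\hat Q_i=(\bigoplus_i Q_i,\bigoplus_i Q_i,\mathrm{Id},f_{\bigoplus Q_i})$. *)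

theory Defs
  imports "HOL-Algebra.Algebraic_Closure" "HOL-Algebra.Module"
begin

section \<open>Left modules over a not necessarily commutative ring\<close>

text \<open>The library locale \<^locale>\<open>Module.module\<close> is restricted to commutative base rings; the axioms
  below are the same ones over an arbitrary ring.  Modules are elements of the library record type
  \<^typ>\<open>('r, 'm) module\<close>, whose fields \<^const>\<open>monoid.mult\<close> and \<^const>\<open>one\<close> play no role for modules.\<close>

locale left_module = R?: ring R + M?: abelian_group M
  for R :: "('r, 'x) ring_scheme" (structure) and M :: "('r, 'm) module" (structure) +
  assumes smult_closed:
      "\<lbrakk>a \<in> carrier R; x \<in> carrier M\<rbrakk> \<Longrightarrow> a \<odot>\<^bsub>M\<^esub> x \<in> carrier M"
    and smult_l_distr:
      "\<lbrakk>a \<in> carrier R; b \<in> carrier R; x \<in> carrier M\<rbrakk>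
        \<Longrightarrow> (a \<oplus>\<^bsub>R\<^esub> b) \<odot>\<^bsub>M\<^esub> x = a \<odot>\<^bsub>M\<^esub> x \<oplus>\<^bsub>M\<^esub> b \<odot>\<^bsub>M\<^esub> x"
    and smult_r_distr:
      "\<lbrakk>a \<in> carrier R; x \<in> carrier M; y \<in> carrier M\<rbrakk>
        \<Longrightarrow> a \<odot>\<^bsub>M\<^esub> (x \<oplus>\<^bsub>M\<^esub> y) = a \<odot>\<^bsub>M\<^esub> x \<oplus>\<^bsub>M\<^esub> a \<odot>\<^bsub>M\<^esub> y"
    and smult_assoc:
      "\<lbrakk>a \<in> carrier R; b \<in> carrier R; x \<in> carrier M\<rbrakk>
        \<Longrightarrow> (a \<otimes>\<^bsub>R\<^esub> b) \<odot>\<^bsub>M\<^esub> x = a \<odot>\<^bsub>M\<^esub> (b \<odot>\<^bsub>M\<^esub> x)"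
    and smult_one:
      "x \<in> carrier M \<Longrightarrow> \<one>\<^bsub>R\<^esub> \<odot>\<^bsub>M\<^esub> x = x"

definition mk_module ::
  "'m set \<Rightarrow> 'm \<Rightarrow> ('m \<Rightarrow> 'm \<Rightarrow> 'm) \<Rightarrow> ('r \<Rightarrow> 'm \<Rightarrow> 'm) \<Rightarrow> ('r, 'm) module" where
  "mk_module C z p s =
    \<lparr>carrier = C, monoid.mult = undefined, one = undefined, zero = z, add = p, smult = s\<rparr>"

definition mhom ::
  "('r, 'x) ring_scheme \<Rightarrow> ('r, 'm) module \<Rightarrow> ('r, 'n) module \<Rightarrow> ('m \<Rightarrow> 'n) set" where
  "mhom R M N = {h. h \<in> carrier M \<rightarrow> carrier N
     \<and> (\<forall>x\<in>carrier M. \<forall>y\<in>carrier M. h (x \<oplus>\<^bsub>M\<^esub> y) = h x \<oplus>\<^bsub>N\<^esub> h y)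
     \<and> (\<forall>a\<in>carrier R. \<forall>x\<in>carrier M. h (a \<odot>\<^bsub>M\<^esub> x) = a \<odot>\<^bsub>N\<^esub> h x)}"

definition module_iso ::
  "('r, 'x) ring_scheme \<Rightarrow> ('r, 'm) module \<Rightarrow> ('r, 'n) module \<Rightarrow> bool" where
  "module_iso R M N \<longleftrightarrow> (\<exists>h\<in>mhom R M N. bij_betw h (carrier M) (carrier N))"

definition zero_module :: "('r, unit) module" where
  "zero_module = mk_module UNIV () (\<lambda>_ _. ()) (\<lambda>_ _. ())"

text \<open>For finite \<open>I\<close> this is the direct sum; its elements are extensional families.\<close>

definition direct_sum :: "'i set \<Rightarrow> ('i \<Rightarrow> ('r, 'm) module) \<Rightarrow> ('r, 'i \<Rightarrow> 'm) module" where
  "direct_sum I M = mk_module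
     (\<Pi>\<^sub>E i\<in>I. carrier (M i))
     (\<lambda>i\<in>I. \<zero>\<^bsub>M i\<^esub>)
     (\<lambda>x y. \<lambda>i\<in>I. x i \<oplus>\<^bsub>M i\<^esub> y i)
     (\<lambda>a x. \<lambda>i\<in>I. a \<odot>\<^bsub>M i\<^esub> x i)"

definition indecomposable :: "('r, 'x) ring_scheme \<Rightarrow> ('r, 'm) module \<Rightarrow> bool" where
  "indecomposable R M \<longleftrightarrow> carrier M \<noteq> {\<zero>\<^bsub>M\<^esub>}
     \<and> \<not> (\<exists>S Y. submodule S R M \<and> submodule Y R M \<and> S \<noteq> {\<zero>\<^bsub>M\<^esub>} \<and> Y \<noteq> {\<zero>\<^bsub>M\<^esub>}
             \<and> S \<inter> Y = {\<zero>\<^bsub>M\<^esub>} \<and> S <+>\<^bsub>M\<^esub> Y = carrier M)"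

text \<open>The lifting property.  A HOL definition can quantify only over modules with elements in a
  fixed type, here \<open>'n\<close>.  One type for both \<open>N\<close> and \<open>L\<close> is no restriction, as two types embed in
  their sum.  A statement made for a type variable \<open>'n\<close> asserts the lifting property against
  modules of all types.  For finitely generated \<open>P\<close> the single instance \<open>'n = nat \<Rightarrow> 'r\<close> already
  implies all others: it contains every \<open>R\<^sup>k\<close> and, choosing representatives, a copy of every
  quotient of \<open>R\<^sup>k\<close>, so the identity of \<open>P\<close> lifts to some \<open>R\<^sup>k\<close>.\<close>

definition projective ::
  "'n itself \<Rightarrow> ('r, 'x) ring_scheme \<Rightarrow> ('r, 'm) module \<Rightarrow> bool" where
  "projective tn R P \<longleftrightarrow> left_module R P
     \<and> (\<forall>(N :: ('r, 'n) module) (L :: ('r, 'n) module) g h.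
          left_module R N \<and> left_module R L \<and>
          g \<in> mhom R N L \<and> g ` carrier N = carrier L \<and> h \<in> mhom R P L
          \<longrightarrow> (\<exists>l\<in>mhom R P N. \<forall>x\<in>carrier P. g (l x) = h x))"

definition superfluous :: "('r, 'x) ring_scheme \<Rightarrow> ('r, 'm) module \<Rightarrow> 'm set \<Rightarrow> bool" where
  "superfluous R M N \<longleftrightarrow>
     (\<forall>S. submodule S R M \<and> S <+>\<^bsub>M\<^esub> N = carrier M \<longrightarrow> S = carrier M)"

definition projective_cover ::
  "'n itself \<Rightarrow> ('r, 'x) ring_scheme \<Rightarrow> ('r, 'p) module \<Rightarrow> ('r, 'm) module \<Rightarrow> ('p \<Rightarrow> 'm) \<Rightarrow> bool" where
  "projective_cover tn R P M h \<longleftrightarrow> projective tn R P \<and> left_module R M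
     \<and> h \<in> mhom R P M \<and> h ` carrier P = carrier M \<and> superfluous R P (a_kernel P M h)"


section \<open>Finite-dimensional algebras and modules\<close>

definition finite_dim :: "('k, 'x) ring_scheme \<Rightarrow> ('k, 'v) module \<Rightarrow> bool" where
  "finite_dim K V \<longleftrightarrow> (\<exists>B. finite B \<and> B \<subseteq> carrier V
     \<and> (\<forall>x\<in>carrier V. \<exists>c\<in>B \<rightarrow> carrier K. x = (\<Oplus>\<^bsub>V\<^esub>b\<in>B. c b \<odot>\<^bsub>V\<^esub> b)))"

text \<open>An algebra is a record carrying both the ring structure and the scalar multiplication.\<close>

locale fd_algebra = module K A + ring A 
  for K :: "'k ring" (structure) and A :: "('k, 'a) module" (structure) +
  assumes smult_mult_left:
      "\<lbrakk>c \<in> carrier K; x \<in> carrier A; y \<in> carrier A\<rbrakk>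
        \<Longrightarrow> (c \<odot>\<^bsub>A\<^esub> x) \<otimes>\<^bsub>A\<^esub> y = c \<odot>\<^bsub>A\<^esub> (x \<otimes>\<^bsub>A\<^esub> y)"
    and smult_mult_right:
      "\<lbrakk>c \<in> carrier K; x \<in> carrier A; y \<in> carrier A\<rbrakk>
        \<Longrightarrow> x \<otimes>\<^bsub>A\<^esub> (c \<odot>\<^bsub>A\<^esub> y) = c \<odot>\<^bsub>A\<^esub> (x \<otimes>\<^bsub>A\<^esub> y)"
    and finite_dim: "finite_dim K A"

text \<open>The vector space underlying an \<open>A\<close>-module; scalars act through \<open>c \<mapsto> c 1\<^sub>A\<close>.\<close>

definition kspace :: "('k, 'a) module \<Rightarrow> ('a, 'm) module \<Rightarrow> ('k, 'm) module" where
  "kspace A M = mk_module (carrier M) \<zero>\<^bsub>M\<^esub> (add M) (\<lambda>c x. (c \<odot>\<^bsub>A\<^esub> \<one>\<^bsub>A\<^esub>) \<odot>\<^bsub>M\<^esub> x)"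

definition fd_module :: "'k ring \<Rightarrow> ('k, 'a) module \<Rightarrow> ('a, 'm) module \<Rightarrow> bool" where
  "fd_module K A M \<longleftrightarrow> left_module A M \<and> finite_dim K (kspace A M)"

text \<open>Linear maps on a tensor product \<open>U \<otimes>\<^sub>K V\<close> are rendered as bilinear maps.\<close>

definition bilinear_map ::
  "'k ring \<Rightarrow> ('k, 'u) module \<Rightarrow> ('k, 'v) module \<Rightarrow> ('k, 'w) module \<Rightarrow> ('u \<Rightarrow> 'v \<Rightarrow> 'w) \<Rightarrow> bool" where
  "bilinear_map K U V W g \<longleftrightarrow> (\<forall>x\<in>carrier U. g x \<in> mhom K V W)
     \<and> (\<forall>y\<in>carrier V. (\<lambda>x. g x y) \<in> mhom K U W)"


section \<open>Minimal projective resolutions\<close>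

text \<open>The complex is \<open>\<dots> \<rightarrow> C 1 \<rightarrow> C 0 \<rightarrow> M \<rightarrow> 0\<close> with \<open>d i : C i \<rightarrow> C (i - 1)\<close> for \<open>i > 0\<close> and
  augmentation \<open>d0 : C 0 \<rightarrow> M\<close>; the value \<open>d 0\<close> is not used.\<close>

definition projective_resolution ::
  "'n itself \<Rightarrow> 'k ring \<Rightarrow> ('k, 'r) module \<Rightarrow> (nat \<Rightarrow> ('r, 'c) module) \<Rightarrow> (nat \<Rightarrow> 'c \<Rightarrow> 'c)
    \<Rightarrow> ('c \<Rightarrow> 'm) \<Rightarrow> ('r, 'm) module \<Rightarrow> bool" where
  "projective_resolution tn K R C d d0 M \<longleftrightarrow>
     (\<forall>i. fd_module K R (C i) \<and> projective tn R (C i)) \<and> fd_module K R M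
     \<and> d0 \<in> mhom R (C 0) M \<and> (\<forall>i>0. d i \<in> mhom R (C i) (C (i - 1)))
     \<and> d0 ` carrier (C 0) = carrier M
     \<and> d 1 ` carrier (C 1) = a_kernel (C 0) M d0
     \<and> (\<forall>i>0. d (i + 1) ` carrier (C (i + 1)) = a_kernel (C i) (C (i - 1)) (d i))"

definition minimal_projective_resolution ::
  "'n itself \<Rightarrow> 'k ring \<Rightarrow> ('k, 'r) module \<Rightarrow> (nat \<Rightarrow> ('r, 'c) module) \<Rightarrow> (nat \<Rightarrow> 'c \<Rightarrow> 'c)
    \<Rightarrow> ('c \<Rightarrow> 'm) \<Rightarrow> ('r, 'm) module \<Rightarrow> bool" where
  "minimal_projective_resolution tn K R C d d0 M \<longleftrightarrow>
     projective_resolution tn K R C d d0 M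
     \<and> projective_cover tn R (C 0) M d0
     \<and> (\<forall>i>0. projective_cover tn R (C i) ((C (i - 1))\<lparr>carrier := d i ` carrier (C i)\<rparr>) (d i))"


section \<open>Idempotents and the projective modules \<open>Q\<close>\<close>

definition primitive_idempotent :: "('a, 'x) ring_scheme \<Rightarrow> 'a \<Rightarrow> bool" where
  "primitive_idempotent A e \<longleftrightarrow> e \<in> carrier A \<and> e \<otimes>\<^bsub>A\<^esub> e = e \<and> e \<noteq> \<zero>\<^bsub>A\<^esub>
     \<and> \<not> (\<exists>x\<in>carrier A. \<exists>y\<in>carrier A. x \<noteq> \<zero>\<^bsub>A\<^esub> \<and> y \<noteq> \<zero>\<^bsub>A\<^esub>
             \<and> x \<otimes>\<^bsub>A\<^esub> x = x \<and> y \<otimes>\<^bsub>A\<^esub> y = y \<and> x \<otimes>\<^bsub>A\<^esub> y = \<zero>\<^bsub>A\<^esub> \<and> y \<otimes>\<^bsub>A\<^esub> x = \<zero>\<^bsub>A\<^esub>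
             \<and> e = x \<oplus>\<^bsub>A\<^esub> y)"

definition left_ideal_module :: "('k, 'a) module \<Rightarrow> 'a \<Rightarrow> ('a, 'a) module" where
  "left_ideal_module A x = mk_module ((\<lambda>a. a \<otimes>\<^bsub>A\<^esub> x) ` carrier A) \<zero>\<^bsub>A\<^esub> (add A) (monoid.mult A)"

text \<open>Indices run over \<open>{..<n}\<close>.  Every finite-dimensional module is isomorphic to one with elements
  in \<open>nat \<Rightarrow> 'a\<close> (a quotient of some \<open>A\<^sup>k\<close>), so the last conjunct covers all of them.\<close>

definition idempotent_decomposition ::
  "'k ring \<Rightarrow> ('k, 'a) module \<Rightarrow> nat \<Rightarrow> (nat \<Rightarrow> 'a) \<Rightarrow> bool" where
  "idempotent_decomposition K A n e \<longleftrightarrow>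
     (\<forall>i<n. primitive_idempotent A (e i))
     \<and> (\<forall>i<n. \<forall>j<n. i \<noteq> j \<longrightarrow> e i \<otimes>\<^bsub>A\<^esub> e j = \<zero>\<^bsub>A\<^esub>)
     \<and> \<one>\<^bsub>A\<^esub> = (\<Oplus>\<^bsub>A\<^esub>i\<in>{..<n}. e i)
     \<and> (\<forall>i<n. indecomposable A (left_ideal_module A (e i))
             \<and> projective TYPE(nat \<Rightarrow> 'a) A (left_ideal_module A (e i)))
     \<and> (\<forall>i<n. \<forall>j<n. i \<noteq> j \<longrightarrow>
             \<not> module_iso A (left_ideal_module A (e i)) (left_ideal_module A (e j)))
     \<and> (\<forall>P :: ('a, nat \<Rightarrow> 'a) module.
             fd_module K A P \<and> indecomposable A P \<and> projective TYPE(nat \<Rightarrow> 'a) A P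
             \<longrightarrow> (\<exists>i<n. module_iso A P (left_ideal_module A (e i))))"

text \<open>A projective module with a chosen decomposition is given by the list \<open>idx = [i\<^sub>1, \<dots>, i\<^sub>m]\<close>;
  the summands are indexed from \<open>0\<close>.\<close>

definition proj_sum :: "('k, 'a) module \<Rightarrow> (nat \<Rightarrow> 'a) \<Rightarrow> nat list \<Rightarrow> ('a, nat \<Rightarrow> 'a) module" where
  "proj_sum A e idx = direct_sum {..<length idx} (\<lambda>r. left_ideal_module A (e (idx ! r)))"

definition f_proj ::
  "('k, 'a) module \<Rightarrow> ('a \<Rightarrow> 'a \<Rightarrow> 'a) \<Rightarrow> (nat \<Rightarrow> 'a) \<Rightarrow> nat list \<Rightarrow> 'a \<Rightarrow> (nat \<Rightarrow> 'a) \<Rightarrow> nat \<Rightarrow> 'a" where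
  "f_proj A f e idx a x = (\<lambda>r\<in>{..<length idx}. f a (x r) \<otimes>\<^bsub>A\<^esub> e (idx ! r))"


section \<open>Deformation by a cocycle\<close>

definition hochschild_2cocycle :: "'k ring \<Rightarrow> ('k, 'a) module \<Rightarrow> ('a \<Rightarrow> 'a \<Rightarrow> 'a) \<Rightarrow> bool" where
  "hochschild_2cocycle K A f \<longleftrightarrow> bilinear_map K A A A f
     \<and> (\<forall>a\<in>carrier A. \<forall>b\<in>carrier A. \<forall>c\<in>carrier A.
          a \<otimes>\<^bsub>A\<^esub> f b c \<ominus>\<^bsub>A\<^esub> f (a \<otimes>\<^bsub>A\<^esub> b) c \<oplus>\<^bsub>A\<^esub> f a (b \<otimes>\<^bsub>A\<^esub> c) \<ominus>\<^bsub>A\<^esub> f a b \<otimes>\<^bsub>A\<^esub> c = \<zero>\<^bsub>A\<^esub>)"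

text \<open>The pair \<open>(a\<^sub>0, a\<^sub>1)\<close> stands for \<open>a\<^sub>0 + a\<^sub>1 t\<close>.  As \<open>f\<close> is not assumed to be normalized, the
  unit is \<open>1 - f(1 \<otimes> 1) t\<close>: the cocycle identity gives \<open>f(a \<otimes> 1) = a f(1 \<otimes> 1)\<close> and
  \<open>f(1 \<otimes> a) = f(1 \<otimes> 1) a\<close>.\<close>

definition deformed_algebra ::
  "('k, 'a) module \<Rightarrow> ('a \<Rightarrow> 'a \<Rightarrow> 'a) \<Rightarrow> ('k, 'a \<times> 'a) module" where
  "deformed_algebra A f =
    \<lparr>carrier = carrier A \<times> carrier A,
     monoid.mult = (\<lambda>(a0, a1) (b0, b1).
       (a0 \<otimes>\<^bsub>A\<^esub> b0, a0 \<otimes>\<^bsub>A\<^esub> b1 \<oplus>\<^bsub>A\<^esub> a1 \<otimes>\<^bsub>A\<^esub> b0 \<oplus>\<^bsub>A\<^esub> f a0 b0)),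
     one = (\<one>\<^bsub>A\<^esub>, \<ominus>\<^bsub>A\<^esub> f \<one>\<^bsub>A\<^esub> \<one>\<^bsub>A\<^esub>),
     zero = (\<zero>\<^bsub>A\<^esub>, \<zero>\<^bsub>A\<^esub>),
     add = (\<lambda>(a0, a1) (b0, b1). (a0 \<oplus>\<^bsub>A\<^esub> b0, a1 \<oplus>\<^bsub>A\<^esub> b1)),
     smult = (\<lambda>c (a0, a1). (c \<odot>\<^bsub>A\<^esub> a0, c \<odot>\<^bsub>A\<^esub> a1))\<rparr>"


section \<open>Modules over the deformed algebra as tuples\<close>

record ('a, 'p, 'q) tuple =
  tup0 :: "('a, 'p) module"
  tup1 :: "('a, 'q) module"
  tupT :: "'p \<Rightarrow> 'q"
  tupf :: "'a \<Rightarrow> 'p \<Rightarrow> 'q"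

definition is_tuple ::
  "'k ring \<Rightarrow> ('k, 'a) module \<Rightarrow> ('a \<Rightarrow> 'a \<Rightarrow> 'a) \<Rightarrow> ('a, 'p, 'q) tuple \<Rightarrow> bool" where
  "is_tuple K A f S \<longleftrightarrow> fd_module K A (tup0 S) \<and> fd_module K A (tup1 S)
     \<and> tupT S \<in> mhom A (tup0 S) (tup1 S) \<and> inj_on (tupT S) (carrier (tup0 S))
     \<and> bilinear_map K A (kspace A (tup0 S)) (kspace A (tup1 S)) (tupf S)
     \<and> (\<forall>a\<in>carrier A. \<forall>b\<in>carrier A. \<forall>m\<in>carrier (tup0 S).
          a \<odot>\<^bsub>tup1 S\<^esub> tupf S b m \<ominus>\<^bsub>tup1 S\<^esub> tupf S (a \<otimes>\<^bsub>A\<^esub> b) m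
            \<oplus>\<^bsub>tup1 S\<^esub> tupf S a (b \<odot>\<^bsub>tup0 S\<^esub> m) \<ominus>\<^bsub>tup1 S\<^esub> f a b \<odot>\<^bsub>tup1 S\<^esub> tupT S m
          = \<zero>\<^bsub>tup1 S\<^esub>)"

definition is_tuple_mor ::
  "'k ring \<Rightarrow> ('k, 'a) module \<Rightarrow> ('a, 'p, 'q) tuple \<Rightarrow> ('a, 'r, 's) tuple
    \<Rightarrow> ('p \<Rightarrow> 'r) \<times> ('p \<Rightarrow> 's) \<times> ('q \<Rightarrow> 's) \<Rightarrow> bool" where
  "is_tuple_mor K A S Y = (\<lambda>(u0, u1, u2).
     u0 \<in> mhom A (tup0 S) (tup0 Y) \<and> u2 \<in> mhom A (tup1 S) (tup1 Y)
     \<and> u1 \<in> mhom K (kspace A (tup0 S)) (kspace A (tup1 Y))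
     \<and> (\<forall>m\<in>carrier (tup0 S). tupT Y (u0 m) = u2 (tupT S m))
     \<and> (\<forall>a\<in>carrier A. \<forall>m\<in>carrier (tup0 S).
          u1 (a \<odot>\<^bsub>tup0 S\<^esub> m) =
            a \<odot>\<^bsub>tup1 Y\<^esub> u1 m \<ominus>\<^bsub>tup1 Y\<^esub> u2 (tupf S a m) \<oplus>\<^bsub>tup1 Y\<^esub> tupf Y a (u0 m)))"

definition tuple_module :: "('a, 'p, 'q) tuple \<Rightarrow> ('a \<times> 'a, 'p \<times> 'q) module" where
  "tuple_module S = mk_module
     (carrier (tup0 S) \<times> carrier (tup1 S))
     (\<zero>\<^bsub>tup0 S\<^esub>, \<zero>\<^bsub>tup1 S\<^esub>)
     (\<lambda>(m0, m1) (n0, n1). (m0 \<oplus>\<^bsub>tup0 S\<^esub> n0, m1 \<oplus>\<^bsub>tup1 S\<^esub> n1))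
     (\<lambda>(a, b) (m0, m1). (a \<odot>\<^bsub>tup0 S\<^esub> m0,
        a \<odot>\<^bsub>tup1 S\<^esub> m1 \<oplus>\<^bsub>tup1 S\<^esub> b \<odot>\<^bsub>tup1 S\<^esub> tupT S m0 \<oplus>\<^bsub>tup1 S\<^esub> tupf S a m0))"

definition tuple_map ::
  "('a, 'r, 's) tuple \<Rightarrow> ('p \<Rightarrow> 'r) \<times> ('p \<Rightarrow> 's) \<times> ('q \<Rightarrow> 's) \<Rightarrow> 'p \<times> 'q \<Rightarrow> 'r \<times> 's" where
  "tuple_map Y = (\<lambda>(u0, u1, u2) (m0, m1). (u0 m0, u1 m0 \<oplus>\<^bsub>tup1 Y\<^esub> u2 m1))"

definition tuple_of_module :: "('a, 'm) module \<Rightarrow> ('a, unit, 'm) tuple" where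
  "tuple_of_module M =
    \<lparr>tup0 = zero_module, tup1 = M, tupT = (\<lambda>_. \<zero>\<^bsub>M\<^esub>), tupf = (\<lambda>_ _. \<zero>\<^bsub>M\<^esub>)\<rparr>"

text \<open>The sum of the hats of \<open>proj_sum A e (js i)\<close> over \<open>i \<le> m\<close>.  The decomposition of the sum
  is the union of those of the summands, so the map \<open>f\<close> of the sum acts componentwise.\<close>

definition hat_sum ::
  "('k, 'a) module \<Rightarrow> ('a \<Rightarrow> 'a \<Rightarrow> 'a) \<Rightarrow> (nat \<Rightarrow> 'a) \<Rightarrow> (nat \<Rightarrow> nat list) \<Rightarrow> nat
    \<Rightarrow> ('a, nat \<Rightarrow> nat \<Rightarrow> 'a, nat \<Rightarrow> nat \<Rightarrow> 'a) tuple" where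
  "hat_sum A f e js m =
    \<lparr>tup0 = direct_sum {..m} (\<lambda>i. proj_sum A e (js i)),
     tup1 = direct_sum {..m} (\<lambda>i. proj_sum A e (js i)),
     tupT = (\<lambda>x. x),
     tupf = (\<lambda>a x. \<lambda>i\<in>{..m}. f_proj A f e (js i) a (x i))\<rparr>"

definition alt_sign :: "('r, 'm) module \<Rightarrow> nat \<Rightarrow> 'm \<Rightarrow> 'm" where
  "alt_sign M i x = (if even i then x else \<ominus>\<^bsub>M\<^esub> x)"

text \<open>The maps \<open>u\<^sub>m\<close>, \<open>v\<^sub>m\<close> for \<open>m \<ge> 1\<close>; the component with index \<open>j\<close> is the one called \<open>i - 1\<close>
  in the usual formula, \<open>1 \<le> i \<le> m\<close>.\<close>

definition u_map :: "(nat \<Rightarrow> 'q \<Rightarrow> 'q) \<Rightarrow> nat \<Rightarrow> (nat \<Rightarrow> 'q) \<Rightarrow> nat \<Rightarrow> 'q" where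
  "u_map \<delta> m x = (\<lambda>j\<in>{..m - 1}. \<delta> (j + 1) (x (j + 1)))"

definition v_map ::
  "(nat \<Rightarrow> ('a, 'q) module) \<Rightarrow> (nat \<Rightarrow> 'q \<Rightarrow> 'q) \<Rightarrow> nat \<Rightarrow> (nat \<Rightarrow> 'q) \<Rightarrow> nat \<Rightarrow> 'q" where
  "v_map Q T m x = (\<lambda>j\<in>{..m - 1}. alt_sign (Q j) j (x j \<oplus>\<^bsub>Q j\<^esub> T (j + 1) (x (j + 1))))"

definition delta_hat ::
  "(nat \<Rightarrow> ('a, 'q) module) \<Rightarrow> (nat \<Rightarrow> 'q \<Rightarrow> 'q) \<Rightarrow> (nat \<Rightarrow> 'q \<Rightarrow> 'q) \<Rightarrow> nat
    \<Rightarrow> ((nat \<Rightarrow> 'q) \<Rightarrow> nat \<Rightarrow> 'q) \<times> ((nat \<Rightarrow> 'q) \<Rightarrow> nat \<Rightarrow> 'q) \<times> ((nat \<Rightarrow> 'q) \<Rightarrow> nat \<Rightarrow> 'q)" where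
  "delta_hat Q \<delta> T m = (u_map \<delta> m, v_map Q T m, u_map \<delta> m)"

text \<open>The one-term sum \<open>hat_sum A f e js 0\<close> consists of families \<open>x\<close> with the single entry \<open>x 0\<close>.\<close>

definition delta_hat0 ::
  "('a, 'm) module \<Rightarrow> ('q \<Rightarrow> 'm)
    \<Rightarrow> ((nat \<Rightarrow> 'q) \<Rightarrow> unit) \<times> ((nat \<Rightarrow> 'q) \<Rightarrow> 'm) \<times> ((nat \<Rightarrow> 'q) \<Rightarrow> 'm)" where
  "delta_hat0 M \<delta>0 = ((\<lambda>_. ()), (\<lambda>x. \<delta>0 (x 0)), (\<lambda>_. \<zero>\<^bsub>M\<^esub>))"

end

theory Submission
  imports Defs
begin

text \<open>
  If \<open>f = 0\<close> and \<open>T = 0\<close>, then \<open>A\<^sub>f = A[t]/(t\<^sup>2)\<close>, and the sequence is the total complex obtained by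
  resolving \<open>M\<close> along \<open>\<delta>\<close> and along the periodic resolution of \<open>A\<close> given by multiplication with \<open>\<plusminus>t\<close>;
  the entries \<open>\<delta>(x\<^sub>i)\<close> and \<open>\<plusminus>x\<^sub>i\<^sub>-\<^sub>1\<close> are its two differentials.  For general \<open>f\<close> the maps \<open>\<delta>\<close> fail to
  commute with the cocycle, and \<open>T\<close> corrects this: its twisted linearity says that the differentials
  are morphisms of tuples (\<open>is_tuple_mor_delta_hat\<close>), and its commutation with \<open>\<delta>\<close> says that they
  form a complex (\<open>D_D\<close>).

  \<^bold>\<open>Exactness.\<close>  Let \<open>(x, y)\<close> be a cycle in degree \<open>m\<close>.  A preimage \<open>(z, 0)\<close> is found from the top down:
  \<open>\<delta>(z\<^sub>m\<^sub>+\<^sub>1) = x\<^sub>m\<close> is solvable by exactness of the given resolution, and \<open>z\<^sub>i = \<plusminus> y\<^sub>i - T(z\<^sub>i\<^sub>+\<^sub>1)\<close> is then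
  forced.  The remaining equations \<open>\<delta>(z\<^sub>i\<^sub>+\<^sub>1) = x\<^sub>i\<close> follow by descending induction from the cycle condition
  (\<open>D_preimage\<close>); the same computation serves the augmentation.

  \<^bold>\<open>Projectivity.\<close>  For an idempotent \<open>\<epsilon>\<close> the hat of \<open>A\<epsilon>\<close> is generated by \<open>(\<epsilon>, 0)\<close>, and
  \<open>(x, y) \<mapsto> (x, y + f(x \<otimes> \<epsilon>) (1 - 2\<epsilon>))\<close> is an \<open>A\<^sub>f\<close>-linear map into \<open>A\<^sub>f\<close> which splits the multiplication by
  that generator.  These maps form a finite dual basis of a sum of hats (\<open>projective_hat\<close>), and a
  module with a finite dual basis is projective (\<open>projective_dual_basis\<close>).

  \<^bold>\<open>Minimality.\<close>  In a hat the second component is \<open>t\<close> times the module and \<open>t\<close> is nilpotent, so a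
  submodule that is superfluous in the first component stays superfluous after adding the whole
  second component (\<open>superfluous_tuple\<close>).  The kernel of each differential is an image, hence its first
  component has entries in images of \<open>\<delta>\<close>; these are superfluous, and so is their direct sum
  (\<open>superfluous_direct_sum\<close>).
\<close>

section \<open>Left modules, homomorphisms and submodules\<close>

lemma set_addI: "h \<in> H \<Longrightarrow> l \<in> L \<Longrightarrow> h \<oplus>\<^bsub>M\<^esub> l \<in> H <+>\<^bsub>M\<^esub> L"
  by (auto simp: set_add_def')

lemma set_addE:
  assumes "x \<in> H <+>\<^bsub>M\<^esub> L"
  obtains h l where "h \<in> H" "l \<in> L" "x = h \<oplus>\<^bsub>M\<^esub> l"
  using assms by (auto simp: set_add_def')

context left_module
begin

lemma smult_zero_left: "x \<in> carrier M \<Longrightarrow> \<zero>\<^bsub>R\<^esub> \<odot>\<^bsub>M\<^esub> x = \<zero>\<^bsub>M\<^esub>"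
  using smult_l_distr[of "\<zero>\<^bsub>R\<^esub>" "\<zero>\<^bsub>R\<^esub>" x] smult_closed[of "\<zero>\<^bsub>R\<^esub>" x]
  by (metis M.add.r_cancel_one' R.zero_closed R.l_zero)

lemma smult_zero_right: "a \<in> carrier R \<Longrightarrow> a \<odot>\<^bsub>M\<^esub> \<zero>\<^bsub>M\<^esub> = \<zero>\<^bsub>M\<^esub>"
  using smult_r_distr[of a "\<zero>\<^bsub>M\<^esub>" "\<zero>\<^bsub>M\<^esub>"] smult_closed[of a "\<zero>\<^bsub>M\<^esub>"]
  by (metis M.add.r_cancel_one' M.zero_closed M.l_zero)

lemma smult_minus_right:
  assumes "a \<in> carrier R" "x \<in> carrier M"
  shows "a \<odot>\<^bsub>M\<^esub> (\<ominus>\<^bsub>M\<^esub> x) = \<ominus>\<^bsub>M\<^esub> (a \<odot>\<^bsub>M\<^esub> x)"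
proof -
  have "a \<odot>\<^bsub>M\<^esub> (\<ominus>\<^bsub>M\<^esub> x) \<oplus>\<^bsub>M\<^esub> a \<odot>\<^bsub>M\<^esub> x = \<zero>\<^bsub>M\<^esub>"
    using assms smult_r_distr[of a "\<ominus>\<^bsub>M\<^esub> x" x] by (simp add: M.l_neg smult_zero_right)
  then show ?thesis
    using assms by (metis M.a_inv_closed M.minus_equality smult_closed)
qed

lemma minus_eq_smult:
  assumes "x \<in> carrier M"
  shows "\<ominus>\<^bsub>M\<^esub> x = (\<ominus>\<^bsub>R\<^esub> \<one>\<^bsub>R\<^esub>) \<odot>\<^bsub>M\<^esub> x"
proof -
  have "(\<ominus>\<^bsub>R\<^esub> \<one>\<^bsub>R\<^esub>) \<odot>\<^bsub>M\<^esub> x \<oplus>\<^bsub>M\<^esub> x = \<zero>\<^bsub>M\<^esub>"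
    using assms smult_l_distr[of "\<ominus>\<^bsub>R\<^esub> \<one>\<^bsub>R\<^esub>" "\<one>\<^bsub>R\<^esub>" x]
    by (simp add: R.l_neg smult_zero_left smult_one)
  then show ?thesis
    using assms by (metis M.minus_equality R.a_inv_closed R.one_closed smult_closed)
qed

lemma submoduleI:
  assumes "H \<subseteq> carrier M" "\<zero>\<^bsub>M\<^esub> \<in> H"
    and "\<And>x y. x \<in> H \<Longrightarrow> y \<in> H \<Longrightarrow> x \<oplus>\<^bsub>M\<^esub> y \<in> H"
    and "\<And>a x. a \<in> carrier R \<Longrightarrow> x \<in> H \<Longrightarrow> a \<odot>\<^bsub>M\<^esub> x \<in> H"
  shows "submodule H R M"
proof -
  have "\<ominus>\<^bsub>M\<^esub> x \<in> H" if "x \<in> H" for x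
    using that assms minus_eq_smult[of x] by auto
  then show ?thesis
    using assms by (intro submodule.intro subgroup.intro) (auto simp: submodule_axioms_def a_inv_def)
qed

lemma submoduleD:
  assumes "submodule H R M"
  shows "H \<subseteq> carrier M" "\<zero>\<^bsub>M\<^esub> \<in> H"
    and "\<And>x y. x \<in> H \<Longrightarrow> y \<in> H \<Longrightarrow> x \<oplus>\<^bsub>M\<^esub> y \<in> H"
    and "\<And>a x. a \<in> carrier R \<Longrightarrow> x \<in> H \<Longrightarrow> a \<odot>\<^bsub>M\<^esub> x \<in> H"
    and "\<And>x. x \<in> H \<Longrightarrow> \<ominus>\<^bsub>M\<^esub> x \<in> H"
proof -
  interpret H: submodule H R M by fact
  show sub: "H \<subseteq> carrier M" "\<zero>\<^bsub>M\<^esub> \<in> H"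
    using H.subset H.one_closed by auto
  show "\<And>x y. x \<in> H \<Longrightarrow> y \<in> H \<Longrightarrow> x \<oplus>\<^bsub>M\<^esub> y \<in> H"
    using H.m_closed by simp
  show smult: "\<And>a x. a \<in> carrier R \<Longrightarrow> x \<in> H \<Longrightarrow> a \<odot>\<^bsub>M\<^esub> x \<in> H"
    using H.smult_closed by simp
  show "\<And>x. x \<in> H \<Longrightarrow> \<ominus>\<^bsub>M\<^esub> x \<in> H"
    using sub(1) smult minus_eq_smult by auto
qed

lemma left_module_submodule:
  assumes "submodule H R M"
  shows "left_module R (M\<lparr>carrier := H\<rparr>)"
proof -
  note H = submoduleD[OF assms]
  then have [simp]: "x \<in> carrier M" if "x \<in> H" for x
    using that by auto
  have "\<exists>y\<in>H. y \<oplus>\<^bsub>M\<^esub> x = \<zero>\<^bsub>M\<^esub>" if "x \<in> H" for x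
    using that by (intro bexI[of _ "\<ominus>\<^bsub>M\<^esub> x"]) (auto simp: M.l_neg H)
  then have "abelian_group (M\<lparr>carrier := H\<rparr>)"
    by (intro abelian_groupI) (auto simp: H M.a_ac)
  then show ?thesis
    by (intro left_module.intro left_module_axioms.intro)
      (auto simp: H smult_l_distr smult_r_distr smult_assoc smult_one R.ring_axioms)
qed

lemma smult_finsum:
  assumes "finite B" "a \<in> carrier R" "g \<in> B \<rightarrow> carrier M"
  shows "a \<odot>\<^bsub>M\<^esub> finsum M g B = (\<Oplus>\<^bsub>M\<^esub>b\<in>B. a \<odot>\<^bsub>M\<^esub> g b)"
  using assms
proof (induction B)
  case empty
  then show ?case by (simp add: smult_zero_right)
next
  case (insert x F)
  then show ?case
    by (simp add: smult_r_distr smult_closed Pi_def)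
qed

lemma submodule_finsum:
  assumes "submodule H R M" "finite B" "\<And>b. b \<in> B \<Longrightarrow> g b \<in> H"
  shows "finsum M g B \<in> H"
  using assms(2,3)
proof (induction B)
  case empty
  then show ?case using submoduleD[OF assms(1)] by simp
next
  case (insert x F)
  moreover have "g \<in> insert x F \<rightarrow> carrier M"
    using insert submoduleD(1)[OF assms(1)] by auto
  ultimately show ?case
    using submoduleD(3)[OF assms(1)] by (simp add: Pi_def)
qed

lemma submodule_add:
  assumes "submodule H R M" "submodule L R M"
  shows "submodule (H <+>\<^bsub>M\<^esub> L) R M"
proof -
  note H = submoduleD[OF assms(1)] and L = submoduleD[OF assms(2)]
  have in_H: "x \<in> carrier M" if "x \<in> H" for x using that H by auto
  have in_L: "x \<in> carrier M" if "x \<in> L" for x using that L by auto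
  show ?thesis
  proof (rule submoduleI)
    show "H <+>\<^bsub>M\<^esub> L \<subseteq> carrier M"
      by (auto simp: set_add_def' in_H in_L)
    show "\<zero>\<^bsub>M\<^esub> \<in> H <+>\<^bsub>M\<^esub> L"
      using set_addI[OF H(2) L(2), of M] by simp
  next
    fix x y assume "x \<in> H <+>\<^bsub>M\<^esub> L" "y \<in> H <+>\<^bsub>M\<^esub> L"
    then obtain h l h' l' where *: "h \<in> H" "l \<in> L" "h' \<in> H" "l' \<in> L"
      and "x = h \<oplus>\<^bsub>M\<^esub> l" "y = h' \<oplus>\<^bsub>M\<^esub> l'"
      by (auto elim!: set_addE)
    then have "x \<oplus>\<^bsub>M\<^esub> y = (h \<oplus>\<^bsub>M\<^esub> h') \<oplus>\<^bsub>M\<^esub> (l \<oplus>\<^bsub>M\<^esub> l')"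
      by (simp add: in_H in_L M.a_ac)
    then show "x \<oplus>\<^bsub>M\<^esub> y \<in> H <+>\<^bsub>M\<^esub> L"
      using * by (auto intro!: set_addI H(3) L(3))
  next
    fix a x assume a: "a \<in> carrier R" and "x \<in> H <+>\<^bsub>M\<^esub> L"
    then obtain h l where *: "h \<in> H" "l \<in> L" and "x = h \<oplus>\<^bsub>M\<^esub> l"
      by (auto elim!: set_addE)
    then have "a \<odot>\<^bsub>M\<^esub> x = a \<odot>\<^bsub>M\<^esub> h \<oplus>\<^bsub>M\<^esub> a \<odot>\<^bsub>M\<^esub> l"
      by (simp add: in_H in_L smult_r_distr a)
    then show "a \<odot>\<^bsub>M\<^esub> x \<in> H <+>\<^bsub>M\<^esub> L"
      using * a by (auto intro!: set_addI H(4) L(4))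
  qed
qed

text \<open>Expressed through submodules, finite generation passes to direct sums and to tuples without
  any manipulation of coefficient families: it suffices to pull submodules back along the
  inclusions of the summands.\<close>

lemma finite_dim_iff_generated:
  "finite_dim R M \<longleftrightarrow>
    (\<exists>B. finite B \<and> B \<subseteq> carrier M \<and> (\<forall>S. submodule S R M \<and> B \<subseteq> S \<longrightarrow> carrier M \<subseteq> S))"
    (is "_ \<longleftrightarrow> ?gen")
proof
  assume "finite_dim R M"
  then obtain B where B: "finite B" "B \<subseteq> carrier M"
    "\<And>x. x \<in> carrier M \<Longrightarrow> \<exists>c\<in>B \<rightarrow> carrier R. x = (\<Oplus>\<^bsub>M\<^esub>b\<in>B. c b \<odot>\<^bsub>M\<^esub> b)"
    unfolding finite_dim_def by blast
  have "x \<in> S" if S: "submodule S R M" "B \<subseteq> S" and x: "x \<in> carrier M" for S x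
  proof -
    obtain c where "c \<in> B \<rightarrow> carrier R" "x = (\<Oplus>\<^bsub>M\<^esub>b\<in>B. c b \<odot>\<^bsub>M\<^esub> b)"
      using B(3)[OF x] by blast
    then show ?thesis
      using submodule_finsum[OF S(1) B(1), of "\<lambda>b. c b \<odot>\<^bsub>M\<^esub> b"] submoduleD(4)[OF S(1)] S(2) by auto
  qed
  with B(1,2) show ?gen by blast
next
  assume ?gen
  then obtain B where B: "finite B" "B \<subseteq> carrier M"
    and gen: "\<forall>S. submodule S R M \<and> B \<subseteq> S \<longrightarrow> carrier M \<subseteq> S"
    by (elim exE conjE)
  define comb where "comb c = (\<Oplus>\<^bsub>M\<^esub>b\<in>B. c b \<odot>\<^bsub>M\<^esub> b)" for c
  have c: "(\<lambda>b. c b \<odot>\<^bsub>M\<^esub> b) \<in> B \<rightarrow> carrier M" if "c \<in> B \<rightarrow> carrier R" for c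
    using that B by (auto intro!: smult_closed)
  define S where "S = comb ` (B \<rightarrow> carrier R)"
  have "submodule S R M"
  proof (rule submoduleI)
    show "S \<subseteq> carrier M"
      using c by (auto simp: S_def comb_def intro!: M.finsum_closed)
    have "comb (\<lambda>_. \<zero>\<^bsub>R\<^esub>) = (\<Oplus>\<^bsub>M\<^esub>b\<in>B. \<zero>\<^bsub>M\<^esub>)"
      unfolding comb_def using B by (intro M.finsum_cong') (auto simp: smult_zero_left)
    then show "\<zero>\<^bsub>M\<^esub> \<in> S"
      unfolding S_def by (intro image_eqI[of _ _ "\<lambda>_. \<zero>\<^bsub>R\<^esub>"]) auto
  next
    fix x y assume "x \<in> S" "y \<in> S"
    then obtain c d where cd: "c \<in> B \<rightarrow> carrier R" "d \<in> B \<rightarrow> carrier R" and "x = comb c" "y = comb d"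
      unfolding S_def by blast
    then have "x \<oplus>\<^bsub>M\<^esub> y = (\<Oplus>\<^bsub>M\<^esub>b\<in>B. c b \<odot>\<^bsub>M\<^esub> b \<oplus>\<^bsub>M\<^esub> d b \<odot>\<^bsub>M\<^esub> b)"
      unfolding comb_def using c B by (simp add: M.finsum_addf)
    also have "\<dots> = comb (\<lambda>b. c b \<oplus>\<^bsub>R\<^esub> d b)"
      unfolding comb_def using c[of c] c[of d] cd B
      by (intro M.finsum_cong') (auto simp: smult_l_distr Pi_def subset_iff intro!: smult_closed)
    finally show "x \<oplus>\<^bsub>M\<^esub> y \<in> S"
      using cd by (auto simp: S_def Pi_def)
  next
    fix a x assume a: "a \<in> carrier R" and "x \<in> S"
    then obtain d where d: "d \<in> B \<rightarrow> carrier R" and "x = comb d"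
      unfolding S_def by blast
    then have "a \<odot>\<^bsub>M\<^esub> x = (\<Oplus>\<^bsub>M\<^esub>b\<in>B. a \<odot>\<^bsub>M\<^esub> (d b \<odot>\<^bsub>M\<^esub> b))"
      unfolding comb_def using c B a by (simp add: smult_finsum)
    also have "\<dots> = comb (\<lambda>b. a \<otimes>\<^bsub>R\<^esub> d b)"
      unfolding comb_def using d B a
      by (intro M.finsum_cong') (auto simp: smult_assoc Pi_def subset_iff intro!: smult_closed)
    finally show "a \<odot>\<^bsub>M\<^esub> x \<in> S"
      using d a by (auto simp: S_def Pi_def)
  qed
  moreover have "B \<subseteq> S"
  proof
    fix x assume x: "x \<in> B"
    have "comb (\<lambda>b. if b = x then \<one>\<^bsub>R\<^esub> else \<zero>\<^bsub>R\<^esub>) = (\<Oplus>\<^bsub>M\<^esub>b\<in>B. if x = b then b else \<zero>\<^bsub>M\<^esub>)"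
      unfolding comb_def using B
      by (intro M.finsum_cong') (auto simp: smult_zero_left smult_one)
    also have "\<dots> = x"
      using x B by (subst M.finsum_singleton[where f = "\<lambda>b. b"]) auto
    finally show "x \<in> S"
      unfolding S_def by (intro image_eqI[of _ _ "\<lambda>b. if b = x then \<one>\<^bsub>R\<^esub> else \<zero>\<^bsub>R\<^esub>"]) auto
  qed
  ultimately have "carrier M \<subseteq> S"
    using gen by simp
  then show "finite_dim R M"
    unfolding finite_dim_def S_def comb_def using B by (intro exI[of _ B]) auto
qed

end

lemma mhomI:
  assumes "\<And>x. x \<in> carrier M \<Longrightarrow> h x \<in> carrier N"
    and "\<And>x y. x \<in> carrier M \<Longrightarrow> y \<in> carrier M \<Longrightarrow> h (x \<oplus>\<^bsub>M\<^esub> y) = h x \<oplus>\<^bsub>N\<^esub> h y"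
    and "\<And>a x. a \<in> carrier R \<Longrightarrow> x \<in> carrier M \<Longrightarrow> h (a \<odot>\<^bsub>M\<^esub> x) = a \<odot>\<^bsub>N\<^esub> h x"
  shows "h \<in> mhom R M N"
  using assms by (auto simp: mhom_def)

lemma mhomD:
  assumes "h \<in> mhom R M N"
  shows "\<And>x. x \<in> carrier M \<Longrightarrow> h x \<in> carrier N"
    and "\<And>x y. x \<in> carrier M \<Longrightarrow> y \<in> carrier M \<Longrightarrow> h (x \<oplus>\<^bsub>M\<^esub> y) = h x \<oplus>\<^bsub>N\<^esub> h y"
    and "\<And>a x. a \<in> carrier R \<Longrightarrow> x \<in> carrier M \<Longrightarrow> h (a \<odot>\<^bsub>M\<^esub> x) = a \<odot>\<^bsub>N\<^esub> h x"
  using assms by (auto simp: mhom_def)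

lemma mhom_zero:
  assumes "h \<in> mhom R M N" "left_module R M" "left_module R N"
  shows "h \<zero>\<^bsub>M\<^esub> = \<zero>\<^bsub>N\<^esub>"
proof -
  interpret M: left_module R M by fact
  interpret N: left_module R N by fact
  note h = mhomD[OF assms(1)]
  have "h (\<zero>\<^bsub>R\<^esub> \<odot>\<^bsub>M\<^esub> \<zero>\<^bsub>M\<^esub>) = \<zero>\<^bsub>R\<^esub> \<odot>\<^bsub>N\<^esub> h \<zero>\<^bsub>M\<^esub>"
    using h by simp
  then show ?thesis
    using h by (simp add: M.smult_zero_right N.smult_zero_left)
qed

lemma mhom_minus:
  assumes "h \<in> mhom R M N" "left_module R M" "left_module R N" "x \<in> carrier M"
  shows "h (\<ominus>\<^bsub>M\<^esub> x) = \<ominus>\<^bsub>N\<^esub> h x"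
proof -
  interpret M: left_module R M by fact
  interpret N: left_module R N by fact
  note h = mhomD[OF assms(1)]
  show ?thesis
    using h assms(4) by (simp add: M.minus_eq_smult N.minus_eq_smult)
qed

lemma mhom_finsum:
  assumes "h \<in> mhom R M N" "left_module R M" "left_module R N"
    and "finite B" "g \<in> B \<rightarrow> carrier M"
  shows "h (finsum M g B) = (\<Oplus>\<^bsub>N\<^esub>b\<in>B. h (g b))"
  using assms(4,5)
proof (induction B)
  interpret M: left_module R M by fact
  interpret N: left_module R N by fact
  case empty
  then show ?case using mhom_zero[OF assms(1-3)] by simp
next
  interpret M: left_module R M by fact
  interpret N: left_module R N by fact
  case (insert x F)
  then show ?case using mhomD[OF assms(1)] by (simp add: Pi_def)
qed

lemma mhom_image_submodule:
  assumes "h \<in> mhom R M N" "left_module R M" "left_module R N" "submodule H R M"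
  shows "submodule (h ` H) R N"
proof -
  interpret M: left_module R M by fact
  interpret N: left_module R N by fact
  note h = mhomD[OF assms(1)] and H = M.submoduleD[OF assms(4)]
  have H': "x \<in> carrier M" if "x \<in> H" for x using that H by auto
  show ?thesis
  proof (rule N.submoduleI)
    show "\<zero>\<^bsub>N\<^esub> \<in> h ` H"
      using H(2) mhom_zero[OF assms(1-3)] by force
    show "x \<oplus>\<^bsub>N\<^esub> y \<in> h ` H" if "x \<in> h ` H" "y \<in> h ` H" for x y
      using that H(3) h(2) H' by (auto simp flip: h(2))
    show "a \<odot>\<^bsub>N\<^esub> x \<in> h ` H" if "a \<in> carrier R" "x \<in> h ` H" for a x
      using that H(4) h(3) H' by (auto simp flip: h(3))
  qed (auto simp: h H')
qed

lemma mhom_vimage_submodule: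
  assumes "h \<in> mhom R M N" "left_module R M" "left_module R N" "submodule H R N"
  shows "submodule {x \<in> carrier M. h x \<in> H} R M"
proof -
  interpret M: left_module R M by fact
  interpret N: left_module R N by fact
  note h = mhomD[OF assms(1)] and H = N.submoduleD[OF assms(4)]
  show ?thesis
    by (rule M.submoduleI) (auto simp: h H mhom_zero[OF assms(1-3)] M.smult_closed)
qed

lemma carrier_submodule:
  assumes "left_module R M"
  shows "submodule (carrier M) R M"
proof -
  interpret left_module R M by fact
  show ?thesis by (rule submoduleI) (auto simp: smult_closed)
qed

section \<open>Superfluous submodules\<close>

context left_module
begin

lemma superfluousD:
  assumes "superfluous R M N" "N \<subseteq> carrier M" "submodule S R M"
    and "\<And>x. x \<in> carrier M \<Longrightarrow> \<exists>s\<in>S. \<exists>n\<in>N. x = s \<oplus>\<^bsub>M\<^esub> n"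
  shows "S = carrier M"
proof -
  have "S <+>\<^bsub>M\<^esub> N \<subseteq> carrier M"
    using assms(2) submoduleD(1)[OF assms(3)] by (auto simp: set_add_def')
  moreover have "carrier M \<subseteq> S <+>\<^bsub>M\<^esub> N"
    using assms(4) by (auto dest!: assms(4) intro: set_addI)
  ultimately show ?thesis
    using assms(1,3) unfolding superfluous_def by blast
qed

lemma superfluousI:
  assumes "\<And>S. submodule S R M \<Longrightarrow> (\<And>x. x \<in> carrier M \<Longrightarrow> \<exists>s\<in>S. \<exists>n\<in>N. x = s \<oplus>\<^bsub>M\<^esub> n)
    \<Longrightarrow> carrier M \<subseteq> S"
  shows "superfluous R M N"
  unfolding superfluous_def
proof (intro allI impI, elim conjE)
  fix S assume S: "submodule S R M" "S <+>\<^bsub>M\<^esub> N = carrier M"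
  have "\<exists>s\<in>S. \<exists>n\<in>N. x = s \<oplus>\<^bsub>M\<^esub> n" if "x \<in> carrier M" for x
    using that unfolding S(2)[symmetric] by (auto elim!: set_addE)
  then show "S = carrier M"
    using assms[OF S(1)] submoduleD(1)[OF S(1)] by blast
qed

lemma superfluous_subset:
  assumes "superfluous R M N" "N \<subseteq> carrier M" "L \<subseteq> N"
  shows "superfluous R M L"
proof (rule superfluousI)
  fix S assume "submodule S R M" "\<And>x. x \<in> carrier M \<Longrightarrow> \<exists>s\<in>S. \<exists>n\<in>L. x = s \<oplus>\<^bsub>M\<^esub> n"
  then show "carrier M \<subseteq> S"
    using superfluousD[OF assms(1,2), of S] assms(3) by blast
qed

lemma superfluous_add:
  assumes "superfluous R M N" "submodule N R M" "superfluous R M L" "L \<subseteq> carrier M"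
  shows "superfluous R M (N <+>\<^bsub>M\<^esub> L)"
proof (rule superfluousI)
  fix S assume S: "submodule S R M"
    and *: "\<And>x. x \<in> carrier M \<Longrightarrow> \<exists>s\<in>S. \<exists>n\<in>N <+>\<^bsub>M\<^esub> L. x = s \<oplus>\<^bsub>M\<^esub> n"
  note Sin = subsetD[OF submoduleD(1)[OF S]] and Nin = subsetD[OF submoduleD(1)[OF assms(2)]]
  have "\<exists>s\<in>S <+>\<^bsub>M\<^esub> N. \<exists>l\<in>L. x = s \<oplus>\<^bsub>M\<^esub> l" if x: "x \<in> carrier M" for x
  proof -
    obtain s n l where "s \<in> S" "n \<in> N" "l \<in> L" "x = s \<oplus>\<^bsub>M\<^esub> (n \<oplus>\<^bsub>M\<^esub> l)"
      using *[OF x] by (auto elim!: set_addE)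
    moreover from this have "x = (s \<oplus>\<^bsub>M\<^esub> n) \<oplus>\<^bsub>M\<^esub> l"
      using Sin Nin assms(4) by (simp add: M.a_assoc subset_iff)
    ultimately show ?thesis
      by (metis set_addI)
  qed
  then have "S <+>\<^bsub>M\<^esub> N = carrier M"
    using superfluousD[OF assms(3,4) submodule_add[OF S assms(2)]] by blast
  then show "carrier M \<subseteq> S"
    using assms(1) S unfolding superfluous_def by blast
qed

end

text \<open>If \<open>S + h(L) = N\<close>, then \<open>h\<^sup>-\<^sup>1(S) + L = M\<close>, so \<open>h\<^sup>-\<^sup>1(S)\<close> is everything and \<open>S\<close> already
  contains \<open>h(L)\<close>.\<close>

lemma superfluous_image:
  assumes h: "h \<in> mhom R M N" and M: "left_module R M" and N: "left_module R N"
    and sup: "superfluous R M L" and L: "L \<subseteq> carrier M"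
  shows "superfluous R N (h ` L)"
proof -
  interpret M: left_module R M by fact
  interpret N: left_module R N by fact
  note hD = mhomD[OF h]
  show ?thesis
  proof (rule N.superfluousI)
    fix S assume S: "submodule S R N"
      and *: "\<And>x. x \<in> carrier N \<Longrightarrow> \<exists>s\<in>S. \<exists>n\<in>h ` L. x = s \<oplus>\<^bsub>N\<^esub> n"
    note SD = N.submoduleD[OF S]
    have "{x \<in> carrier M. h x \<in> S} = carrier M"
    proof (rule M.superfluousD[OF sup L mhom_vimage_submodule[OF h M N S]])
      fix x assume x: "x \<in> carrier M"
      then obtain s l where s: "s \<in> S" and l: "l \<in> L" and eq: "h x = s \<oplus>\<^bsub>N\<^esub> h l"
        using *[of "h x"] hD(1) by blast
      have lM: "l \<in> carrier M" and sN: "s \<in> carrier N"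
        using l L s SD(1) by auto
      have "h (x \<oplus>\<^bsub>M\<^esub> \<ominus>\<^bsub>M\<^esub> l) = s"
        using x lM sN eq by (simp add: hD mhom_minus[OF h M N] N.M.a_assoc N.M.r_neg)
      moreover have "x = (x \<oplus>\<^bsub>M\<^esub> \<ominus>\<^bsub>M\<^esub> l) \<oplus>\<^bsub>M\<^esub> l"
        using x lM by (simp add: M.M.a_assoc M.M.l_neg)
      ultimately show "\<exists>s\<in>{x \<in> carrier M. h x \<in> S}. \<exists>n\<in>L. x = s \<oplus>\<^bsub>M\<^esub> n"
        using s l x lM by (intro bexI[of _ "x \<oplus>\<^bsub>M\<^esub> \<ominus>\<^bsub>M\<^esub> l"] bexI[of _ l]) auto
    qed
    then have hS: "h l \<in> S" if "l \<in> L" for l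
      using that L by auto
    show "carrier N \<subseteq> S"
    proof
      fix x assume "x \<in> carrier N"
      then show "x \<in> S" using *[of x] hS SD(3) by blast
    qed
  qed
qed

section \<open>Projectivity from a finite dual basis\<close>

text \<open>A finite dual basis presents \<open>P\<close> as a retract of a free module; the lift of \<open>h\<close> sends \<open>x\<close> to
  the sum of the \<open>s\<^sub>j(x)\<close> times chosen preimages of the \<open>h(p\<^sub>j)\<close>.\<close>

lemma projective_dual_basis:
  fixes p :: "'j \<Rightarrow> 'm" and s :: "'j \<Rightarrow> 'm \<Rightarrow> 'r"
  assumes P: "left_module R P" and J: "finite J"
    and p: "\<And>j. j \<in> J \<Longrightarrow> p j \<in> carrier P"
    and s: "\<And>j x. j \<in> J \<Longrightarrow> x \<in> carrier P \<Longrightarrow> s j x \<in> carrier R"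
    and s_add: "\<And>j x y. j \<in> J \<Longrightarrow> x \<in> carrier P \<Longrightarrow> y \<in> carrier P \<Longrightarrow> s j (x \<oplus>\<^bsub>P\<^esub> y) = s j x \<oplus>\<^bsub>R\<^esub> s j y"
    and s_smult: "\<And>j a x. j \<in> J \<Longrightarrow> a \<in> carrier R \<Longrightarrow> x \<in> carrier P \<Longrightarrow>
      s j (a \<odot>\<^bsub>P\<^esub> x) = a \<otimes>\<^bsub>R\<^esub> s j x"
    and dual: "\<And>x. x \<in> carrier P \<Longrightarrow> (\<Oplus>\<^bsub>P\<^esub>j\<in>J. s j x \<odot>\<^bsub>P\<^esub> p j) = x"
  shows "projective TYPE('n) R P"
  unfolding projective_def
proof (intro conjI allI impI P, elim conjE)
  fix N L :: "('r, 'n) module" and g h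
  assume N: "left_module R N" and L: "left_module R L" and g: "g \<in> mhom R N L"
    and surj: "g ` carrier N = carrier L" and h: "h \<in> mhom R P L"
  interpret P: left_module R P by fact
  interpret N: left_module R N by fact
  interpret L: left_module R L by fact
  have "\<exists>n\<in>carrier N. g n = h (p j)" if "j \<in> J" for j
  proof -
    have "h (p j) \<in> g ` carrier N"
      unfolding surj by (rule mhomD(1)[OF h p[OF that]])
    then show ?thesis by (auto simp: image_iff)
  qed
  then obtain q where q: "\<And>j. j \<in> J \<Longrightarrow> q j \<in> carrier N" and gq: "\<And>j. j \<in> J \<Longrightarrow> g (q j) = h (p j)"
    by metis
  define l where "l x = (\<Oplus>\<^bsub>N\<^esub>j\<in>J. s j x \<odot>\<^bsub>N\<^esub> q j)" for x
  have sq: "(\<lambda>j. s j x \<odot>\<^bsub>N\<^esub> q j) \<in> J \<rightarrow> carrier N" if "x \<in> carrier P" for x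
    using that s q by (auto intro!: N.smult_closed)
  have "l \<in> mhom R P N"
  proof (rule mhomI)
    show "l x \<in> carrier N" if "x \<in> carrier P" for x
      unfolding l_def using sq[OF that] by (rule N.finsum_closed)
  next
    fix x y assume xy: "x \<in> carrier P" "y \<in> carrier P"
    have "l (x \<oplus>\<^bsub>P\<^esub> y) = (\<Oplus>\<^bsub>N\<^esub>j\<in>J. s j x \<odot>\<^bsub>N\<^esub> q j \<oplus>\<^bsub>N\<^esub> s j y \<odot>\<^bsub>N\<^esub> q j)"
      unfolding l_def using xy s q
      by (intro N.M.finsum_cong') (auto simp: s_add N.smult_l_distr N.smult_closed)
    then show "l (x \<oplus>\<^bsub>P\<^esub> y) = l x \<oplus>\<^bsub>N\<^esub> l y"
      unfolding l_def using sq xy by (simp add: N.M.finsum_addf)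
  next
    fix a x assume a: "a \<in> carrier R" and x: "x \<in> carrier P"
    have "l (a \<odot>\<^bsub>P\<^esub> x) = (\<Oplus>\<^bsub>N\<^esub>j\<in>J. a \<odot>\<^bsub>N\<^esub> (s j x \<odot>\<^bsub>N\<^esub> q j))"
      unfolding l_def using a x s q
      by (intro N.M.finsum_cong') (auto simp: s_smult N.smult_assoc N.smult_closed)
    then show "l (a \<odot>\<^bsub>P\<^esub> x) = a \<odot>\<^bsub>N\<^esub> l x"
      unfolding l_def using sq x a J by (simp add: N.smult_finsum)
  qed
  moreover have "g (l x) = h x" if x: "x \<in> carrier P" for x
  proof -
    have "g (l x) = (\<Oplus>\<^bsub>L\<^esub>j\<in>J. g (s j x \<odot>\<^bsub>N\<^esub> q j))"
      unfolding l_def by (rule mhom_finsum[OF g N L J sq[OF x]])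
    also have "\<dots> = (\<Oplus>\<^bsub>L\<^esub>j\<in>J. h (s j x \<odot>\<^bsub>P\<^esub> p j))"
      using x s q p gq by (intro L.M.finsum_cong')
        (auto simp: mhomD(3)[OF g] mhomD(3)[OF h] mhomD(1)[OF h] L.smult_closed P.smult_closed)
    also have "\<dots> = h (\<Oplus>\<^bsub>P\<^esub>j\<in>J. s j x \<odot>\<^bsub>P\<^esub> p j)"
      using x s p by (intro mhom_finsum[OF h P L J, symmetric]) (auto intro!: P.smult_closed)
    also have "\<dots> = h x"
      by (simp add: dual[OF x])
    finally show ?thesis .
  qed
  ultimately show "\<exists>l\<in>mhom R P N. \<forall>x\<in>carrier P. g (l x) = h x"
    by blast
qed

section \<open>Finite direct sums\<close>

lemma mk_module_simps [simp]:
  "carrier (mk_module C z p s) = C" "zero (mk_module C z p s) = z"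
  "add (mk_module C z p s) = p" "smult (mk_module C z p s) = s"
  by (simp_all add: mk_module_def)

lemma direct_sum_simps [simp]:
  "carrier (direct_sum I M) = (\<Pi>\<^sub>E i\<in>I. carrier (M i))"
  "\<zero>\<^bsub>direct_sum I M\<^esub> = (\<lambda>i\<in>I. \<zero>\<^bsub>M i\<^esub>)"
  "x \<oplus>\<^bsub>direct_sum I M\<^esub> y = (\<lambda>i\<in>I. x i \<oplus>\<^bsub>M i\<^esub> y i)"
  "a \<odot>\<^bsub>direct_sum I M\<^esub> x = (\<lambda>i\<in>I. a \<odot>\<^bsub>M i\<^esub> x i)"
  by (simp_all add: direct_sum_def)

lemma restrict_eq_PiE:
  assumes "x \<in> Pi\<^sub>E I B" "\<And>i. i \<in> I \<Longrightarrow> g i = x i"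
  shows "restrict g I = x"
proof
  show "restrict g I i = x i" for i
    using assms(2)[of i] PiE_arb[OF assms(1), of i] by (cases "i \<in> I") auto
qed

lemma left_module_direct_sum:
  assumes "ring R" "\<And>i. i \<in> I \<Longrightarrow> left_module R (M i)"
  shows "left_module R (direct_sum I M)"
proof -
  interpret R: ring R by fact
  have ab: "abelian_group (M i)" if "i \<in> I" for i
    using assms(2)[OF that] left_module.axioms(2) by blast
  note ag = abelian_groupE[OF ab] and lm = left_module.smult_closed[OF assms(2)]
    left_module.smult_l_distr[OF assms(2)] left_module.smult_r_distr[OF assms(2)]
    left_module.smult_assoc[OF assms(2)] left_module.smult_one[OF assms(2)]
  have "abelian_group (direct_sum I M)"
  proof (rule abelian_groupI)
    fix x y z
    assume x: "x \<in> carrier (direct_sum I M)" and y: "y \<in> carrier (direct_sum I M)"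
      and z: "z \<in> carrier (direct_sum I M)"
    note xyz = PiE_mem[OF x[unfolded direct_sum_simps]] PiE_mem[OF y[unfolded direct_sum_simps]]
      PiE_mem[OF z[unfolded direct_sum_simps]]
    show "x \<oplus>\<^bsub>direct_sum I M\<^esub> y \<in> carrier (direct_sum I M)"
      using xyz by (auto simp: ag(1))
    show "x \<oplus>\<^bsub>direct_sum I M\<^esub> y \<oplus>\<^bsub>direct_sum I M\<^esub> z = x \<oplus>\<^bsub>direct_sum I M\<^esub> (y \<oplus>\<^bsub>direct_sum I M\<^esub> z)"
      using xyz by (auto simp: ag(3) intro!: restrict_ext)
    show "x \<oplus>\<^bsub>direct_sum I M\<^esub> y = y \<oplus>\<^bsub>direct_sum I M\<^esub> x"
      using xyz by (auto simp: ag(4) intro!: restrict_ext)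
    show "\<zero>\<^bsub>direct_sum I M\<^esub> \<oplus>\<^bsub>direct_sum I M\<^esub> x = x"
      using xyz unfolding direct_sum_simps
      by (intro restrict_eq_PiE[OF x[unfolded direct_sum_simps]]) (simp add: ag(5))
    have "(\<lambda>i\<in>I. \<ominus>\<^bsub>M i\<^esub> x i) \<oplus>\<^bsub>direct_sum I M\<^esub> x = \<zero>\<^bsub>direct_sum I M\<^esub>"
      using xyz by (auto simp: abelian_group.l_neg[OF ab] intro!: restrict_ext)
    moreover have "(\<lambda>i\<in>I. \<ominus>\<^bsub>M i\<^esub> x i) \<in> carrier (direct_sum I M)"
      using xyz by (auto intro!: abelian_group.a_inv_closed[OF ab])
    ultimately show "\<exists>y\<in>carrier (direct_sum I M). y \<oplus>\<^bsub>direct_sum I M\<^esub> x = \<zero>\<^bsub>direct_sum I M\<^esub>"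
      by blast
  qed (auto simp: ag(2))
  moreover have "left_module_axioms R (direct_sum I M)"
  proof (rule left_module_axioms.intro)
    fix a b x y
    assume a: "a \<in> carrier R" and b: "b \<in> carrier R"
      and x: "x \<in> carrier (direct_sum I M)" and y: "y \<in> carrier (direct_sum I M)"
    note xy = PiE_mem[OF x[unfolded direct_sum_simps]] PiE_mem[OF y[unfolded direct_sum_simps]]
    show "a \<odot>\<^bsub>direct_sum I M\<^esub> x \<in> carrier (direct_sum I M)"
      using a xy by (auto simp: lm)
    show "(a \<oplus>\<^bsub>R\<^esub> b) \<odot>\<^bsub>direct_sum I M\<^esub> x
        = a \<odot>\<^bsub>direct_sum I M\<^esub> x \<oplus>\<^bsub>direct_sum I M\<^esub> b \<odot>\<^bsub>direct_sum I M\<^esub> x"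
      using a b xy by (auto simp: lm intro!: restrict_ext)
    show "a \<odot>\<^bsub>direct_sum I M\<^esub> (x \<oplus>\<^bsub>direct_sum I M\<^esub> y)
        = a \<odot>\<^bsub>direct_sum I M\<^esub> x \<oplus>\<^bsub>direct_sum I M\<^esub> a \<odot>\<^bsub>direct_sum I M\<^esub> y"
      using a xy by (auto simp: lm intro!: restrict_ext)
    show "(a \<otimes>\<^bsub>R\<^esub> b) \<odot>\<^bsub>direct_sum I M\<^esub> x = a \<odot>\<^bsub>direct_sum I M\<^esub> (b \<odot>\<^bsub>direct_sum I M\<^esub> x)"
      using a b xy by (auto simp: lm intro!: restrict_ext)
  next
    fix x assume x: "x \<in> carrier (direct_sum I M)"
    show "\<one>\<^bsub>R\<^esub> \<odot>\<^bsub>direct_sum I M\<^esub> x = x"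
      using PiE_mem[OF x[unfolded direct_sum_simps]] unfolding direct_sum_simps
      by (intro restrict_eq_PiE[OF x[unfolded direct_sum_simps]]) (simp add: lm)
  qed
  ultimately show ?thesis
    using assms(1) by (intro left_module.intro)
qed

definition summand_inj :: "'i set \<Rightarrow> ('i \<Rightarrow> ('r, 'm) module) \<Rightarrow> 'i \<Rightarrow> 'm \<Rightarrow> 'i \<Rightarrow> 'm" where
  "summand_inj I M k q = (\<lambda>i\<in>I. if i = k then q else \<zero>\<^bsub>M i\<^esub>)"

locale finite_direct_sum =
  fixes R :: "('r, 'x) ring_scheme" and I :: "'i set" and M :: "'i \<Rightarrow> ('r, 'm) module"
  assumes ring: "ring R" and finite: "finite I" and summand: "\<And>i. i \<in> I \<Longrightarrow> left_module R (M i)"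
begin

sublocale D: left_module R "direct_sum I M"
  by (rule left_module_direct_sum[OF ring summand])

lemmas summand_add = abelian_groupE(1,2,5)[OF left_module.axioms(2)[OF summand]]

lemma summand_inj_mhom:
  assumes "k \<in> I"
  shows "summand_inj I M k \<in> mhom R (M k) (direct_sum I M)"
  by (rule mhomI) (auto simp: summand_inj_def summand_add left_module.smult_zero_right[OF summand]
    intro!: restrict_ext)

lemma mem_submodule_if_components:
  assumes S: "submodule S R (direct_sum I M)" and x: "x \<in> carrier (direct_sum I M)"
    and inj: "\<And>i. i \<in> I \<Longrightarrow> summand_inj I M i (x i) \<in> S"
  shows "x \<in> S"
proof -
  note SD = D.submoduleD[OF S]
  have xi: "x i \<in> carrier (M i)" if "i \<in> I" for i
    using x that by auto
  have "(\<lambda>i\<in>I. if i \<in> F then x i else \<zero>\<^bsub>M i\<^esub>) \<in> S" if "finite F" "F \<subseteq> I" for F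
    using that
  proof (induction F)
    case empty
    then show ?case using SD(2) by (simp add: restrict_def)
  next
    case (insert k F)
    have IH: "(\<lambda>i\<in>I. if i \<in> F then x i else \<zero>\<^bsub>M i\<^esub>) \<in> S"
      using insert by (intro insert.IH) auto
    have *: "(\<lambda>i\<in>I. if i \<in> insert k F then x i else \<zero>\<^bsub>M i\<^esub>) =
      (\<lambda>i\<in>I. if i \<in> F then x i else \<zero>\<^bsub>M i\<^esub>) \<oplus>\<^bsub>direct_sum I M\<^esub> summand_inj I M k (x k)"
      using insert.hyps xi by (auto simp: summand_inj_def summand_add abelian_monoid.r_zero[OF
        abelian_group.axioms(1)[OF left_module.axioms(2)[OF summand]]] intro!: restrict_ext)
    show ?case
      unfolding * by (rule SD(3)[OF IH inj]) (use insert in simp)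
  qed
  from this[of I] finite have "(\<lambda>i\<in>I. if i \<in> I then x i else \<zero>\<^bsub>M i\<^esub>) \<in> S"
    by simp
  moreover have "(\<lambda>i\<in>I. if i \<in> I then x i else \<zero>\<^bsub>M i\<^esub>) = x"
    by (rule restrict_eq_PiE[OF x[unfolded direct_sum_simps]]) simp
  ultimately show ?thesis by simp
qed

lemma finite_dim_direct_sum:
  assumes "\<And>i. i \<in> I \<Longrightarrow> finite_dim R (M i)"
  shows "finite_dim R (direct_sum I M)"
proof -
  have "\<exists>B. finite B \<and> B \<subseteq> carrier (M i)
      \<and> (\<forall>S. submodule S R (M i) \<and> B \<subseteq> S \<longrightarrow> carrier (M i) \<subseteq> S)" if "i \<in> I" for i
    using assms[OF that] left_module.finite_dim_iff_generated[OF summand[OF that]] by simp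
  then obtain B where B: "\<And>i. i \<in> I \<Longrightarrow> Finite_Set.finite (B i)" "\<And>i. i \<in> I \<Longrightarrow> B i \<subseteq> carrier (M i)"
    and gen: "\<And>i S. i \<in> I \<Longrightarrow> submodule S R (M i) \<Longrightarrow> B i \<subseteq> S \<Longrightarrow> carrier (M i) \<subseteq> S"
    by metis
  let ?B = "\<Union>i\<in>I. summand_inj I M i ` B i"
  show ?thesis
    unfolding D.finite_dim_iff_generated
  proof (intro exI[of _ ?B] conjI allI impI)
    show "Finite_Set.finite ?B"
      using finite B by auto
    show "?B \<subseteq> carrier (direct_sum I M)"
      using B(2) mhomD(1)[OF summand_inj_mhom] by blast
    fix S assume "submodule S R (direct_sum I M) \<and> ?B \<subseteq> S"
    then have S: "submodule S R (direct_sum I M)" and BS: "?B \<subseteq> S"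
      by auto
    have *: "summand_inj I M i q \<in> S" if i: "i \<in> I" and q: "q \<in> carrier (M i)" for i q
    proof -
      have "carrier (M i) \<subseteq> {q \<in> carrier (M i). summand_inj I M i q \<in> S}"
        using BS B(2)[OF i] i
        by (intro gen[OF i mhom_vimage_submodule[OF summand_inj_mhom[OF i] summand[OF i] D.left_module_axioms S]])
          auto
      then show ?thesis using q by auto
    qed
    show "carrier (direct_sum I M) \<subseteq> S"
    proof
      fix x assume x: "x \<in> carrier (direct_sum I M)"
      then show "x \<in> S"
        by (intro mem_submodule_if_components[OF S x] *) auto
    qed
  qed
qed

text \<open>The product of the \<open>N\<^sub>i\<close> is the sum of their images under the inclusions of the summands, and
  images and finite sums of superfluous submodules are superfluous.  The induction runs over the
  set \<open>F\<close> of those indices that have been admitted to the sum.\<close>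

lemma superfluous_direct_sum:
  assumes N: "\<And>i. i \<in> I \<Longrightarrow> submodule (N i) R (M i)" "\<And>i. i \<in> I \<Longrightarrow> superfluous R (M i) (N i)"
  shows "superfluous R (direct_sum I M) (\<Pi>\<^sub>E i\<in>I. N i)"
proof -
  note ND = left_module.submoduleD[OF summand N(1)]
  have zero: "superfluous R (direct_sum I M) {\<zero>\<^bsub>direct_sum I M\<^esub>}"
    using D.submoduleD(1) by (intro D.superfluousI) (force simp del: direct_sum_simps)
  have "superfluous R (direct_sum I M) (\<Pi>\<^sub>E i\<in>I. if i \<in> F then N i else {\<zero>\<^bsub>M i\<^esub>})"
    if "Finite_Set.finite F" "F \<subseteq> I" for F
    using that
  proof (induction F)
    case empty
    have "(\<Pi>\<^sub>E i\<in>I. if i \<in> {} then N i else {\<zero>\<^bsub>M i\<^esub>}) \<subseteq> {\<zero>\<^bsub>direct_sum I M\<^esub>}"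
      by (auto simp: fun_eq_iff PiE_iff extensional_def)
    then show ?case
      using zero by (rule D.superfluous_subset[rotated 2]) (simp del: direct_sum_simps)
  next
    case (insert k F)
    let ?L = "\<Pi>\<^sub>E i\<in>I. if i \<in> F then N i else {\<zero>\<^bsub>M i\<^esub>}"
    have k: "k \<in> I" using insert by simp
    note inj = summand_inj_mhom[OF k]
    have sub: "submodule (summand_inj I M k ` N k) R (direct_sum I M)"
      by (rule mhom_image_submodule[OF inj summand[OF k] D.left_module_axioms N(1)[OF k]])
    have L: "?L \<subseteq> carrier (direct_sum I M)"
      unfolding direct_sum_simps by (intro PiE_mono) (auto simp: summand_add intro: subsetD[OF ND(1)])
    have "superfluous R (direct_sum I M) (summand_inj I M k ` N k <+>\<^bsub>direct_sum I M\<^esub> ?L)"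
      using insert
      by (intro D.superfluous_add sub L superfluous_image[OF inj summand[OF k] D.left_module_axioms]
        N(2) ND(1) k) auto
    moreover have "summand_inj I M k ` N k <+>\<^bsub>direct_sum I M\<^esub> ?L \<subseteq> carrier (direct_sum I M)"
      using D.submoduleD(1)[OF sub] L unfolding set_add_def' by (blast intro: D.M.a_closed)
    moreover have "(\<Pi>\<^sub>E i\<in>I. if i \<in> insert k F then N i else {\<zero>\<^bsub>M i\<^esub>})
      \<subseteq> summand_inj I M k ` N k <+>\<^bsub>direct_sum I M\<^esub> ?L"
    proof
      fix x assume x: "x \<in> (\<Pi>\<^sub>E i\<in>I. if i \<in> insert k F then N i else {\<zero>\<^bsub>M i\<^esub>})"
      define y where "y = (\<lambda>i\<in>I. if i = k then \<zero>\<^bsub>M i\<^esub> else x i)"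
      have xi: "x i \<in> (if i \<in> insert k F then N i else {\<zero>\<^bsub>M i\<^esub>})" if "i \<in> I" for i
        using x that by (rule PiE_mem)
      then have xM: "x i \<in> carrier (M i)" if "i \<in> I" for i
        using ND(1,2) that by (fastforce split: if_splits simp: summand_add)
      have "y \<in> ?L"
      proof (rule PiE_I)
        show "y i \<in> (if i \<in> F then N i else {\<zero>\<^bsub>M i\<^esub>})" if "i \<in> I" for i
          using xi[OF that] that insert.hyps by (auto simp: y_def split: if_splits)
      qed (simp add: y_def)
      moreover have "x k \<in> N k"
        using xi[OF k] by simp
      moreover have "x = summand_inj I M k (x k) \<oplus>\<^bsub>direct_sum I M\<^esub> y"
        unfolding direct_sum_simps using xM k
        by (intro restrict_eq_PiE[OF x, symmetric]) (auto simp: y_def summand_inj_def summand_add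
          abelian_monoid.r_zero[OF abelian_group.axioms(1)[OF left_module.axioms(2)[OF summand]]])
      ultimately show "x \<in> summand_inj I M k ` N k <+>\<^bsub>direct_sum I M\<^esub> ?L"
        using set_addI[of "summand_inj I M k (x k)" "summand_inj I M k ` N k" y ?L "direct_sum I M"] by auto
    qed
    ultimately show ?case
      by (rule D.superfluous_subset)
  qed
  from this[OF finite order_refl]
  show ?thesis
    by (simp cong: PiE_cong)
qed

end

section \<open>The vector space underlying a module over an algebra\<close>

lemma kspace_simps [simp]:
  "carrier (kspace A M) = carrier M" "\<zero>\<^bsub>kspace A M\<^esub> = \<zero>\<^bsub>M\<^esub>" "add (kspace A M) = add M"
  "c \<odot>\<^bsub>kspace A M\<^esub> x = (c \<odot>\<^bsub>A\<^esub> \<one>\<^bsub>A\<^esub>) \<odot>\<^bsub>M\<^esub> x"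
  by (simp_all add: kspace_def)

lemma kspace_direct_sum: "kspace A (direct_sum I M) = direct_sum I (\<lambda>i. kspace A (M i))"
  by (simp add: kspace_def direct_sum_def)

lemma minus_kspace [simp]: "\<ominus>\<^bsub>kspace A M\<^esub> x = \<ominus>\<^bsub>M\<^esub> x"
  by (simp add: a_inv_def m_inv_def)

lemma left_module_kspace:
  assumes "fd_algebra K A" "left_module A M"
  shows "left_module K (kspace A M)"
proof -
  interpret fd_algebra K A by fact
  interpret A: ring A by unfold_locales
  have KA: "module K A" by unfold_locales
  interpret M: left_module A M by fact
  have [simp]: "c \<odot>\<^bsub>A\<^esub> \<one>\<^bsub>A\<^esub> \<in> carrier A" if "c \<in> carrier K" for c
    using that module.smult_closed[OF KA] by simp
  have mult: "(c \<otimes>\<^bsub>K\<^esub> d) \<odot>\<^bsub>A\<^esub> \<one>\<^bsub>A\<^esub> = (c \<odot>\<^bsub>A\<^esub> \<one>\<^bsub>A\<^esub>) \<otimes>\<^bsub>A\<^esub> (d \<odot>\<^bsub>A\<^esub> \<one>\<^bsub>A\<^esub>)"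
    if "c \<in> carrier K" "d \<in> carrier K" for c d
    using that smult_mult_left[of c "\<one>\<^bsub>A\<^esub>" "d \<odot>\<^bsub>A\<^esub> \<one>\<^bsub>A\<^esub>"] by (simp add: module.smult_assoc1[OF KA])
  have "\<exists>y\<in>carrier M. y \<oplus>\<^bsub>M\<^esub> x = \<zero>\<^bsub>M\<^esub>" if "x \<in> carrier M" for x
    using that by (intro bexI[of _ "\<ominus>\<^bsub>M\<^esub> x"]) (auto simp: M.M.l_neg)
  then have "abelian_group (kspace A M)"
    by (intro abelian_groupI) (auto simp: M.M.a_ac)
  moreover have "ring K"
    using module.axioms(1)[OF KA] cring.axioms(1) by blast
  ultimately show ?thesis
    by (intro left_module.intro left_module_axioms.intro)
      (auto simp: M.smult_closed M.smult_l_distr M.smult_r_distr mult M.smult_assoc M.smult_one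
        module.smult_l_distr[OF KA] module.smult_one[OF KA])
qed

lemma fd_module_direct_sum:
  assumes A: "fd_algebra K A" and "finite I" "\<And>i. i \<in> I \<Longrightarrow> fd_module K A (M i)"
  shows "fd_module K A (direct_sum I M)"
proof -
  interpret fd_algebra K A by fact
  have ring: "ring A" "ring K"
    by (unfold_locales)
  have lm: "left_module A (M i)" "finite_dim K (kspace A (M i))" if "i \<in> I" for i
    using assms(3)[OF that] by (auto simp: fd_module_def)
  interpret V: finite_direct_sum K I "\<lambda>i. kspace A (M i)"
    using ring(2) assms(2) left_module_kspace[OF A lm(1)] by (intro finite_direct_sum.intro)
  show ?thesis
    unfolding fd_module_def kspace_direct_sum
    by (intro conjI left_module_direct_sum ring(1) lm(1) V.finite_dim_direct_sum lm(2))
qed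

section \<open>The deformed algebra\<close>

text \<open>The cocycle and morphism identities, stated with differences, are used as equations between sums;
  these two lemmas translate.\<close>

lemma (in abelian_group) diff_plus_diff_eq_zero_iff:
  assumes "x \<in> carrier G" "y \<in> carrier G" "z \<in> carrier G" "w \<in> carrier G"
  shows "x \<ominus> y \<oplus> z \<ominus> w = \<zero> \<longleftrightarrow> x \<oplus> z = y \<oplus> w"
proof -
  have "x \<ominus> y \<oplus> z \<ominus> w = (x \<oplus> z) \<ominus> (y \<oplus> w)"
    using assms by (simp add: a_minus_def minus_add a_ac)
  then show ?thesis
    using assms by (simp add: a_minus_def add.inv_solve_right')
qed

lemma (in abelian_group) eq_diff_plus_iff:
  assumes "x \<in> carrier G" "p \<in> carrier G" "q \<in> carrier G" "r \<in> carrier G"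
  shows "x = p \<ominus> q \<oplus> r \<longleftrightarrow> x \<oplus> q = p \<oplus> r"
proof -
  have "p \<ominus> q \<oplus> r = (p \<oplus> r) \<oplus> \<ominus> q"
    using assms by (simp add: a_minus_def a_ac)
  then show ?thesis
    using assms add.inv_solve_right[of x "p \<oplus> r" q] by auto
qed

lemma deformed_algebra_simps [simp]:
  "carrier (deformed_algebra A f) = carrier A \<times> carrier A"
  "(a0, a1) \<otimes>\<^bsub>deformed_algebra A f\<^esub> (b0, b1) =
    (a0 \<otimes>\<^bsub>A\<^esub> b0, a0 \<otimes>\<^bsub>A\<^esub> b1 \<oplus>\<^bsub>A\<^esub> a1 \<otimes>\<^bsub>A\<^esub> b0 \<oplus>\<^bsub>A\<^esub> f a0 b0)"
  "\<one>\<^bsub>deformed_algebra A f\<^esub> = (\<one>\<^bsub>A\<^esub>, \<ominus>\<^bsub>A\<^esub> f \<one>\<^bsub>A\<^esub> \<one>\<^bsub>A\<^esub>)"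
  "\<zero>\<^bsub>deformed_algebra A f\<^esub> = (\<zero>\<^bsub>A\<^esub>, \<zero>\<^bsub>A\<^esub>)"
  "(a0, a1) \<oplus>\<^bsub>deformed_algebra A f\<^esub> (b0, b1) = (a0 \<oplus>\<^bsub>A\<^esub> b0, a1 \<oplus>\<^bsub>A\<^esub> b1)"
  "c \<odot>\<^bsub>deformed_algebra A f\<^esub> (a0, a1) = (c \<odot>\<^bsub>A\<^esub> a0, c \<odot>\<^bsub>A\<^esub> a1)"
  by (simp_all add: deformed_algebra_def)

lemma tuple_module_simps [simp]:
  "carrier (tuple_module S) = carrier (tup0 S) \<times> carrier (tup1 S)"
  "\<zero>\<^bsub>tuple_module S\<^esub> = (\<zero>\<^bsub>tup0 S\<^esub>, \<zero>\<^bsub>tup1 S\<^esub>)"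
  "(m0, m1) \<oplus>\<^bsub>tuple_module S\<^esub> (n0, n1) = (m0 \<oplus>\<^bsub>tup0 S\<^esub> n0, m1 \<oplus>\<^bsub>tup1 S\<^esub> n1)"
  "(a, b) \<odot>\<^bsub>tuple_module S\<^esub> (m0, m1) = (a \<odot>\<^bsub>tup0 S\<^esub> m0,
     a \<odot>\<^bsub>tup1 S\<^esub> m1 \<oplus>\<^bsub>tup1 S\<^esub> b \<odot>\<^bsub>tup1 S\<^esub> tupT S m0 \<oplus>\<^bsub>tup1 S\<^esub> tupf S a m0)"
  by (simp_all add: tuple_module_def)

locale deformation =
  fixes K :: "'k ring" and A :: "('k, 'a) module" and f :: "'a \<Rightarrow> 'a \<Rightarrow> 'a"
  assumes algebra: "fd_algebra K A" and hochschild: "hochschild_2cocycle K A f"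
begin

lemma algebra_axioms:
  shows ring_A: "ring A" and ring_K: "ring K" and vector_space_A: "module K A"
proof -
  interpret fd_algebra K A by (rule algebra)
  show "ring A" "module K A" by unfold_locales
  then show "ring K" using module.axioms(1) cring.axioms(1) by blast
qed

sublocale A: ring A by (rule ring_A)

lemma left_module_KA: "left_module K A"
  using vector_space_A ring_K
  by (intro left_module.intro left_module_axioms.intro)
    (auto simp: module.axioms(2) module.smult_closed module.smult_l_distr module.smult_r_distr
      module.smult_assoc1 module.smult_one)

abbreviation scal :: "'k \<Rightarrow> 'a" where "scal c \<equiv> c \<odot>\<^bsub>A\<^esub> \<one>\<^bsub>A\<^esub>"

lemma scal_closed: "c \<in> carrier K \<Longrightarrow> scal c \<in> carrier A"
  using left_module.smult_closed[OF left_module_KA] by simp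

lemma scal_mult: "c \<in> carrier K \<Longrightarrow> a \<in> carrier A \<Longrightarrow> scal c \<otimes>\<^bsub>A\<^esub> a = c \<odot>\<^bsub>A\<^esub> a"
  using fd_algebra.smult_mult_left[OF algebra, of c "\<one>\<^bsub>A\<^esub>" a] by simp

lemma bilinear_f: "bilinear_map K A A A f"
  using hochschild by (simp add: hochschild_2cocycle_def)

lemma f_mhom_right: "a \<in> carrier A \<Longrightarrow> f a \<in> mhom K A A"
  and f_mhom_left: "b \<in> carrier A \<Longrightarrow> (\<lambda>a. f a b) \<in> mhom K A A"
  using bilinear_f by (auto simp: bilinear_map_def)

lemma f_closed [simp]: "a \<in> carrier A \<Longrightarrow> b \<in> carrier A \<Longrightarrow> f a b \<in> carrier A"
  using mhomD(1)[OF f_mhom_right] .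

lemma f_add_right: "a \<in> carrier A \<Longrightarrow> b \<in> carrier A \<Longrightarrow> c \<in> carrier A \<Longrightarrow>
    f a (b \<oplus>\<^bsub>A\<^esub> c) = f a b \<oplus>\<^bsub>A\<^esub> f a c"
  using mhomD(2)[OF f_mhom_right] .

lemma f_add_left: "a \<in> carrier A \<Longrightarrow> b \<in> carrier A \<Longrightarrow> c \<in> carrier A \<Longrightarrow>
    f (a \<oplus>\<^bsub>A\<^esub> b) c = f a c \<oplus>\<^bsub>A\<^esub> f b c"
  using mhomD(2)[OF f_mhom_left] .

lemma f_zero: "a \<in> carrier A \<Longrightarrow> f a \<zero>\<^bsub>A\<^esub> = \<zero>\<^bsub>A\<^esub>" "a \<in> carrier A \<Longrightarrow> f \<zero>\<^bsub>A\<^esub> a = \<zero>\<^bsub>A\<^esub>"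
  using mhom_zero[OF f_mhom_right left_module_KA left_module_KA]
    mhom_zero[OF f_mhom_left left_module_KA left_module_KA] by auto

lemma f_scalar_right: "c \<in> carrier K \<Longrightarrow> a \<in> carrier A \<Longrightarrow> b \<in> carrier A \<Longrightarrow>
    f a (c \<odot>\<^bsub>A\<^esub> b) = c \<odot>\<^bsub>A\<^esub> f a b"
  using mhomD(3)[OF f_mhom_right] .

lemma f_scalar_left: "c \<in> carrier K \<Longrightarrow> a \<in> carrier A \<Longrightarrow> b \<in> carrier A \<Longrightarrow>
    f (c \<odot>\<^bsub>A\<^esub> a) b = c \<odot>\<^bsub>A\<^esub> f a b"
  using mhomD(3)[OF f_mhom_left] .

lemma f_cocycle:
  assumes "a \<in> carrier A" "b \<in> carrier A" "c \<in> carrier A"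
  shows "a \<otimes>\<^bsub>A\<^esub> f b c \<oplus>\<^bsub>A\<^esub> f a (b \<otimes>\<^bsub>A\<^esub> c) = f (a \<otimes>\<^bsub>A\<^esub> b) c \<oplus>\<^bsub>A\<^esub> f a b \<otimes>\<^bsub>A\<^esub> c"
  using hochschild assms A.diff_plus_diff_eq_zero_iff[of "a \<otimes>\<^bsub>A\<^esub> f b c" "f (a \<otimes>\<^bsub>A\<^esub> b) c"
      "f a (b \<otimes>\<^bsub>A\<^esub> c)" "f a b \<otimes>\<^bsub>A\<^esub> c"]
  by (simp add: hochschild_2cocycle_def)

lemma f_one_right:
  assumes "a \<in> carrier A"
  shows "f a \<one>\<^bsub>A\<^esub> = a \<otimes>\<^bsub>A\<^esub> f \<one>\<^bsub>A\<^esub> \<one>\<^bsub>A\<^esub>"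
proof -
  have "f a \<one>\<^bsub>A\<^esub> \<oplus>\<^bsub>A\<^esub> a \<otimes>\<^bsub>A\<^esub> f \<one>\<^bsub>A\<^esub> \<one>\<^bsub>A\<^esub> = f a \<one>\<^bsub>A\<^esub> \<oplus>\<^bsub>A\<^esub> f a \<one>\<^bsub>A\<^esub>"
    using f_cocycle[of a "\<one>\<^bsub>A\<^esub>" "\<one>\<^bsub>A\<^esub>"] assms by (simp add: A.a_comm)
  then show ?thesis
    using assms by (simp add: A.add.l_cancel)
qed

lemma f_one_left:
  assumes "a \<in> carrier A"
  shows "f \<one>\<^bsub>A\<^esub> a = f \<one>\<^bsub>A\<^esub> \<one>\<^bsub>A\<^esub> \<otimes>\<^bsub>A\<^esub> a"
  using f_cocycle[of "\<one>\<^bsub>A\<^esub>" "\<one>\<^bsub>A\<^esub>" a] assms by (simp add: A.add.l_cancel)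

abbreviation Af :: "('k, 'a \<times> 'a) module" where "Af \<equiv> deformed_algebra A f"

lemma deformed_mult_assoc:
  assumes "x \<in> carrier Af" "y \<in> carrier Af" "z \<in> carrier Af"
  shows "x \<otimes>\<^bsub>Af\<^esub> y \<otimes>\<^bsub>Af\<^esub> z = x \<otimes>\<^bsub>Af\<^esub> (y \<otimes>\<^bsub>Af\<^esub> z)"
proof -
  obtain a0 a1 b0 b1 c0 c1 where xyz: "x = (a0, a1)" "y = (b0, b1)" "z = (c0, c1)"
    by (metis surj_pair)
  have [simp]: "a0 \<in> carrier A" "a1 \<in> carrier A" "b0 \<in> carrier A" "b1 \<in> carrier A"
    "c0 \<in> carrier A" "c1 \<in> carrier A"
    using assms xyz by auto
  define p where "p = a0 \<otimes>\<^bsub>A\<^esub> (b0 \<otimes>\<^bsub>A\<^esub> c1) \<oplus>\<^bsub>A\<^esub> (a0 \<otimes>\<^bsub>A\<^esub> (b1 \<otimes>\<^bsub>A\<^esub> c0) \<oplus>\<^bsub>A\<^esub> a1 \<otimes>\<^bsub>A\<^esub> (b0 \<otimes>\<^bsub>A\<^esub> c0))"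
  have p: "p \<in> carrier A"
    by (simp add: p_def)
  have "a0 \<otimes>\<^bsub>A\<^esub> b0 \<otimes>\<^bsub>A\<^esub> c1 \<oplus>\<^bsub>A\<^esub> (a0 \<otimes>\<^bsub>A\<^esub> b1 \<oplus>\<^bsub>A\<^esub> a1 \<otimes>\<^bsub>A\<^esub> b0 \<oplus>\<^bsub>A\<^esub> f a0 b0) \<otimes>\<^bsub>A\<^esub> c0 \<oplus>\<^bsub>A\<^esub> f (a0 \<otimes>\<^bsub>A\<^esub> b0) c0
      = p \<oplus>\<^bsub>A\<^esub> (f (a0 \<otimes>\<^bsub>A\<^esub> b0) c0 \<oplus>\<^bsub>A\<^esub> f a0 b0 \<otimes>\<^bsub>A\<^esub> c0)"
    by (simp add: p_def A.l_distr A.m_assoc A.a_ac)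
  also have "\<dots> = p \<oplus>\<^bsub>A\<^esub> (a0 \<otimes>\<^bsub>A\<^esub> f b0 c0 \<oplus>\<^bsub>A\<^esub> f a0 (b0 \<otimes>\<^bsub>A\<^esub> c0))"
    by (simp add: f_cocycle)
  also have "\<dots> = a0 \<otimes>\<^bsub>A\<^esub> (b0 \<otimes>\<^bsub>A\<^esub> c1 \<oplus>\<^bsub>A\<^esub> b1 \<otimes>\<^bsub>A\<^esub> c0 \<oplus>\<^bsub>A\<^esub> f b0 c0) \<oplus>\<^bsub>A\<^esub> a1 \<otimes>\<^bsub>A\<^esub> (b0 \<otimes>\<^bsub>A\<^esub> c0) \<oplus>\<^bsub>A\<^esub> f a0 (b0 \<otimes>\<^bsub>A\<^esub> c0)"
    by (simp add: p_def A.r_distr A.m_assoc A.a_ac)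
  finally show ?thesis
    by (simp add: xyz A.m_assoc)
qed

lemma ring_deformed: "ring Af"
proof (rule ringI)
  show "abelian_group Af"
  proof (rule abelian_groupI)
    show "\<exists>y\<in>carrier Af. y \<oplus>\<^bsub>Af\<^esub> x = \<zero>\<^bsub>Af\<^esub>" if "x \<in> carrier Af" for x
      using that by (cases x) (auto simp: A.l_neg intro!: bexI[of _ "\<ominus>\<^bsub>A\<^esub> fst x"] bexI[of _ "\<ominus>\<^bsub>A\<^esub> snd x"])
  qed (auto simp: A.a_ac)
  show "Group.monoid Af"
  proof (rule monoidI)
    show "\<one>\<^bsub>Af\<^esub> \<otimes>\<^bsub>Af\<^esub> x = x" if "x \<in> carrier Af" for x
    proof (cases x)
      case (Pair x0 x1)
      then show ?thesis
        using that by (simp add: f_one_left[of x0] A.l_minus A.a_assoc A.l_neg)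
    qed
    show "x \<otimes>\<^bsub>Af\<^esub> \<one>\<^bsub>Af\<^esub> = x" if "x \<in> carrier Af" for x
    proof (cases x)
      case (Pair x0 x1)
      then have x: "x0 \<in> carrier A" "x1 \<in> carrier A"
        using that by auto
      let ?y = "x0 \<otimes>\<^bsub>A\<^esub> f \<one>\<^bsub>A\<^esub> \<one>\<^bsub>A\<^esub>"
      have "\<ominus>\<^bsub>A\<^esub> ?y \<oplus>\<^bsub>A\<^esub> x1 \<oplus>\<^bsub>A\<^esub> ?y = x1 \<oplus>\<^bsub>A\<^esub> (\<ominus>\<^bsub>A\<^esub> ?y \<oplus>\<^bsub>A\<^esub> ?y)"
        using x by (simp add: A.a_ac)
      then show ?thesis
        using x Pair by (simp add: f_one_right[of x0] A.r_minus A.l_neg)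
    qed
  qed (auto simp: deformed_mult_assoc simp del: deformed_algebra_simps(1), auto)
qed (auto simp: A.l_distr A.r_distr f_add_left f_add_right A.a_ac)

end

section \<open>Modules over the deformed algebra\<close>

locale deformed_tuple = deformation K A f
  for K :: "'k ring" and A :: "('k, 'a) module" and f :: "'a \<Rightarrow> 'a \<Rightarrow> 'a" +
  fixes S :: "('a, 'p, 'q) tuple"
  assumes tuple: "is_tuple K A f S"
begin

lemma fd0: "fd_module K A (tup0 S)" and fd1: "fd_module K A (tup1 S)"
  and T_mhom: "tupT S \<in> mhom A (tup0 S) (tup1 S)"
  and bilinear_tupf: "bilinear_map K A (kspace A (tup0 S)) (kspace A (tup1 S)) (tupf S)"
  using tuple by (auto simp: is_tuple_def)

sublocale M0: left_module A "tup0 S"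
  using fd0 by (simp add: fd_module_def)

sublocale M1: left_module A "tup1 S"
  using fd1 by (simp add: fd_module_def)

lemmas T_closed [simp] = mhomD(1)[OF T_mhom]
  and T_add = mhomD(2)[OF T_mhom]
  and T_smult = mhomD(3)[OF T_mhom]

lemmas kspace0 = left_module_kspace[OF algebra M0.left_module_axioms]
  and kspace1 = left_module_kspace[OF algebra M1.left_module_axioms]

lemma tupf_mhom_right: "a \<in> carrier A \<Longrightarrow> tupf S a \<in> mhom K (kspace A (tup0 S)) (kspace A (tup1 S))"
  and tupf_mhom_left: "m \<in> carrier (tup0 S) \<Longrightarrow> (\<lambda>a. tupf S a m) \<in> mhom K A (kspace A (tup1 S))"
  using bilinear_tupf by (auto simp: bilinear_map_def)

lemma tupf_closed [simp]: "a \<in> carrier A \<Longrightarrow> m \<in> carrier (tup0 S) \<Longrightarrow> tupf S a m \<in> carrier (tup1 S)"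
  using mhomD(1)[OF tupf_mhom_right] by simp

lemma tupf_add_right: "a \<in> carrier A \<Longrightarrow> m \<in> carrier (tup0 S) \<Longrightarrow> n \<in> carrier (tup0 S) \<Longrightarrow>
    tupf S a (m \<oplus>\<^bsub>tup0 S\<^esub> n) = tupf S a m \<oplus>\<^bsub>tup1 S\<^esub> tupf S a n"
  using mhomD(2)[OF tupf_mhom_right] by simp

lemma tupf_add_left: "a \<in> carrier A \<Longrightarrow> b \<in> carrier A \<Longrightarrow> m \<in> carrier (tup0 S) \<Longrightarrow>
    tupf S (a \<oplus>\<^bsub>A\<^esub> b) m = tupf S a m \<oplus>\<^bsub>tup1 S\<^esub> tupf S b m"
  using mhomD(2)[OF tupf_mhom_left] by simp

lemma tupf_scalar_left: "c \<in> carrier K \<Longrightarrow> a \<in> carrier A \<Longrightarrow> m \<in> carrier (tup0 S) \<Longrightarrow>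
    tupf S (c \<odot>\<^bsub>A\<^esub> a) m = scal c \<odot>\<^bsub>tup1 S\<^esub> tupf S a m"
  using mhomD(3)[OF tupf_mhom_left] by simp

lemma tupf_zero_left: "m \<in> carrier (tup0 S) \<Longrightarrow> tupf S \<zero>\<^bsub>A\<^esub> m = \<zero>\<^bsub>tup1 S\<^esub>"
  using mhom_zero[OF tupf_mhom_left left_module_KA kspace1] by simp

lemma tupf_cocycle:
  assumes "a \<in> carrier A" "b \<in> carrier A" "m \<in> carrier (tup0 S)"
  shows "a \<odot>\<^bsub>tup1 S\<^esub> tupf S b m \<oplus>\<^bsub>tup1 S\<^esub> tupf S a (b \<odot>\<^bsub>tup0 S\<^esub> m)
    = tupf S (a \<otimes>\<^bsub>A\<^esub> b) m \<oplus>\<^bsub>tup1 S\<^esub> f a b \<odot>\<^bsub>tup1 S\<^esub> tupT S m"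
  using tuple assms M1.M.diff_plus_diff_eq_zero_iff[of "a \<odot>\<^bsub>tup1 S\<^esub> tupf S b m"
      "tupf S (a \<otimes>\<^bsub>A\<^esub> b) m" "tupf S a (b \<odot>\<^bsub>tup0 S\<^esub> m)" "f a b \<odot>\<^bsub>tup1 S\<^esub> tupT S m"]
  by (simp add: is_tuple_def M1.smult_closed M0.smult_closed)

lemma tupf_one:
  assumes "m \<in> carrier (tup0 S)"
  shows "tupf S \<one>\<^bsub>A\<^esub> m = f \<one>\<^bsub>A\<^esub> \<one>\<^bsub>A\<^esub> \<odot>\<^bsub>tup1 S\<^esub> tupT S m"
  using tupf_cocycle[of "\<one>\<^bsub>A\<^esub>" "\<one>\<^bsub>A\<^esub>" m] assms
  by (simp add: M0.smult_one M1.smult_one M1.M.add.l_cancel M1.smult_closed)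

lemma abelian_group_tuple: "abelian_group (tuple_module S)"
proof (rule abelian_groupI)
  show "\<exists>y\<in>carrier (tuple_module S). y \<oplus>\<^bsub>tuple_module S\<^esub> x = \<zero>\<^bsub>tuple_module S\<^esub>"
    if "x \<in> carrier (tuple_module S)" for x
    using that by (cases x) (auto simp: M0.M.l_neg M1.M.l_neg
      intro!: bexI[of _ "\<ominus>\<^bsub>tup0 S\<^esub> fst x"] bexI[of _ "\<ominus>\<^bsub>tup1 S\<^esub> snd x"])
qed (auto simp: M0.M.a_ac M1.M.a_ac)

lemma tuple_smult_assoc:
  assumes "x \<in> carrier Af" "y \<in> carrier Af" "m \<in> carrier (tuple_module S)"
  shows "(x \<otimes>\<^bsub>Af\<^esub> y) \<odot>\<^bsub>tuple_module S\<^esub> m = x \<odot>\<^bsub>tuple_module S\<^esub> (y \<odot>\<^bsub>tuple_module S\<^esub> m)"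
proof -
  obtain a0 a1 b0 b1 m0 m1 where xym: "x = (a0, a1)" "y = (b0, b1)" "m = (m0, m1)"
    by (metis surj_pair)
  have [simp]: "a0 \<in> carrier A" "a1 \<in> carrier A" "b0 \<in> carrier A" "b1 \<in> carrier A"
    "m0 \<in> carrier (tup0 S)" "m1 \<in> carrier (tup1 S)"
    using assms xym by auto
  let ?T = "tupT S m0"
  define p where "p = a0 \<odot>\<^bsub>tup1 S\<^esub> (b0 \<odot>\<^bsub>tup1 S\<^esub> m1) \<oplus>\<^bsub>tup1 S\<^esub>
    (a0 \<odot>\<^bsub>tup1 S\<^esub> (b1 \<odot>\<^bsub>tup1 S\<^esub> ?T) \<oplus>\<^bsub>tup1 S\<^esub> a1 \<odot>\<^bsub>tup1 S\<^esub> (b0 \<odot>\<^bsub>tup1 S\<^esub> ?T))"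
  note closed = M0.smult_closed M1.smult_closed
  have p: "p \<in> carrier (tup1 S)"
    by (simp add: p_def closed)
  have "(a0 \<otimes>\<^bsub>A\<^esub> b0) \<odot>\<^bsub>tup1 S\<^esub> m1
      \<oplus>\<^bsub>tup1 S\<^esub> (a0 \<otimes>\<^bsub>A\<^esub> b1 \<oplus>\<^bsub>A\<^esub> a1 \<otimes>\<^bsub>A\<^esub> b0 \<oplus>\<^bsub>A\<^esub> f a0 b0) \<odot>\<^bsub>tup1 S\<^esub> ?T
      \<oplus>\<^bsub>tup1 S\<^esub> tupf S (a0 \<otimes>\<^bsub>A\<^esub> b0) m0
    = p \<oplus>\<^bsub>tup1 S\<^esub> (tupf S (a0 \<otimes>\<^bsub>A\<^esub> b0) m0 \<oplus>\<^bsub>tup1 S\<^esub> f a0 b0 \<odot>\<^bsub>tup1 S\<^esub> ?T)"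
    by (simp add: p_def M1.smult_l_distr M1.smult_assoc M1.M.a_ac closed)
  also have "\<dots> = p \<oplus>\<^bsub>tup1 S\<^esub> (a0 \<odot>\<^bsub>tup1 S\<^esub> tupf S b0 m0 \<oplus>\<^bsub>tup1 S\<^esub> tupf S a0 (b0 \<odot>\<^bsub>tup0 S\<^esub> m0))"
    by (simp add: tupf_cocycle)
  also have "\<dots> = a0 \<odot>\<^bsub>tup1 S\<^esub> (b0 \<odot>\<^bsub>tup1 S\<^esub> m1 \<oplus>\<^bsub>tup1 S\<^esub> b1 \<odot>\<^bsub>tup1 S\<^esub> ?T \<oplus>\<^bsub>tup1 S\<^esub> tupf S b0 m0)
      \<oplus>\<^bsub>tup1 S\<^esub> a1 \<odot>\<^bsub>tup1 S\<^esub> tupT S (b0 \<odot>\<^bsub>tup0 S\<^esub> m0) \<oplus>\<^bsub>tup1 S\<^esub> tupf S a0 (b0 \<odot>\<^bsub>tup0 S\<^esub> m0)"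
    by (simp add: p_def M1.smult_r_distr T_smult M1.M.a_ac closed)
  finally show ?thesis
    by (simp add: xym M0.smult_assoc)
qed

lemma left_module_tuple: "left_module Af (tuple_module S)"
proof (intro left_module.intro left_module_axioms.intro)
  show "\<one>\<^bsub>Af\<^esub> \<odot>\<^bsub>tuple_module S\<^esub> m = m" if m: "m \<in> carrier (tuple_module S)" for m
  proof (cases m)
    case (Pair m0 m1)
    have "(\<ominus>\<^bsub>A\<^esub> f \<one>\<^bsub>A\<^esub> \<one>\<^bsub>A\<^esub>) \<odot>\<^bsub>tup1 S\<^esub> tupT S m0 \<oplus>\<^bsub>tup1 S\<^esub> tupf S \<one>\<^bsub>A\<^esub> m0 = \<zero>\<^bsub>tup1 S\<^esub>"
      using m Pair M1.smult_l_distr[of "\<ominus>\<^bsub>A\<^esub> f \<one>\<^bsub>A\<^esub> \<one>\<^bsub>A\<^esub>" "f \<one>\<^bsub>A\<^esub> \<one>\<^bsub>A\<^esub>" "tupT S m0"]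
      by (simp add: tupf_one A.l_neg M1.smult_zero_left)
    then show ?thesis
      using m Pair by (simp add: M0.smult_one M1.smult_one M1.M.a_assoc M1.smult_closed)
  qed
  show "x \<odot>\<^bsub>tuple_module S\<^esub> m \<in> carrier (tuple_module S)"
    if "x \<in> carrier Af" "m \<in> carrier (tuple_module S)" for x m
    using that by (cases x; cases m) (simp add: M0.smult_closed M1.smult_closed)
  show "(x \<oplus>\<^bsub>Af\<^esub> y) \<odot>\<^bsub>tuple_module S\<^esub> m
      = x \<odot>\<^bsub>tuple_module S\<^esub> m \<oplus>\<^bsub>tuple_module S\<^esub> y \<odot>\<^bsub>tuple_module S\<^esub> m"
    if "x \<in> carrier Af" "y \<in> carrier Af" "m \<in> carrier (tuple_module S)" for x y m
    using that by (cases x; cases y; cases m)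
      (simp add: M0.smult_l_distr M1.smult_l_distr tupf_add_left M1.smult_closed M1.M.a_ac)
  show "x \<odot>\<^bsub>tuple_module S\<^esub> (m \<oplus>\<^bsub>tuple_module S\<^esub> n)
      = x \<odot>\<^bsub>tuple_module S\<^esub> m \<oplus>\<^bsub>tuple_module S\<^esub> x \<odot>\<^bsub>tuple_module S\<^esub> n"
    if "x \<in> carrier Af" "m \<in> carrier (tuple_module S)" "n \<in> carrier (tuple_module S)" for x m n
    using that by (cases x; cases m; cases n)
      (simp add: M0.smult_r_distr M1.smult_r_distr tupf_add_right T_add M1.smult_closed M1.M.a_ac)
qed (rule ring_deformed abelian_group_tuple tuple_smult_assoc; assumption?)+

text \<open>The unit of \<open>A\<^sub>f\<close> is \<open>1 - f(1 \<otimes> 1) t\<close>, so a scalar \<open>c\<close> also acts through a multiple of \<open>t\<close>.  That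
  contribution cancels against \<open>f\<^sub>M(c \<otimes> m) = c f(1 \<otimes> 1) T(m)\<close>, and the underlying vector space is
  the plain product.\<close>

lemma kspace_tuple_smult:
  assumes c: "c \<in> carrier K" and "m0 \<in> carrier (tup0 S)" "m1 \<in> carrier (tup1 S)"
  shows "c \<odot>\<^bsub>kspace Af (tuple_module S)\<^esub> (m0, m1) = (scal c \<odot>\<^bsub>tup0 S\<^esub> m0, scal c \<odot>\<^bsub>tup1 S\<^esub> m1)"
proof -
  let ?n = "f \<one>\<^bsub>A\<^esub> \<one>\<^bsub>A\<^esub>"
  have "c \<odot>\<^bsub>A\<^esub> (\<ominus>\<^bsub>A\<^esub> ?n) = scal c \<otimes>\<^bsub>A\<^esub> (\<ominus>\<^bsub>A\<^esub> ?n)"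
    using c by (simp add: scal_mult)
  then have "(c \<odot>\<^bsub>A\<^esub> (\<ominus>\<^bsub>A\<^esub> ?n)) \<odot>\<^bsub>tup1 S\<^esub> tupT S m0 \<oplus>\<^bsub>tup1 S\<^esub> tupf S (scal c) m0
      = scal c \<odot>\<^bsub>tup1 S\<^esub> ((\<ominus>\<^bsub>A\<^esub> ?n) \<odot>\<^bsub>tup1 S\<^esub> tupT S m0 \<oplus>\<^bsub>tup1 S\<^esub> ?n \<odot>\<^bsub>tup1 S\<^esub> tupT S m0)"
    using assms by (simp add: tupf_scalar_left tupf_one M1.smult_assoc M1.smult_r_distr
      scal_closed M1.smult_closed)
  also have "\<dots> = scal c \<odot>\<^bsub>tup1 S\<^esub> ((\<ominus>\<^bsub>A\<^esub> ?n \<oplus>\<^bsub>A\<^esub> ?n) \<odot>\<^bsub>tup1 S\<^esub> tupT S m0)"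
    using assms by (simp only: M1.smult_l_distr T_closed A.a_inv_closed f_closed A.one_closed)
  also have "\<dots> = \<zero>\<^bsub>tup1 S\<^esub>"
    using assms by (simp add: A.l_neg M1.smult_zero_left M1.smult_zero_right scal_closed)
  finally have "(c \<odot>\<^bsub>A\<^esub> (\<ominus>\<^bsub>A\<^esub> ?n)) \<odot>\<^bsub>tup1 S\<^esub> tupT S m0 \<oplus>\<^bsub>tup1 S\<^esub> tupf S (scal c) m0 = \<zero>\<^bsub>tup1 S\<^esub>" .
  moreover have "c \<odot>\<^bsub>A\<^esub> (\<ominus>\<^bsub>A\<^esub> ?n) \<in> carrier A"
    using c left_module.smult_closed[OF left_module_KA] by simp
  ultimately show ?thesis
    using assms by (simp add: M1.M.a_assoc M1.smult_closed scal_closed)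
qed

lemma left_module_kspace_tuple: "left_module K (kspace Af (tuple_module S))"
proof -
  let ?V = "kspace Af (tuple_module S)"
  note k0 = left_module.smult_closed[OF kspace0] left_module.smult_l_distr[OF kspace0]
    left_module.smult_r_distr[OF kspace0] left_module.smult_assoc[OF kspace0] left_module.smult_one[OF kspace0]
  note k1 = left_module.smult_closed[OF kspace1] left_module.smult_l_distr[OF kspace1]
    left_module.smult_r_distr[OF kspace1] left_module.smult_assoc[OF kspace1] left_module.smult_one[OF kspace1]
  interpret K: ring K by (rule ring_K)
  have sm: "c \<odot>\<^bsub>?V\<^esub> (m0, m1) = (c \<odot>\<^bsub>kspace A (tup0 S)\<^esub> m0, c \<odot>\<^bsub>kspace A (tup1 S)\<^esub> m1)"
    if "c \<in> carrier K" "m0 \<in> carrier (tup0 S)" "m1 \<in> carrier (tup1 S)" for c m0 m1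
    using that by (simp only: kspace_tuple_smult kspace_simps(4)[where A = A])
  note [simp del] = kspace_simps(4) and [simp] = sm
  have "abelian_group ?V"
    by (rule abelian_groupI; unfold kspace_simps(1-3);
      rule abelian_groupE[OF abelian_group_tuple]; assumption)
  then show ?thesis
    using k0 k1 by (intro left_module.intro left_module_axioms.intro) (auto simp: ring_K)
qed

lemma fd_module_tuple: "fd_module K Af (tuple_module S)"
proof -
  let ?V = "kspace Af (tuple_module S)"
  interpret V: left_module K ?V by (rule left_module_kspace_tuple)
  interpret K: ring K by (rule ring_K)
  have "\<exists>B. finite B \<and> B \<subseteq> carrier (tup0 S)
      \<and> (\<forall>Y. submodule Y K (kspace A (tup0 S)) \<and> B \<subseteq> Y \<longrightarrow> carrier (tup0 S) \<subseteq> Y)"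
    using fd0 left_module.finite_dim_iff_generated[OF kspace0] by (simp add: fd_module_def)
  then obtain B0 where B0: "finite B0" "B0 \<subseteq> carrier (tup0 S)"
    and gen0: "\<And>Y. submodule Y K (kspace A (tup0 S)) \<Longrightarrow> B0 \<subseteq> Y \<Longrightarrow> carrier (tup0 S) \<subseteq> Y"
    by metis
  have "\<exists>B. finite B \<and> B \<subseteq> carrier (tup1 S)
      \<and> (\<forall>Y. submodule Y K (kspace A (tup1 S)) \<and> B \<subseteq> Y \<longrightarrow> carrier (tup1 S) \<subseteq> Y)"
    using fd1 left_module.finite_dim_iff_generated[OF kspace1] by (simp add: fd_module_def)
  then obtain B1 where B1: "finite B1" "B1 \<subseteq> carrier (tup1 S)"
    and gen1: "\<And>Y. submodule Y K (kspace A (tup1 S)) \<Longrightarrow> B1 \<subseteq> Y \<Longrightarrow> carrier (tup1 S) \<subseteq> Y"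
    by metis
  have i0: "(\<lambda>x. (x, \<zero>\<^bsub>tup1 S\<^esub>)) \<in> mhom K (kspace A (tup0 S)) ?V"
    by (rule mhomI) (auto simp: kspace_tuple_smult M1.smult_zero_right scal_closed simp del: kspace_simps(4),
      simp add: kspace_simps(4))
  have i1: "(\<lambda>y. (\<zero>\<^bsub>tup0 S\<^esub>, y)) \<in> mhom K (kspace A (tup1 S)) ?V"
    by (rule mhomI) (auto simp: kspace_tuple_smult M0.smult_zero_right scal_closed simp del: kspace_simps(4),
      simp add: kspace_simps(4))
  let ?B = "(\<lambda>x. (x, \<zero>\<^bsub>tup1 S\<^esub>)) ` B0 \<union> (\<lambda>y. (\<zero>\<^bsub>tup0 S\<^esub>, y)) ` B1"
  have "finite_dim K ?V"
    unfolding V.finite_dim_iff_generated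
  proof (intro exI[of _ ?B] conjI allI impI)
    show "finite ?B" using B0 B1 by simp
    show "?B \<subseteq> carrier ?V" using B0 B1 by auto
    fix Y assume "submodule Y K ?V \<and> ?B \<subseteq> Y"
    then have Y: "submodule Y K ?V" and BY: "?B \<subseteq> Y" by auto
    have "carrier (tup0 S) \<subseteq> {x \<in> carrier (kspace A (tup0 S)). (x, \<zero>\<^bsub>tup1 S\<^esub>) \<in> Y}"
      using BY B0(2) by (intro gen0 mhom_vimage_submodule[OF i0 kspace0 V.left_module_axioms Y]) auto
    moreover have "carrier (tup1 S) \<subseteq> {y \<in> carrier (kspace A (tup1 S)). (\<zero>\<^bsub>tup0 S\<^esub>, y) \<in> Y}"
      using BY B1(2) by (intro gen1 mhom_vimage_submodule[OF i1 kspace1 V.left_module_axioms Y]) auto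
    ultimately have "(x, \<zero>\<^bsub>tup1 S\<^esub>) \<oplus>\<^bsub>?V\<^esub> (\<zero>\<^bsub>tup0 S\<^esub>, y) \<in> Y"
      if "x \<in> carrier (tup0 S)" "y \<in> carrier (tup1 S)" for x y
      using that by (intro V.submoduleD(3)[OF Y]) auto
    then show "carrier ?V \<subseteq> Y" by auto
  qed
  then show ?thesis
    by (simp add: fd_module_def left_module_tuple)
qed

text \<open>When \<open>T\<close> is onto, \<open>t\<close> maps the tuple onto its second component, so that component lies in the
  radical and superfluousness can be tested on the first.\<close>

lemma superfluous_tuple:
  assumes sup: "superfluous A (tup0 S) N" and N: "N \<subseteq> carrier (tup0 S)"
    and onto: "tupT S ` carrier (tup0 S) = carrier (tup1 S)"
  shows "superfluous Af (tuple_module S) (N \<times> carrier (tup1 S))"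
proof -
  interpret P: left_module Af "tuple_module S" by (rule left_module_tuple)
  show ?thesis
  proof (rule P.superfluousI)
    fix Y assume Y: "submodule Y Af (tuple_module S)"
      and cover: "\<And>x. x \<in> carrier (tuple_module S) \<Longrightarrow>
        \<exists>s\<in>Y. \<exists>n\<in>N \<times> carrier (tup1 S). x = s \<oplus>\<^bsub>tuple_module S\<^esub> n"
    note YD = P.submoduleD[OF Y]
    have Ym: "m0 \<in> carrier (tup0 S)" "m1 \<in> carrier (tup1 S)" if "(m0, m1) \<in> Y" for m0 m1
      using YD(1) that by auto
    have "submodule (fst ` Y) A (tup0 S)"
    proof (rule M0.submoduleI)
      show "fst ` Y \<subseteq> carrier (tup0 S)" using YD(1) by auto
      show "\<zero>\<^bsub>tup0 S\<^esub> \<in> fst ` Y" using YD(2) by force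
      show "x \<oplus>\<^bsub>tup0 S\<^esub> y \<in> fst ` Y" if "x \<in> fst ` Y" "y \<in> fst ` Y" for x y
        using that YD(3) by (force simp: image_iff)
      show "a \<odot>\<^bsub>tup0 S\<^esub> x \<in> fst ` Y" if a: "a \<in> carrier A" and "x \<in> fst ` Y" for a x
      proof -
        obtain y where "(x, y) \<in> Y" using \<open>x \<in> fst ` Y\<close> by auto
        then have "(a, \<zero>\<^bsub>A\<^esub>) \<odot>\<^bsub>tuple_module S\<^esub> (x, y) \<in> Y"
          using a by (intro YD(4)) auto
        then show ?thesis by (force simp: image_iff)
      qed
    qed
    then have fst_Y: "fst ` Y = carrier (tup0 S)"
    proof (rule M0.superfluousD[OF sup N])
      fix x assume "x \<in> carrier (tup0 S)"
      then have "(x, \<zero>\<^bsub>tup1 S\<^esub>) \<in> carrier (tuple_module S)" by simp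
      from cover[OF this] obtain s0 s1 n0 n1 where s: "(s0, s1) \<in> Y" and "n0 \<in> N"
        and "(x, \<zero>\<^bsub>tup1 S\<^esub>) = (s0, s1) \<oplus>\<^bsub>tuple_module S\<^esub> (n0, n1)" by auto
      moreover have "s0 \<in> fst ` Y" using image_eqI[OF _ s, of s0 fst] by simp
      ultimately show "\<exists>s\<in>fst ` Y. \<exists>n\<in>N. x = s \<oplus>\<^bsub>tup0 S\<^esub> n" by auto
    qed
    have snd_Y: "(\<zero>\<^bsub>tup0 S\<^esub>, y) \<in> Y" if y: "y \<in> carrier (tup1 S)" for y
    proof -
      obtain x where x: "x \<in> carrier (tup0 S)" "y = tupT S x"
        using y onto by auto
      obtain z where z: "(x, z) \<in> Y"
        using x(1) fst_Y by force
      have "(\<zero>\<^bsub>A\<^esub>, \<one>\<^bsub>A\<^esub>) \<odot>\<^bsub>tuple_module S\<^esub> (x, z) \<in> Y"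
        using z by (intro YD(4)) auto
      then show ?thesis
        using x Ym[OF z] by (simp add: M0.smult_zero_left M1.smult_zero_left M1.smult_one tupf_zero_left)
    qed
    show "carrier (tuple_module S) \<subseteq> Y"
    proof
      fix m assume "m \<in> carrier (tuple_module S)"
      then obtain m0 m1 where m: "m = (m0, m1)" "m0 \<in> carrier (tup0 S)" "m1 \<in> carrier (tup1 S)"
        by auto
      obtain z where z: "(m0, z) \<in> Y"
        using m(2) fst_Y by force
      have "(m0, z) \<oplus>\<^bsub>tuple_module S\<^esub> (\<zero>\<^bsub>tup0 S\<^esub>, \<ominus>\<^bsub>tup1 S\<^esub> z \<oplus>\<^bsub>tup1 S\<^esub> m1) \<in> Y"
        using z m Ym[OF z] by (intro YD(3) snd_Y) auto
      then show "m \<in> Y"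
        using m Ym[OF z] by (simp add: M1.M.r_neg flip: M1.M.a_assoc)
    qed
  qed
qed

end

context deformation
begin

lemma tuple_map_mhom:
  assumes S: "is_tuple K A f S" and Y: "is_tuple K A f Y" and u: "is_tuple_mor K A S Y u"
  shows "tuple_map Y u \<in> mhom Af (tuple_module S) (tuple_module Y)"
proof -
  interpret S: deformed_tuple K A f S by unfold_locales fact
  interpret Y: deformed_tuple K A f Y by unfold_locales fact
  obtain u0 u1 u2 where u_eq: "u = (u0, u1, u2)" by (cases u)
  have u0: "u0 \<in> mhom A (tup0 S) (tup0 Y)" and u2: "u2 \<in> mhom A (tup1 S) (tup1 Y)"
    and u1: "u1 \<in> mhom K (kspace A (tup0 S)) (kspace A (tup1 Y))"
    and comm: "\<And>m. m \<in> carrier (tup0 S) \<Longrightarrow> tupT Y (u0 m) = u2 (tupT S m)"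
    and act: "\<And>a m. a \<in> carrier A \<Longrightarrow> m \<in> carrier (tup0 S) \<Longrightarrow> u1 (a \<odot>\<^bsub>tup0 S\<^esub> m) =
      a \<odot>\<^bsub>tup1 Y\<^esub> u1 m \<ominus>\<^bsub>tup1 Y\<^esub> u2 (tupf S a m) \<oplus>\<^bsub>tup1 Y\<^esub> tupf Y a (u0 m)"
    using u by (auto simp: is_tuple_mor_def u_eq)
  note u0D = mhomD[OF u0] and u2D = mhomD[OF u2] and u1D = mhomD(1,2)[OF u1, simplified]
  have map_eq: "tuple_map Y u (m0, m1) = (u0 m0, u1 m0 \<oplus>\<^bsub>tup1 Y\<^esub> u2 m1)" for m0 m1
    by (simp add: tuple_map_def u_eq)
  show ?thesis
  proof (rule mhomI)
    show "tuple_map Y u m \<in> carrier (tuple_module Y)" if "m \<in> carrier (tuple_module S)" for m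
      using that by (cases m) (simp add: map_eq u0D u1D u2D)
    show "tuple_map Y u (m \<oplus>\<^bsub>tuple_module S\<^esub> n)
        = tuple_map Y u m \<oplus>\<^bsub>tuple_module Y\<^esub> tuple_map Y u n"
      if "m \<in> carrier (tuple_module S)" "n \<in> carrier (tuple_module S)" for m n
      using that by (cases m; cases n) (simp add: map_eq u0D u1D u2D Y.M1.M.a_ac)
    show "tuple_map Y u (x \<odot>\<^bsub>tuple_module S\<^esub> m) = x \<odot>\<^bsub>tuple_module Y\<^esub> tuple_map Y u m"
      if "x \<in> carrier Af" "m \<in> carrier (tuple_module S)" for x m
    proof -
      obtain a b m0 m1 where xm: "x = (a, b)" "m = (m0, m1)" by (cases x; cases m)
      have [simp]: "a \<in> carrier A" "b \<in> carrier A" "m0 \<in> carrier (tup0 S)" "m1 \<in> carrier (tup1 S)"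
        using that xm by auto
      note closed = Y.M1.smult_closed S.M1.smult_closed S.M0.smult_closed Y.M0.smult_closed u0D(1) u1D(1) u2D(1)
      have act': "u1 (a \<odot>\<^bsub>tup0 S\<^esub> m0) \<oplus>\<^bsub>tup1 Y\<^esub> u2 (tupf S a m0)
          = a \<odot>\<^bsub>tup1 Y\<^esub> u1 m0 \<oplus>\<^bsub>tup1 Y\<^esub> tupf Y a (u0 m0)"
        using act[of a m0] Y.M1.M.eq_diff_plus_iff[of "u1 (a \<odot>\<^bsub>tup0 S\<^esub> m0)"
          "a \<odot>\<^bsub>tup1 Y\<^esub> u1 m0" "u2 (tupf S a m0)" "tupf Y a (u0 m0)"]
        by (simp add: closed)
      let ?p = "a \<odot>\<^bsub>tup1 Y\<^esub> u2 m1 \<oplus>\<^bsub>tup1 Y\<^esub> b \<odot>\<^bsub>tup1 Y\<^esub> tupT Y (u0 m0)"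
      have "u1 (a \<odot>\<^bsub>tup0 S\<^esub> m0)
          \<oplus>\<^bsub>tup1 Y\<^esub> u2 (a \<odot>\<^bsub>tup1 S\<^esub> m1 \<oplus>\<^bsub>tup1 S\<^esub> b \<odot>\<^bsub>tup1 S\<^esub> tupT S m0 \<oplus>\<^bsub>tup1 S\<^esub> tupf S a m0)
        = ?p \<oplus>\<^bsub>tup1 Y\<^esub> (u1 (a \<odot>\<^bsub>tup0 S\<^esub> m0) \<oplus>\<^bsub>tup1 Y\<^esub> u2 (tupf S a m0))"
        by (simp add: u2D(2,3) comm closed Y.M1.M.a_ac)
      also have "\<dots> = a \<odot>\<^bsub>tup1 Y\<^esub> (u1 m0 \<oplus>\<^bsub>tup1 Y\<^esub> u2 m1)
          \<oplus>\<^bsub>tup1 Y\<^esub> b \<odot>\<^bsub>tup1 Y\<^esub> tupT Y (u0 m0) \<oplus>\<^bsub>tup1 Y\<^esub> tupf Y a (u0 m0)"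
        unfolding act' by (simp add: closed Y.M1.smult_r_distr Y.M1.M.a_ac)
      finally show ?thesis
        by (simp add: xm map_eq u0D)
    qed
  qed
qed

end

section \<open>Homomorphisms given by components\<close>

lemma mhom_comp:
  assumes "h \<in> mhom R L M" "g \<in> mhom R M N"
  shows "(\<lambda>x. g (h x)) \<in> mhom R L N"
  using mhomD[OF assms(1)] mhomD[OF assms(2)] by (intro mhomI) auto

lemma mhom_add:
  assumes "h \<in> mhom R M N" "g \<in> mhom R M N" "left_module R N"
  shows "(\<lambda>x. h x \<oplus>\<^bsub>N\<^esub> g x) \<in> mhom R M N"
proof -
  interpret N: left_module R N by fact
  show ?thesis
    using mhomD[OF assms(1)] mhomD[OF assms(2)]
    by (intro mhomI) (auto simp: N.smult_r_distr N.smult_closed N.M.a_ac)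
qed

lemma mhom_component: "i \<in> I \<Longrightarrow> (\<lambda>x. x i) \<in> mhom R (direct_sum I M) (M i)"
  by (intro mhomI) auto

lemma mhom_comp_component:
  assumes "i \<in> I" "g \<in> mhom R (M i) N"
  shows "(\<lambda>x. g (x i)) \<in> mhom R (direct_sum I M) N"
  by (rule mhom_comp[where h = "\<lambda>x. x i" and g = g and M = "M i"]) (rule mhom_component assms)+

lemma mhom_family:
  assumes "\<And>i. i \<in> I \<Longrightarrow> h i \<in> mhom R L (M i)"
  shows "(\<lambda>x. \<lambda>i\<in>I. h i x) \<in> mhom R L (direct_sum I M)"
proof -
  note h = mhomD[OF assms]
  show ?thesis
    by (intro mhomI) (auto simp: h intro!: restrict_ext)
qed

lemma mhom_image_codomain:
  "h \<in> mhom R M N \<Longrightarrow> h \<in> mhom R M (N\<lparr>carrier := h ` carrier M\<rparr>)"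
  by (auto simp: mhom_def)

lemma mhom_kspace:
  assumes "h \<in> mhom A M N" "\<And>c. c \<in> carrier K \<Longrightarrow> c \<odot>\<^bsub>A\<^esub> \<one>\<^bsub>A\<^esub> \<in> carrier A"
  shows "h \<in> mhom K (kspace A M) (kspace A N)"
  using mhomD[OF assms(1)] assms(2) by (intro mhomI) auto

lemma alt_sign_Suc_Suc: "alt_sign M (Suc (Suc i)) x = alt_sign M i x"
  by (simp add: alt_sign_def)

lemma alt_sign_kspace: "alt_sign (kspace A M) i x = alt_sign M i x"
  by (simp add: alt_sign_def)

context left_module
begin

lemma alt_sign_mhom: "alt_sign M i \<in> mhom R M M"
  by (intro mhomI) (auto simp: alt_sign_def M.minus_add smult_minus_right)

lemma alt_sign_closed: "x \<in> carrier M \<Longrightarrow> alt_sign M i x \<in> carrier M"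
  by (rule mhomD(1)[OF alt_sign_mhom])

lemma alt_sign_alt_sign: "x \<in> carrier M \<Longrightarrow> alt_sign M i (alt_sign M i x) = x"
  by (simp add: alt_sign_def)

lemma alt_sign_Suc: "x \<in> carrier M \<Longrightarrow> alt_sign M (Suc i) x = \<ominus>\<^bsub>M\<^esub> alt_sign M i x"
  by (simp add: alt_sign_def)

lemma alt_sign_shift:
  assumes "p \<in> carrier M" "s \<in> carrier M" "t \<in> carrier M" "g \<in> carrier M" "h \<in> carrier M"
    and "s \<ominus>\<^bsub>M\<^esub> t = alt_sign M i (g \<ominus>\<^bsub>M\<^esub> h)"
  shows "alt_sign M i (p \<oplus>\<^bsub>M\<^esub> s) \<oplus>\<^bsub>M\<^esub> h = alt_sign M i (p \<oplus>\<^bsub>M\<^esub> t) \<oplus>\<^bsub>M\<^esub> g"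
proof -
  note add = mhomD(2)[OF alt_sign_mhom]
  have "s = alt_sign M i (g \<ominus>\<^bsub>M\<^esub> h) \<oplus>\<^bsub>M\<^esub> t"
    using assms M.add.inv_solve_right'[of "alt_sign M i (g \<ominus>\<^bsub>M\<^esub> h)" s t]
    by (simp add: a_minus_def alt_sign_closed)
  then have "alt_sign M i (p \<oplus>\<^bsub>M\<^esub> s)
      = alt_sign M i p \<oplus>\<^bsub>M\<^esub> ((g \<oplus>\<^bsub>M\<^esub> \<ominus>\<^bsub>M\<^esub> h) \<oplus>\<^bsub>M\<^esub> alt_sign M i t)"
    using assms(1-5) by (simp add: add alt_sign_closed alt_sign_alt_sign a_minus_def)
  then have "alt_sign M i (p \<oplus>\<^bsub>M\<^esub> s) \<oplus>\<^bsub>M\<^esub> h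
      = (alt_sign M i p \<oplus>\<^bsub>M\<^esub> alt_sign M i t \<oplus>\<^bsub>M\<^esub> g) \<oplus>\<^bsub>M\<^esub> (\<ominus>\<^bsub>M\<^esub> h \<oplus>\<^bsub>M\<^esub> h)"
    using assms(1-5) by (simp add: alt_sign_closed M.a_ac)
  then show ?thesis
    using assms(1-5) by (simp add: add alt_sign_closed M.l_neg)
qed

end

lemma mhom_alt_sign:
  assumes "h \<in> mhom R M N" "left_module R M" "left_module R N" "x \<in> carrier M"
  shows "h (alt_sign M i x) = alt_sign N i (h x)"
  using mhom_minus[OF assms] by (simp add: alt_sign_def)

section \<open>The projective modules \<open>Q\<close> and the sums of their hats\<close>

lemma left_ideal_module_simps [simp]:
  "carrier (left_ideal_module A x) = (\<lambda>a. a \<otimes>\<^bsub>A\<^esub> x) ` carrier A"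
  "\<zero>\<^bsub>left_ideal_module A x\<^esub> = \<zero>\<^bsub>A\<^esub>"
  "add (left_ideal_module A x) = add A"
  "smult (left_ideal_module A x) = monoid.mult A"
  by (simp_all add: left_ideal_module_def)

locale hat_sums = deformation K A f
  for K :: "'k ring" and A :: "('k, 'a) module" and f :: "'a \<Rightarrow> 'a \<Rightarrow> 'a" +
  fixes e :: "nat \<Rightarrow> 'a" and js :: "nat \<Rightarrow> nat list" and Q :: "nat \<Rightarrow> ('a, nat \<Rightarrow> 'a) module"
  assumes idem_closed: "\<And>i r. r < length (js i) \<Longrightarrow> e (js i ! r) \<in> carrier A"
    and idem: "\<And>i r. r < length (js i) \<Longrightarrow> e (js i ! r) \<otimes>\<^bsub>A\<^esub> e (js i ! r) = e (js i ! r)"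
    and Q_eq: "Q = (\<lambda>i. proj_sum A e (js i))"
    and fd_Q: "\<And>i. fd_module K A (Q i)"
begin

abbreviation P :: "nat \<Rightarrow> ('a, nat \<Rightarrow> nat \<Rightarrow> 'a) module" where "P m \<equiv> direct_sum {..m} Q"
abbreviation fQ :: "nat \<Rightarrow> 'a \<Rightarrow> (nat \<Rightarrow> 'a) \<Rightarrow> nat \<Rightarrow> 'a" where "fQ i \<equiv> f_proj A f e (js i)"
abbreviation hat :: "nat \<Rightarrow> ('a, nat \<Rightarrow> nat \<Rightarrow> 'a, nat \<Rightarrow> nat \<Rightarrow> 'a) tuple" where
  "hat m \<equiv> hat_sum A f e js m"

lemma mem_left_ideal_iff:
  assumes "r < length (js i)"
  shows "y \<in> (\<lambda>a. a \<otimes>\<^bsub>A\<^esub> e (js i ! r)) ` carrier A \<longleftrightarrow> y \<in> carrier A \<and> y \<otimes>\<^bsub>A\<^esub> e (js i ! r) = y"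
  using idem_closed[OF assms] idem[OF assms] by (auto simp: A.m_assoc image_iff) metis

lemma carrier_Q: "carrier (Q i) = (\<Pi>\<^sub>E r\<in>{..<length (js i)}. (\<lambda>a. a \<otimes>\<^bsub>A\<^esub> e (js i ! r)) ` carrier A)"
  by (simp add: Q_eq proj_sum_def)

lemma Q_entry:
  assumes "x \<in> carrier (Q i)" "r < length (js i)"
  shows "x r \<in> carrier A" "x r \<otimes>\<^bsub>A\<^esub> e (js i ! r) = x r"
  using assms PiE_mem[of x "{..<length (js i)}"] mem_left_ideal_iff[of r i "x r"]
  by (auto simp: carrier_Q)

lemma restrict_in_Q:
  assumes "\<And>r. r < length (js i) \<Longrightarrow> g r \<in> carrier A"
    and "\<And>r. r < length (js i) \<Longrightarrow> g r \<otimes>\<^bsub>A\<^esub> e (js i ! r) = g r"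
  shows "(\<lambda>r\<in>{..<length (js i)}. g r) \<in> carrier (Q i)"
  using assms by (simp add: carrier_Q restrict_PiE_iff mem_left_ideal_iff)

lemma Q_zero: "\<zero>\<^bsub>Q i\<^esub> = (\<lambda>r\<in>{..<length (js i)}. \<zero>\<^bsub>A\<^esub>)"
  and Q_add: "x \<oplus>\<^bsub>Q i\<^esub> y = (\<lambda>r\<in>{..<length (js i)}. x r \<oplus>\<^bsub>A\<^esub> y r)"
  and Q_smult: "a \<odot>\<^bsub>Q i\<^esub> x = (\<lambda>r\<in>{..<length (js i)}. a \<otimes>\<^bsub>A\<^esub> x r)"
  by (simp_all add: Q_eq proj_sum_def)

lemma left_module_Q: "left_module A (Q i)"
  using fd_Q by (simp add: fd_module_def)

sublocale Q: left_module A "Q i" for i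
  by (rule left_module_Q)

lemma left_module_P: "left_module A (P m)"
  by (rule left_module_direct_sum[OF ring_A left_module_Q])

lemma f_proj_closed:
  assumes "a \<in> carrier A" "x \<in> carrier (Q i)"
  shows "fQ i a x \<in> carrier (Q i)"
  unfolding f_proj_def
  by (intro restrict_in_Q) (auto simp: Q_entry[OF assms(2)] assms(1) idem_closed idem A.m_assoc)

lemma f_proj_bilinear: "bilinear_map K A (kspace A (Q i)) (kspace A (Q i)) (fQ i)"
  unfolding bilinear_map_def
proof (intro conjI ballI)
  fix a assume a: "a \<in> carrier A"
  show "fQ i a \<in> mhom K (kspace A (Q i)) (kspace A (Q i))"
  proof (rule mhomI)
    fix x y assume "x \<in> carrier (kspace A (Q i))" "y \<in> carrier (kspace A (Q i))"
    then have "x \<in> carrier (Q i)" "y \<in> carrier (Q i)" by auto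
    note xy = Q_entry[OF this(1)] Q_entry[OF this(2)]
    show "fQ i a (x \<oplus>\<^bsub>kspace A (Q i)\<^esub> y) = fQ i a x \<oplus>\<^bsub>kspace A (Q i)\<^esub> fQ i a y"
      using xy a by (auto simp: f_proj_def Q_add f_add_right A.l_distr idem_closed intro!: restrict_ext)
  next
    fix c x assume c: "c \<in> carrier K" and "x \<in> carrier (kspace A (Q i))"
    then have "x \<in> carrier (Q i)" by auto
    note x = Q_entry[OF this]
    show "fQ i a (c \<odot>\<^bsub>kspace A (Q i)\<^esub> x) = c \<odot>\<^bsub>kspace A (Q i)\<^esub> fQ i a x"
      using x a c by (auto simp: f_proj_def Q_smult scal_mult f_scalar_right idem_closed
        fd_algebra.smult_mult_left[OF algebra] intro!: restrict_ext)
  qed (use a f_proj_closed in auto)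
next
  fix x assume "x \<in> carrier (kspace A (Q i))"
  then have x: "x \<in> carrier (Q i)" by simp
  show "(\<lambda>a. fQ i a x) \<in> mhom K A (kspace A (Q i))"
  proof (rule mhomI)
    show "fQ i (a \<oplus>\<^bsub>A\<^esub> b) x = fQ i a x \<oplus>\<^bsub>kspace A (Q i)\<^esub> fQ i b x"
      if "a \<in> carrier A" "b \<in> carrier A" for a b
      using that Q_entry[OF x]
      by (auto simp: f_proj_def Q_add f_add_left A.l_distr idem_closed intro!: restrict_ext)
    show "fQ i (c \<odot>\<^bsub>A\<^esub> a) x = c \<odot>\<^bsub>kspace A (Q i)\<^esub> fQ i a x"
      if "c \<in> carrier K" "a \<in> carrier A" for c a
      using that Q_entry[OF x]
      by (auto simp: f_proj_def Q_smult f_scalar_left idem_closed scal_mult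
        fd_algebra.smult_mult_left[OF algebra] intro!: restrict_ext)
  qed (use x f_proj_closed in auto)
qed

lemma f_proj_cocycle:
  assumes "a \<in> carrier A" "b \<in> carrier A" "x \<in> carrier (Q i)"
  shows "a \<odot>\<^bsub>Q i\<^esub> fQ i b x \<oplus>\<^bsub>Q i\<^esub> fQ i a (b \<odot>\<^bsub>Q i\<^esub> x)
    = fQ i (a \<otimes>\<^bsub>A\<^esub> b) x \<oplus>\<^bsub>Q i\<^esub> f a b \<odot>\<^bsub>Q i\<^esub> x"
proof -
  have "a \<otimes>\<^bsub>A\<^esub> (f b (x r) \<otimes>\<^bsub>A\<^esub> e (js i ! r)) \<oplus>\<^bsub>A\<^esub> f a (b \<otimes>\<^bsub>A\<^esub> x r) \<otimes>\<^bsub>A\<^esub> e (js i ! r)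
      = f (a \<otimes>\<^bsub>A\<^esub> b) (x r) \<otimes>\<^bsub>A\<^esub> e (js i ! r) \<oplus>\<^bsub>A\<^esub> f a b \<otimes>\<^bsub>A\<^esub> x r" if "r < length (js i)" for r
  proof -
    note x = Q_entry[OF assms(3) that] and [simp] = idem_closed[OF that]
    have "a \<otimes>\<^bsub>A\<^esub> (f b (x r) \<otimes>\<^bsub>A\<^esub> e (js i ! r)) \<oplus>\<^bsub>A\<^esub> f a (b \<otimes>\<^bsub>A\<^esub> x r) \<otimes>\<^bsub>A\<^esub> e (js i ! r)
      = (a \<otimes>\<^bsub>A\<^esub> f b (x r) \<oplus>\<^bsub>A\<^esub> f a (b \<otimes>\<^bsub>A\<^esub> x r)) \<otimes>\<^bsub>A\<^esub> e (js i ! r)"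
      using x assms by (simp add: A.l_distr A.m_assoc)
    also have "\<dots> = (f (a \<otimes>\<^bsub>A\<^esub> b) (x r) \<oplus>\<^bsub>A\<^esub> f a b \<otimes>\<^bsub>A\<^esub> x r) \<otimes>\<^bsub>A\<^esub> e (js i ! r)"
      using x assms by (simp add: f_cocycle)
    finally show ?thesis
      using x assms by (simp add: A.l_distr A.m_assoc)
  qed
  then show ?thesis
    by (auto simp: f_proj_def Q_add Q_smult intro!: restrict_ext)
qed

lemma hat_simps [simp]:
  "tup0 (hat m) = P m" "tup1 (hat m) = P m" "tupT (hat m) = (\<lambda>x. x)"
  "tupf (hat m) = (\<lambda>a x. \<lambda>i\<in>{..m}. fQ i a (x i))"
  by (simp_all add: hat_sum_def Q_eq)

lemma is_tuple_hat: "is_tuple K A f (hat m)"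
  unfolding is_tuple_def
proof (intro conjI ballI)
  show "fd_module K A (tup0 (hat m))" "fd_module K A (tup1 (hat m))"
    by (simp_all add: fd_module_direct_sum[OF algebra] fd_Q)
  show "tupT (hat m) \<in> mhom A (tup0 (hat m)) (tup1 (hat m))"
    by (rule mhomI) auto
  show "inj_on (tupT (hat m)) (carrier (tup0 (hat m)))"
    by simp
  have r: "fQ i a \<in> mhom K (kspace A (Q i)) (kspace A (Q i))" if "a \<in> carrier A" for i a
    using f_proj_bilinear that by (simp add: bilinear_map_def)
  have l: "(\<lambda>a. fQ i a x) \<in> mhom K A (kspace A (Q i))" if "x \<in> carrier (Q i)" for i x
    using f_proj_bilinear that by (simp add: bilinear_map_def)
  have "(\<lambda>x. \<lambda>i\<in>{..m}. fQ i a (x i)) \<in> mhom K (kspace A (P m)) (kspace A (P m))"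
    if "a \<in> carrier A" for a
    unfolding kspace_direct_sum by (intro mhom_family mhom_comp_component r that)
  moreover have "(\<lambda>a. \<lambda>i\<in>{..m}. fQ i a (x i)) \<in> mhom K A (kspace A (P m))"
    if "x \<in> carrier (P m)" for x
    unfolding kspace_direct_sum by (intro mhom_family l) (use that in auto)
  ultimately show "bilinear_map K A (kspace A (tup0 (hat m))) (kspace A (tup1 (hat m))) (tupf (hat m))"
    unfolding bilinear_map_def hat_simps by (simp only: kspace_simps(1)) blast
next
  fix a b x assume a: "a \<in> carrier A" and b: "b \<in> carrier A" and "x \<in> carrier (tup0 (hat m))"
  then have x: "x \<in> carrier (P m)" by simp
  interpret P: left_module A "P m" by (rule left_module_P)
  have xi: "x i \<in> carrier (Q i)" if "i \<le> m" for i using x that by auto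
  let ?F = "\<lambda>a x. \<lambda>i\<in>{..m}. fQ i a (x i)"
  have F: "?F a x \<in> carrier (P m)" if "a \<in> carrier A" "x \<in> carrier (P m)" for a x
    using that by (auto intro!: f_proj_closed)
  have "a \<odot>\<^bsub>P m\<^esub> ?F b x \<oplus>\<^bsub>P m\<^esub> ?F a (b \<odot>\<^bsub>P m\<^esub> x) = ?F (a \<otimes>\<^bsub>A\<^esub> b) x \<oplus>\<^bsub>P m\<^esub> f a b \<odot>\<^bsub>P m\<^esub> x"
    using xi a b by (auto simp: f_proj_cocycle intro!: restrict_ext)
  then have "a \<odot>\<^bsub>P m\<^esub> ?F b x \<ominus>\<^bsub>P m\<^esub> ?F (a \<otimes>\<^bsub>A\<^esub> b) x \<oplus>\<^bsub>P m\<^esub> ?F a (b \<odot>\<^bsub>P m\<^esub> x)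
      \<ominus>\<^bsub>P m\<^esub> f a b \<odot>\<^bsub>P m\<^esub> x = \<zero>\<^bsub>P m\<^esub>"
    using a b x by (subst P.M.diff_plus_diff_eq_zero_iff) (blast intro: P.smult_closed F f_closed A.m_closed)+
  then show "a \<odot>\<^bsub>tup1 (hat m)\<^esub> tupf (hat m) b x \<ominus>\<^bsub>tup1 (hat m)\<^esub> tupf (hat m) (a \<otimes>\<^bsub>A\<^esub> b) x
      \<oplus>\<^bsub>tup1 (hat m)\<^esub> tupf (hat m) a (b \<odot>\<^bsub>tup0 (hat m)\<^esub> x)
      \<ominus>\<^bsub>tup1 (hat m)\<^esub> f a b \<odot>\<^bsub>tup1 (hat m)\<^esub> tupT (hat m) x = \<zero>\<^bsub>tup1 (hat m)\<^esub>"
    unfolding hat_simps .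
qed

sublocale hat: deformed_tuple K A f "hat m" for m
  by unfold_locales (rule is_tuple_hat)

subsection \<open>Projectivity\<close>

text \<open>The inclusion of \<open>A\<epsilon>\<close> into \<open>A\<close> does not respect the twisted actions, because the hat of \<open>A\<epsilon>\<close>
  uses \<open>f(a \<otimes> x) \<epsilon>\<close> where \<open>A\<^sub>f\<close> itself uses \<open>f(a \<otimes> x)\<close>.  Since \<open>\<epsilon> w = - \<epsilon>\<close> for \<open>w = 1 - 2\<epsilon>\<close>, the cocycle
  identity for \<open>a\<close>, \<open>x\<close>, \<open>\<epsilon>\<close>, multiplied by \<open>w\<close> from the right, shows that adding \<open>f(x \<otimes> \<epsilon>) w\<close> to the
  second component repairs this.\<close>

lemma twisted_inclusion:
  assumes "\<epsilon> \<in> carrier A" "\<epsilon> \<otimes>\<^bsub>A\<^esub> \<epsilon> = \<epsilon>" "a \<in> carrier A" "x \<in> carrier A" "x \<otimes>\<^bsub>A\<^esub> \<epsilon> = x"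
    and w: "w = \<one>\<^bsub>A\<^esub> \<ominus>\<^bsub>A\<^esub> (\<epsilon> \<oplus>\<^bsub>A\<^esub> \<epsilon>)"
  shows "f a x \<otimes>\<^bsub>A\<^esub> \<epsilon> \<oplus>\<^bsub>A\<^esub> f (a \<otimes>\<^bsub>A\<^esub> x) \<epsilon> \<otimes>\<^bsub>A\<^esub> w = a \<otimes>\<^bsub>A\<^esub> (f x \<epsilon> \<otimes>\<^bsub>A\<^esub> w) \<oplus>\<^bsub>A\<^esub> f a x"
proof -
  have w_closed: "w \<in> carrier A"
    using assms by simp
  define g where "g = f a x"
  define h where "h = g \<otimes>\<^bsub>A\<^esub> \<epsilon>"
  have [simp]: "g \<in> carrier A" "h \<in> carrier A"
    using assms by (auto simp: g_def h_def)
  have "\<epsilon> \<otimes>\<^bsub>A\<^esub> w = \<ominus>\<^bsub>A\<^esub> \<epsilon>"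
    unfolding w using assms(1,2)
    by (simp add: a_minus_def A.r_distr A.r_minus A.minus_add A.r_neg1 A.r_neg flip: A.a_assoc)
  then have hw: "h \<otimes>\<^bsub>A\<^esub> w = \<ominus>\<^bsub>A\<^esub> h"
    using assms(1) w_closed by (simp add: h_def A.m_assoc A.r_minus)
  have gw: "g \<otimes>\<^bsub>A\<^esub> w \<oplus>\<^bsub>A\<^esub> (h \<oplus>\<^bsub>A\<^esub> h) = g"
    unfolding w using assms(1)
    by (simp add: a_minus_def A.r_distr A.r_minus h_def A.a_assoc A.l_neg)
  have "(a \<otimes>\<^bsub>A\<^esub> f x \<epsilon> \<oplus>\<^bsub>A\<^esub> g) \<otimes>\<^bsub>A\<^esub> w = (f (a \<otimes>\<^bsub>A\<^esub> x) \<epsilon> \<oplus>\<^bsub>A\<^esub> h) \<otimes>\<^bsub>A\<^esub> w"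
    using f_cocycle[of a x \<epsilon>] assms by (simp add: g_def h_def)
  then have *: "a \<otimes>\<^bsub>A\<^esub> (f x \<epsilon> \<otimes>\<^bsub>A\<^esub> w) \<oplus>\<^bsub>A\<^esub> g \<otimes>\<^bsub>A\<^esub> w = f (a \<otimes>\<^bsub>A\<^esub> x) \<epsilon> \<otimes>\<^bsub>A\<^esub> w \<oplus>\<^bsub>A\<^esub> \<ominus>\<^bsub>A\<^esub> h"
    using assms(1,3,4) w_closed by (simp add: A.l_distr A.m_assoc hw)
  have "a \<otimes>\<^bsub>A\<^esub> (f x \<epsilon> \<otimes>\<^bsub>A\<^esub> w) \<oplus>\<^bsub>A\<^esub> g = (a \<otimes>\<^bsub>A\<^esub> (f x \<epsilon> \<otimes>\<^bsub>A\<^esub> w) \<oplus>\<^bsub>A\<^esub> g \<otimes>\<^bsub>A\<^esub> w) \<oplus>\<^bsub>A\<^esub> (h \<oplus>\<^bsub>A\<^esub> h)"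
    using assms(1,3,4) w_closed by (subst gw[symmetric]) (simp add: A.a_assoc)
  also have "\<dots> = f (a \<otimes>\<^bsub>A\<^esub> x) \<epsilon> \<otimes>\<^bsub>A\<^esub> w \<oplus>\<^bsub>A\<^esub> ((\<ominus>\<^bsub>A\<^esub> h \<oplus>\<^bsub>A\<^esub> h) \<oplus>\<^bsub>A\<^esub> h)"
    unfolding * using assms(1,3,4) w_closed by (simp add: A.a_assoc)
  also have "\<dots> = f (a \<otimes>\<^bsub>A\<^esub> x) \<epsilon> \<otimes>\<^bsub>A\<^esub> w \<oplus>\<^bsub>A\<^esub> h"
    by (simp add: A.l_neg)
  also have "\<dots> = h \<oplus>\<^bsub>A\<^esub> f (a \<otimes>\<^bsub>A\<^esub> x) \<epsilon> \<otimes>\<^bsub>A\<^esub> w"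
    using assms(1,3,4) w_closed by (simp add: A.a_comm)
  finally show ?thesis
    by (simp add: g_def h_def)
qed

definition reflection :: "nat \<times> nat \<Rightarrow> 'a" where
  "reflection j = \<one>\<^bsub>A\<^esub> \<ominus>\<^bsub>A\<^esub> (e (js (fst j) ! snd j) \<oplus>\<^bsub>A\<^esub> e (js (fst j) ! snd j))"

text \<open>The entry of index \<open>j\<close> of an element of the hat, mapped to \<open>A\<^sub>f\<close> by the corrected inclusion.  The
  factor \<open>1 - 2\<epsilon>\<close> rather than \<open>1 - \<epsilon>\<close> has the further effect that multiplying the generator
  \<open>(\<epsilon>, 0)\<close> by this element of \<open>A\<^sub>f\<close> gives back exactly the entry.\<close>

definition coord :: "nat \<times> nat \<Rightarrow> (nat \<Rightarrow> nat \<Rightarrow> 'a) \<times> (nat \<Rightarrow> nat \<Rightarrow> 'a) \<Rightarrow> 'a \<times> 'a" where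
  "coord j z = (fst z (fst j) (snd j),
     snd z (fst j) (snd j) \<oplus>\<^bsub>A\<^esub> f (fst z (fst j) (snd j)) (e (js (fst j) ! snd j)) \<otimes>\<^bsub>A\<^esub> reflection j)"

definition trunc :: "nat \<Rightarrow> (nat \<times> nat) set \<Rightarrow> (nat \<Rightarrow> nat \<Rightarrow> 'a) \<Rightarrow> nat \<Rightarrow> nat \<Rightarrow> 'a" where
  "trunc m F x = (\<lambda>i\<in>{..m}. \<lambda>r\<in>{..<length (js i)}. if (i, r) \<in> F then x i r else \<zero>\<^bsub>A\<^esub>)"

definition basis :: "nat \<Rightarrow> nat \<times> nat \<Rightarrow> (nat \<Rightarrow> nat \<Rightarrow> 'a) \<times> (nat \<Rightarrow> nat \<Rightarrow> 'a)" where
  "basis m j = (trunc m {j} (\<lambda>i r. e (js i ! r)), \<zero>\<^bsub>P m\<^esub>)"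

lemma P_entry:
  assumes "x \<in> carrier (P m)" "i \<le> m" "r < length (js i)"
  shows "x i r \<in> carrier A" "x i r \<otimes>\<^bsub>A\<^esub> e (js i ! r) = x i r"
  using Q_entry[of "x i" i r] assms by auto

lemma trunc_closed:
  assumes "\<And>i r. (i, r) \<in> F \<Longrightarrow> i \<le> m \<Longrightarrow> r < length (js i) \<Longrightarrow>
    x i r \<in> carrier A \<and> x i r \<otimes>\<^bsub>A\<^esub> e (js i ! r) = x i r"
  shows "trunc m F x \<in> carrier (P m)"
  unfolding trunc_def direct_sum_simps
  by (auto simp: restrict_PiE_iff assms idem_closed intro!: restrict_in_Q)

lemma reflection_closed: "r < length (js i) \<Longrightarrow> reflection (i, r) \<in> carrier A"
  using idem_closed by (simp add: reflection_def)

lemma reflection_idem: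
  assumes "r < length (js i)"
  shows "reflection (i, r) \<otimes>\<^bsub>A\<^esub> e (js i ! r) = \<ominus>\<^bsub>A\<^esub> e (js i ! r)"
  using idem_closed[OF assms] idem[OF assms]
  by (simp add: reflection_def a_minus_def A.l_distr A.l_minus A.minus_add A.r_neg1 A.r_neg flip: A.a_assoc)

text \<open>In the second component the action on the generator contributes \<open>f(x \<otimes> \<epsilon>) \<epsilon>\<close>, and the correction
  term contributes \<open>f(x \<otimes> \<epsilon>) w \<epsilon> = - f(x \<otimes> \<epsilon>) \<epsilon>\<close>.\<close>

lemma coord_smult_basis:
  assumes x: "x \<in> carrier (P m)" and y: "y \<in> carrier (P m)" and i: "i \<le> m" and r: "r < length (js i)"
  shows "coord (i, r) (x, y) \<odot>\<^bsub>tuple_module (hat m)\<^esub> basis m (i, r) = (trunc m {(i, r)} x, trunc m {(i, r)} y)"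
proof -
  let ?e = "e (js i ! r)"
  note [simp] = P_entry[OF x i r] P_entry[OF y i r] idem_closed[OF r] idem[OF r] reflection_closed[OF r]
  have first: "x i r \<odot>\<^bsub>P m\<^esub> trunc m {(i, r)} (\<lambda>i r. e (js i ! r)) = trunc m {(i, r)} x"
    by (auto simp: trunc_def Q_smult intro!: restrict_ext)
  let ?b = "y i r \<oplus>\<^bsub>A\<^esub> f (x i r) ?e \<otimes>\<^bsub>A\<^esub> reflection (i, r)"
  have "\<zero>\<^bsub>A\<^esub> \<oplus>\<^bsub>A\<^esub> ?b \<otimes>\<^bsub>A\<^esub> ?e \<oplus>\<^bsub>A\<^esub> f (x i r) ?e \<otimes>\<^bsub>A\<^esub> ?e = y i r"
    using reflection_idem[OF r] by (simp add: A.l_distr A.m_assoc A.r_minus A.a_assoc A.l_neg)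
  then have "x i r \<odot>\<^bsub>P m\<^esub> \<zero>\<^bsub>P m\<^esub> \<oplus>\<^bsub>P m\<^esub> ?b \<odot>\<^bsub>P m\<^esub> trunc m {(i, r)} (\<lambda>i r. e (js i ! r))
      \<oplus>\<^bsub>P m\<^esub> (\<lambda>k\<in>{..m}. fQ k (x i r) (trunc m {(i, r)} (\<lambda>i r. e (js i ! r)) k))
    = trunc m {(i, r)} y"
    by (auto simp: trunc_def Q_smult Q_add Q_zero f_proj_def f_zero idem_closed intro!: restrict_ext)
  with first show ?thesis
    by (simp only: coord_def basis_def fst_conv snd_conv tuple_module_simps hat_simps)
qed

lemma projective_hat: "projective TYPE('n) Af (tuple_module (hat m))"
proof -
  let ?H = "tuple_module (hat m)"
  define J where "J = Sigma {..m} (\<lambda>i. {..<length (js i)})"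
  have J: "finite J" by (simp add: J_def)
  interpret H: left_module Af ?H by (rule hat.left_module_tuple)
  have basis: "basis m j \<in> carrier ?H" if "j \<in> J" for j
  proof -
    have "trunc m {j} (\<lambda>i r. e (js i ! r)) \<in> carrier (P m)"
      by (rule trunc_closed) (auto simp: idem_closed idem)
    moreover have "\<zero>\<^bsub>P m\<^esub> \<in> carrier (P m)"
      using hat.M0.M.zero_closed by simp
    ultimately show ?thesis by (simp add: basis_def)
  qed
  have dual: "(\<Oplus>\<^bsub>?H\<^esub>j\<in>F. coord j (x, y) \<odot>\<^bsub>?H\<^esub> basis m j) = (trunc m F x, trunc m F y)"
    if x: "x \<in> carrier (P m)" and y: "y \<in> carrier (P m)" and "finite F" "F \<subseteq> J" for x y F
    using that(3,4)
  proof (induction F)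
    case empty
    have "trunc m {} x = \<zero>\<^bsub>P m\<^esub>" for x
      by (auto simp: trunc_def Q_zero intro!: restrict_ext)
    then show ?case by (simp del: direct_sum_simps)
  next
    case (insert j F)
    have in_J: "i \<le> m \<and> r < length (js i)" if "(i, r) \<in> insert j F" for i r
      using insert.prems that by (auto simp: J_def)
    have single: "coord k (x, y) \<odot>\<^bsub>?H\<^esub> basis m k = (trunc m {k} x, trunc m {k} y)" if "k \<in> insert j F" for k
      using coord_smult_basis[OF x y, of "fst k" "snd k"] in_J[of "fst k" "snd k"] that by simp
    have tr: "trunc m G z \<in> carrier (P m)" if "z \<in> carrier (P m)" for G z
      using P_entry[OF that] by (intro trunc_closed) auto
    have add: "trunc m {j} z \<oplus>\<^bsub>P m\<^esub> trunc m F z = trunc m (insert j F) z" if "z \<in> carrier (P m)" for z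
      using P_entry(1)[OF that] insert.hyps(2)
      by (auto simp: trunc_def Q_add intro!: restrict_ext)
    have mem: "coord k (x, y) \<odot>\<^bsub>?H\<^esub> basis m k \<in> carrier ?H" if "k \<in> insert j F" for k
      unfolding single[OF that] using tr[OF x] tr[OF y] by (simp del: direct_sum_simps)
    have "(\<Oplus>\<^bsub>?H\<^esub>j\<in>insert j F. coord j (x, y) \<odot>\<^bsub>?H\<^esub> basis m j)
        = (trunc m {j} x, trunc m {j} y) \<oplus>\<^bsub>?H\<^esub> (trunc m F x, trunc m F y)"
      using insert mem by (subst H.M.finsum_insert) (auto simp: single simp del: tuple_module_simps)
    also have "\<dots> = (trunc m (insert j F) x, trunc m (insert j F) y)"
      by (simp only: tuple_module_simps hat_simps add[OF x] add[OF y])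
    finally show ?case .
  qed
  show ?thesis
  proof (rule projective_dual_basis[where J = J and p = "basis m" and s = coord])
    show "left_module Af ?H" by (rule hat.left_module_tuple)
    show "finite J" by (rule J)
    show "basis m j \<in> carrier ?H" if "j \<in> J" for j by (rule basis[OF that])
    have entry: "x i r \<in> carrier A" "x i r \<otimes>\<^bsub>A\<^esub> e (js i ! r) = x i r" if "(i, r) \<in> J" "x \<in> carrier (P m)" for x i r
      using P_entry[OF that(2), of i r] that(1) by (auto simp: J_def)
    have inJ: "e (js i ! r) \<in> carrier A" "e (js i ! r) \<otimes>\<^bsub>A\<^esub> e (js i ! r) = e (js i ! r)" "reflection (i, r) \<in> carrier A"
      if "(i, r) \<in> J" for i r
      using that idem_closed idem reflection_closed by (auto simp: J_def)
    show "coord j z \<in> carrier Af" if "j \<in> J" "z \<in> carrier ?H" for j z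
      using that entry inJ by (cases j; cases z) (simp add: coord_def del: direct_sum_simps)
    show "coord j (z \<oplus>\<^bsub>?H\<^esub> z') = coord j z \<oplus>\<^bsub>Af\<^esub> coord j z'"
      if "j \<in> J" "z \<in> carrier ?H" "z' \<in> carrier ?H" for j z z'
    proof -
      obtain i r x y x' y' where eq: "j = (i, r)" "z = (x, y)" "z' = (x', y')" by (cases j; cases z; cases z')
      then have P: "x \<in> carrier (P m)" "y \<in> carrier (P m)" "x' \<in> carrier (P m)" "y' \<in> carrier (P m)"
        using that by auto
      have ir: "(i, r) \<in> J" "i \<le> m" "r < length (js i)"
        using that eq by (auto simp: J_def)
      note [simp] = entry[OF ir(1) P(1)] entry[OF ir(1) P(2)] entry[OF ir(1) P(3)] entry[OF ir(1) P(4)]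
        inJ[OF ir(1)]
      have "(u \<oplus>\<^bsub>P m\<^esub> v) i r = u i r \<oplus>\<^bsub>A\<^esub> v i r" for u v
        using ir by (simp add: Q_add)
      then show ?thesis
        by (simp add: eq coord_def f_add_left A.l_distr A.a_ac del: direct_sum_simps)
    qed
    show "coord j (a \<odot>\<^bsub>?H\<^esub> z) = a \<otimes>\<^bsub>Af\<^esub> coord j z"
      if "j \<in> J" "a \<in> carrier Af" "z \<in> carrier ?H" for j a z
    proof -
      obtain i r x y a0 a1 where eq: "j = (i, r)" "z = (x, y)" "a = (a0, a1)" by (cases j; cases z; cases a)
      then have P: "x \<in> carrier (P m)" "y \<in> carrier (P m)" and a: "a0 \<in> carrier A" "a1 \<in> carrier A"
        using that by auto
      have ir: "(i, r) \<in> J" "i \<le> m" "r < length (js i)"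
        using that eq by (auto simp: J_def)
      note [simp] = entry[OF ir(1) P(1)] entry[OF ir(1) P(2)] inJ[OF ir(1)] a
      let ?e = "e (js i ! r)"
      define p where "p = a0 \<otimes>\<^bsub>A\<^esub> y i r \<oplus>\<^bsub>A\<^esub> a1 \<otimes>\<^bsub>A\<^esub> x i r"
      have p: "p \<in> carrier A" by (simp add: p_def)
      have "a0 \<otimes>\<^bsub>A\<^esub> y i r \<oplus>\<^bsub>A\<^esub> a1 \<otimes>\<^bsub>A\<^esub> x i r \<oplus>\<^bsub>A\<^esub> f a0 (x i r) \<otimes>\<^bsub>A\<^esub> ?e
          \<oplus>\<^bsub>A\<^esub> f (a0 \<otimes>\<^bsub>A\<^esub> x i r) ?e \<otimes>\<^bsub>A\<^esub> reflection (i, r)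
        = p \<oplus>\<^bsub>A\<^esub> (f a0 (x i r) \<otimes>\<^bsub>A\<^esub> ?e \<oplus>\<^bsub>A\<^esub> f (a0 \<otimes>\<^bsub>A\<^esub> x i r) ?e \<otimes>\<^bsub>A\<^esub> reflection (i, r))"
        using p by (simp add: p_def A.a_assoc)
      also have "\<dots> = p \<oplus>\<^bsub>A\<^esub> (a0 \<otimes>\<^bsub>A\<^esub> (f (x i r) ?e \<otimes>\<^bsub>A\<^esub> reflection (i, r)) \<oplus>\<^bsub>A\<^esub> f a0 (x i r))"
        by (subst twisted_inclusion[of ?e a0 "x i r" "reflection (i, r)"]) (auto simp: reflection_def)
      also have "\<dots> = a0 \<otimes>\<^bsub>A\<^esub> (y i r \<oplus>\<^bsub>A\<^esub> f (x i r) ?e \<otimes>\<^bsub>A\<^esub> reflection (i, r)) \<oplus>\<^bsub>A\<^esub> a1 \<otimes>\<^bsub>A\<^esub> x i r \<oplus>\<^bsub>A\<^esub> f a0 (x i r)"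
        by (simp add: p_def A.r_distr A.a_ac)
      finally show ?thesis
        using ir by (simp add: eq coord_def Q_smult Q_add f_proj_def)
    qed
    show "(\<Oplus>\<^bsub>?H\<^esub>j\<in>J. coord j z \<odot>\<^bsub>?H\<^esub> basis m j) = z" if z: "z \<in> carrier ?H" for z
    proof -
      obtain x y where eq: "z = (x, y)" and x: "x \<in> carrier (P m)" and y: "y \<in> carrier (P m)"
        using z by (cases z) auto
      have "trunc m J x = x" if x: "x \<in> carrier (P m)" for x
        unfolding trunc_def
      proof (rule restrict_eq_PiE[OF x[unfolded direct_sum_simps]])
        fix i assume i: "i \<in> {..m}"
        then have "x i \<in> carrier (Q i)" using x by auto
        then show "(\<lambda>r\<in>{..<length (js i)}. if (i, r) \<in> J then x i r else \<zero>\<^bsub>A\<^esub>) = x i"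
          unfolding carrier_Q using i by (intro restrict_eq_PiE) (auto simp: J_def)
      qed
      then show ?thesis
        unfolding eq using dual[OF x y J] x y by simp
    qed
  qed
qed

end

section \<open>The resolution over the deformed algebra\<close>

lemma fd_module_zero_module: "fd_algebra K A \<Longrightarrow> fd_module K A zero_module"
proof -
  assume A: "fd_algebra K A"
  interpret fd_algebra K A by fact
  have lm: "left_module A (zero_module :: ('b, unit) module)"
  proof (intro left_module.intro left_module_axioms.intro)
    show "ring A" by unfold_locales
    show "abelian_group (zero_module :: ('b, unit) module)"
      by (rule abelian_groupI) (auto simp: zero_module_def)
  qed (auto simp: zero_module_def)
  interpret V: left_module K "kspace A (zero_module :: ('b, unit) module)"
    by (rule left_module_kspace[OF A lm])
  have "finite_dim K (kspace A (zero_module :: ('b, unit) module))"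
    unfolding V.finite_dim_iff_generated
  proof (intro exI[of _ "{}"] conjI allI impI)
    fix S assume "submodule S K (kspace A (zero_module :: ('b, unit) module)) \<and> {} \<subseteq> S"
    then have "\<zero>\<^bsub>kspace A (zero_module :: ('b, unit) module)\<^esub> \<in> S"
      using V.submoduleD(2) by blast
    then show "carrier (kspace A (zero_module :: ('b, unit) module)) \<subseteq> S"
      by auto
  qed auto
  with lm show "fd_module K A zero_module"
    by (simp add: fd_module_def)
qed

lemma tuple_of_module_simps [simp]:
  "tup0 (tuple_of_module M) = zero_module" "tup1 (tuple_of_module M) = M"
  "tupT (tuple_of_module M) = (\<lambda>_. \<zero>\<^bsub>M\<^esub>)" "tupf (tuple_of_module M) = (\<lambda>_ _. \<zero>\<^bsub>M\<^esub>)"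
  by (simp_all add: tuple_of_module_def)

lemma (in deformation) is_tuple_of_module:
  assumes "fd_module K A M"
  shows "is_tuple K A f (tuple_of_module M)"
proof -
  interpret M: left_module A M
    using assms by (simp add: fd_module_def)
  have "\<ominus>\<^bsub>M\<^esub> \<zero>\<^bsub>M\<^esub> = \<zero>\<^bsub>M\<^esub>"
    by (rule M.M.minus_equality) auto
  then have "\<zero>\<^bsub>M\<^esub> \<ominus>\<^bsub>M\<^esub> \<zero>\<^bsub>M\<^esub> \<ominus>\<^bsub>M\<^esub> \<zero>\<^bsub>M\<^esub> = \<zero>\<^bsub>M\<^esub>"
    by (simp only: a_minus_def M.M.r_zero M.M.zero_closed)
  then show ?thesis
    unfolding is_tuple_def
    using assms fd_module_zero_module[OF algebra]
    by (auto simp: mhom_def bilinear_map_def M.smult_zero_right scal_closed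
      inj_on_def)
qed

locale deformed_resolution = hat_sums K A f e js Q
  for K :: "'k ring" and A :: "('k, 'a) module" and f :: "'a \<Rightarrow> 'a \<Rightarrow> 'a"
    and e :: "nat \<Rightarrow> 'a" and js :: "nat \<Rightarrow> nat list" and Q :: "nat \<Rightarrow> ('a, nat \<Rightarrow> 'a) module" +
  fixes M :: "('a, 'm) module"
    and \<delta> :: "nat \<Rightarrow> (nat \<Rightarrow> 'a) \<Rightarrow> (nat \<Rightarrow> 'a)" and \<delta>0 :: "(nat \<Rightarrow> 'a) \<Rightarrow> 'm"
    and T :: "nat \<Rightarrow> (nat \<Rightarrow> 'a) \<Rightarrow> (nat \<Rightarrow> 'a)"
  assumes resolution: "minimal_projective_resolution TYPE(nat \<Rightarrow> 'a) K A Q \<delta> \<delta>0 M"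
    and T: "\<And>i. i > 0 \<Longrightarrow> T i \<in> mhom K (kspace A (Q i)) (kspace A (Q (i - 1)))"
    and T_act: "\<And>i a x. \<lbrakk>i > 0; a \<in> carrier A; x \<in> carrier (Q i)\<rbrakk> \<Longrightarrow>
        T i (a \<odot>\<^bsub>Q i\<^esub> x) \<ominus>\<^bsub>Q (i - 1)\<^esub> a \<odot>\<^bsub>Q (i - 1)\<^esub> T i x =
        alt_sign (Q (i - 1)) (i + 1)
          (f_proj A f e (js (i - 1)) a (\<delta> i x) \<ominus>\<^bsub>Q (i - 1)\<^esub> \<delta> i (f_proj A f e (js i) a x))"
    and T_comm: "\<And>i x. \<lbrakk>i > 0; x \<in> carrier (Q (i + 1))\<rbrakk> \<Longrightarrow>
        T i (\<delta> (i + 1) x) = \<delta> i (T (i + 1) x)"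
begin

lemma is_resolution: "projective_resolution TYPE(nat \<Rightarrow> 'a) K A Q \<delta> \<delta>0 M"
  using resolution by (simp add: minimal_projective_resolution_def)

lemma fd_M: "fd_module K A M"
  using is_resolution by (simp add: projective_resolution_def)

sublocale M: left_module A M
  using fd_M by (simp add: fd_module_def)

sublocale Mt: deformed_tuple K A f "tuple_of_module M"
  by unfold_locales (rule is_tuple_of_module[OF fd_M])

lemma d_mhom: "\<delta> (Suc i) \<in> mhom A (Q (Suc i)) (Q i)"
proof -
  have "\<forall>i>0. \<delta> i \<in> mhom A (Q i) (Q (i - 1))"
    using is_resolution unfolding projective_resolution_def by blast
  from this[rule_format, of "Suc i"] show ?thesis by simp
qed

lemma d0_mhom: "\<delta>0 \<in> mhom A (Q 0) M"
  and d0_onto: "\<delta>0 ` carrier (Q 0) = carrier M"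
  and exact0: "\<delta> (Suc 0) ` carrier (Q (Suc 0)) = a_kernel (Q 0) M \<delta>0"
  using is_resolution by (simp_all add: projective_resolution_def)

lemma exact: "\<delta> (Suc (Suc i)) ` carrier (Q (Suc (Suc i))) = a_kernel (Q (Suc i)) (Q i) (\<delta> (Suc i))"
proof -
  have "\<forall>i>0. \<delta> (i + 1) ` carrier (Q (i + 1)) = a_kernel (Q i) (Q (i - 1)) (\<delta> i)"
    using is_resolution unfolding projective_resolution_def by blast
  from this[rule_format, of "Suc i"] show ?thesis by simp
qed

lemmas d_closed = mhomD(1)[OF d_mhom]
  and d_add = mhomD(2)[OF d_mhom]
  and d_zero = mhom_zero[OF d_mhom left_module_Q left_module_Q]
  and d_minus = mhom_minus[OF d_mhom left_module_Q left_module_Q]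
  and d_alt_sign = mhom_alt_sign[OF d_mhom left_module_Q left_module_Q]

lemma d_d: "x \<in> carrier (Q (Suc (Suc i))) \<Longrightarrow> \<delta> (Suc i) (\<delta> (Suc (Suc i)) x) = \<zero>\<^bsub>Q i\<^esub>"
  using exact[of i] by (auto simp: a_kernel_def')

abbreviation N :: "nat \<Rightarrow> (nat \<Rightarrow> 'a) set" where "N i \<equiv> \<delta> (Suc i) ` carrier (Q (Suc i))"

lemma submodule_N: "submodule (N i) A (Q i)"
  by (rule mhom_image_submodule[OF d_mhom left_module_Q left_module_Q carrier_submodule[OF left_module_Q]])

lemma superfluous_N: "superfluous A (Q i) (N i)"
proof (cases i)
  case 0
  then show ?thesis
    using resolution unfolding minimal_projective_resolution_def projective_cover_def
    by (simp add: exact0)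
next
  case (Suc k)
  have "\<forall>i>0. superfluous A (Q i) (a_kernel (Q i) ((Q (i - 1))\<lparr>carrier := \<delta> i ` carrier (Q i)\<rparr>) (\<delta> i))"
    using resolution unfolding minimal_projective_resolution_def projective_cover_def by blast
  from this[rule_format, of "Suc k"] show ?thesis
    by (simp add: Suc exact a_kernel_def')
qed

lemma T_mhom: "T (Suc i) \<in> mhom K (kspace A (Q (Suc i))) (kspace A (Q i))"
  using T[of "Suc i"] by simp

lemma T_closed: "x \<in> carrier (Q (Suc i)) \<Longrightarrow> T (Suc i) x \<in> carrier (Q i)"
  using mhomD(1)[OF T_mhom] by simp

lemma T_d: "x \<in> carrier (Q (Suc (Suc i))) \<Longrightarrow>
    T (Suc i) (\<delta> (Suc (Suc i)) x) = \<delta> (Suc i) (T (Suc (Suc i)) x)"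
  using T_comm[of "Suc i" x] by simp

text \<open>This is the form in which the twisted linearity of \<open>T\<close> enters: the alternating sign of \<open>v\<close> cancels
  the one in the hypothesis on \<open>T\<close>, and no sign is left on \<open>\<delta>\<close> and \<open>f\<close>.\<close>

lemma T_shift:
  assumes "p \<in> carrier (Q i)" "a \<in> carrier A" "x \<in> carrier (Q (Suc i))"
  shows "alt_sign (Q i) i (p \<oplus>\<^bsub>Q i\<^esub> T (Suc i) (a \<odot>\<^bsub>Q (Suc i)\<^esub> x)) \<oplus>\<^bsub>Q i\<^esub> \<delta> (Suc i) (fQ (Suc i) a x)
    = alt_sign (Q i) i (p \<oplus>\<^bsub>Q i\<^esub> a \<odot>\<^bsub>Q i\<^esub> T (Suc i) x) \<oplus>\<^bsub>Q i\<^esub> fQ i a (\<delta> (Suc i) x)"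
  using assms T_act[of "Suc i" a x]
  by (intro Q.alt_sign_shift) (auto simp: T_closed Q.smult_closed d_closed f_proj_closed alt_sign_Suc_Suc)

lemma u_map_Suc: "u_map \<delta> (Suc k) x = (\<lambda>j\<in>{..k}. \<delta> (Suc j) (x (Suc j)))"
  by (simp add: u_map_def)

lemma v_map_Suc: "v_map Q T (Suc k) x =
    (\<lambda>j\<in>{..k}. alt_sign (Q j) j (x j \<oplus>\<^bsub>Q j\<^esub> T (Suc j) (x (Suc j))))"
  by (simp add: v_map_def)

lemma u_map_mhom: "u_map \<delta> (Suc k) \<in> mhom A (P (Suc k)) (P k)"
  unfolding u_map_Suc[abs_def] by (intro mhom_family mhom_comp_component d_mhom) auto

lemma v_map_mhom: "v_map Q T (Suc k) \<in> mhom K (kspace A (P (Suc k))) (kspace A (P k))"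
  unfolding v_map_Suc[abs_def] kspace_direct_sum
proof (rule mhom_family)
  fix j assume j: "j \<in> {..k}"
  note lm = left_module_kspace[OF algebra left_module_Q]
  have "(\<lambda>x. x j \<oplus>\<^bsub>kspace A (Q j)\<^esub> T (Suc j) (x (Suc j)))
      \<in> mhom K (direct_sum {..Suc k} (\<lambda>i. kspace A (Q i))) (kspace A (Q j))"
    using j by (intro mhom_add mhom_component mhom_comp_component T_mhom lm) auto
  from mhom_comp[OF this left_module.alt_sign_mhom[OF lm, of j j]]
  show "(\<lambda>x. alt_sign (Q j) j (x j \<oplus>\<^bsub>Q j\<^esub> T (Suc j) (x (Suc j))))
      \<in> mhom K (direct_sum {..Suc k} (\<lambda>i. kspace A (Q i))) (kspace A (Q j))"
    by (simp add: alt_sign_kspace)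
qed

lemma is_tuple_mor_delta_hat: "is_tuple_mor K A (hat (Suc k)) (hat k) (delta_hat Q \<delta> T (Suc k))"
proof -
  interpret Pk: left_module A "P k" by (rule left_module_P)
  interpret PS: left_module A "P (Suc k)" by (rule left_module_P)
  let ?u = "u_map \<delta> (Suc k)" and ?v = "v_map Q T (Suc k)"
  let ?F = "\<lambda>m a x. \<lambda>i\<in>{..m}. fQ i a (x i)"
  have F: "?F m a x \<in> carrier (P m)" if "a \<in> carrier A" "x \<in> carrier (P m)" for m a x
    using that by (auto intro!: f_proj_closed)
  note u = mhomD(1)[OF u_map_mhom] and v = mhomD(1)[OF v_map_mhom, simplified kspace_simps]
  have "?v (a \<odot>\<^bsub>P (Suc k)\<^esub> x) = a \<odot>\<^bsub>P k\<^esub> ?v x \<ominus>\<^bsub>P k\<^esub> ?u (?F (Suc k) a x) \<oplus>\<^bsub>P k\<^esub> ?F k a (?u x)"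
    if a: "a \<in> carrier A" and x: "x \<in> carrier (P (Suc k))" for a x
  proof -
    have xi: "x i \<in> carrier (Q i)" if "i \<le> Suc k" for i
      using x that by auto
    have "?v (a \<odot>\<^bsub>P (Suc k)\<^esub> x) \<oplus>\<^bsub>P k\<^esub> ?u (?F (Suc k) a x) = a \<odot>\<^bsub>P k\<^esub> ?v x \<oplus>\<^bsub>P k\<^esub> ?F k a (?u x)"
      unfolding u_map_Suc v_map_Suc direct_sum_simps
    proof (rule restrict_ext)
      fix j assume "j \<in> {..k}"
      then have [simp]: "j \<le> k" "j \<le> Suc k" by simp_all
      note xj = xi[of j] xi[of "Suc j"]
      have "alt_sign (Q j) j (a \<odot>\<^bsub>Q j\<^esub> x j \<oplus>\<^bsub>Q j\<^esub> a \<odot>\<^bsub>Q j\<^esub> T (Suc j) (x (Suc j)))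
          = a \<odot>\<^bsub>Q j\<^esub> alt_sign (Q j) j (x j \<oplus>\<^bsub>Q j\<^esub> T (Suc j) (x (Suc j)))"
        using a xj mhomD(3)[OF Q.alt_sign_mhom[of j j]] by (simp add: T_closed flip: Q.smult_r_distr)
      then show "(\<lambda>i\<in>{..k}. alt_sign (Q i) i ((\<lambda>i\<in>{..Suc k}. a \<odot>\<^bsub>Q i\<^esub> x i) i
            \<oplus>\<^bsub>Q i\<^esub> T (Suc i) ((\<lambda>i\<in>{..Suc k}. a \<odot>\<^bsub>Q i\<^esub> x i) (Suc i)))) j
          \<oplus>\<^bsub>Q j\<^esub> (\<lambda>j\<in>{..k}. \<delta> (Suc j) ((\<lambda>i\<in>{..Suc k}. fQ i a (x i)) (Suc j))) j
        = (\<lambda>i\<in>{..k}. a \<odot>\<^bsub>Q i\<^esub> (\<lambda>j\<in>{..k}. alt_sign (Q j) j (x j \<oplus>\<^bsub>Q j\<^esub> T (Suc j) (x (Suc j)))) i) j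
          \<oplus>\<^bsub>Q j\<^esub> (\<lambda>i\<in>{..k}. fQ i a ((\<lambda>j\<in>{..k}. \<delta> (Suc j) (x (Suc j))) i)) j"
        using T_shift[of "a \<odot>\<^bsub>Q j\<^esub> x j" j a "x (Suc j)"] a xj by (simp add: Q.smult_closed)
    qed
    then show ?thesis
      by (subst Pk.M.eq_diff_plus_iff)
        (blast intro: v u F a x PS.smult_closed Pk.smult_closed)+
  qed
  then show ?thesis
    unfolding is_tuple_mor_def delta_hat_def prod.case hat_simps
    by (intro conjI ballI u_map_mhom v_map_mhom refl)
qed

lemma is_tuple_mor_delta_hat0: "is_tuple_mor K A (hat 0) (tuple_of_module M) (delta_hat0 M \<delta>0)"
proof -
  have "(\<lambda>x. \<delta>0 (x 0)) \<in> mhom A (P 0) M"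
    by (intro mhom_comp_component d0_mhom) simp
  then have d: "(\<lambda>x. \<delta>0 (x 0)) \<in> mhom K (kspace A (P 0)) (kspace A M)"
    by (rule mhom_kspace) (rule scal_closed)
  have "(\<lambda>_. ()) \<in> mhom A (P 0) zero_module" "(\<lambda>_. \<zero>\<^bsub>M\<^esub>) \<in> mhom A (P 0) M"
    by (auto intro!: mhomI simp: zero_module_def M.smult_zero_right)
  moreover have "\<delta>0 ((a \<odot>\<^bsub>P 0\<^esub> x) 0) = a \<odot>\<^bsub>M\<^esub> \<delta>0 (x 0) \<ominus>\<^bsub>M\<^esub> \<zero>\<^bsub>M\<^esub> \<oplus>\<^bsub>M\<^esub> \<zero>\<^bsub>M\<^esub>"
    if "a \<in> carrier A" "x \<in> carrier (P 0)" for a x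
  proof -
    have "x 0 \<in> carrier (Q 0)" using that by auto
    then show ?thesis
      using that mhomD(1,3)[OF d0_mhom] by (simp add: a_minus_def M.smult_closed)
  qed
  ultimately show ?thesis
    unfolding is_tuple_mor_def delta_hat0_def prod.case hat_simps tuple_of_module_simps
    using d by blast
qed

subsection \<open>Exactness\<close>

abbreviation H :: "nat \<Rightarrow> ('a \<times> 'a, (nat \<Rightarrow> nat \<Rightarrow> 'a) \<times> (nat \<Rightarrow> nat \<Rightarrow> 'a)) module" where
  "H m \<equiv> tuple_module (hat m)"
abbreviation D where "D k \<equiv> tuple_map (hat k) (delta_hat Q \<delta> T (Suc k))"
abbreviation D0 where "D0 \<equiv> tuple_map (tuple_of_module M) (delta_hat0 M \<delta>0)"

lemma D_mhom: "D k \<in> mhom Af (H (Suc k)) (H k)"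
  by (rule tuple_map_mhom[OF is_tuple_hat is_tuple_hat is_tuple_mor_delta_hat])

lemma D0_mhom: "D0 \<in> mhom Af (H 0) (tuple_module (tuple_of_module M))"
  by (rule tuple_map_mhom[OF is_tuple_hat is_tuple_of_module[OF fd_M] is_tuple_mor_delta_hat0])

lemma D_apply: "D k (x, y) = (\<lambda>j\<in>{..k}. \<delta> (Suc j) (x (Suc j)),
    \<lambda>j\<in>{..k}. alt_sign (Q j) j (x j \<oplus>\<^bsub>Q j\<^esub> T (Suc j) (x (Suc j))) \<oplus>\<^bsub>Q j\<^esub> \<delta> (Suc j) (y (Suc j)))"
  by (auto simp: tuple_map_def delta_hat_def u_map_Suc v_map_Suc intro!: restrict_ext)

lemma D0_apply:
  assumes "x \<in> carrier (P 0)"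
  shows "D0 (x, y) = ((), \<delta>0 (x 0))"
proof -
  have "x 0 \<in> carrier (Q 0)" using assms by auto
  then show ?thesis
    using mhomD(1)[OF d0_mhom] by (simp add: tuple_map_def delta_hat0_def)
qed

text \<open>The diagonal terms cancel because consecutive entries of \<open>v\<close> carry opposite signs, and the terms
  in \<open>T\<close> cancel because \<open>T\<close> commutes with \<open>\<delta>\<close>.\<close>

lemma D_D:
  assumes "z \<in> carrier (H (Suc (Suc k)))"
  shows "D k (D (Suc k) z) = \<zero>\<^bsub>H k\<^esub>"
proof -
  obtain x y where z: "z = (x, y)" by (cases z)
  have xi: "x i \<in> carrier (Q i)" "y i \<in> carrier (Q i)" if "i \<le> Suc (Suc k)" for i
    using assms that by (auto simp: z)
  have "alt_sign (Q j) j (\<delta> (Suc j) (x (Suc j)) \<oplus>\<^bsub>Q j\<^esub> T (Suc j) (\<delta> (Suc (Suc j)) (x (Suc (Suc j)))))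
      \<oplus>\<^bsub>Q j\<^esub> \<delta> (Suc j) (alt_sign (Q (Suc j)) (Suc j)
        (x (Suc j) \<oplus>\<^bsub>Q (Suc j)\<^esub> T (Suc (Suc j)) (x (Suc (Suc j))))
        \<oplus>\<^bsub>Q (Suc j)\<^esub> \<delta> (Suc (Suc j)) (y (Suc (Suc j)))) = \<zero>\<^bsub>Q j\<^esub>" if "j \<le> k" for j
  proof -
    have in_Q: "x (Suc j) \<in> carrier (Q (Suc j))" "x (Suc (Suc j)) \<in> carrier (Q (Suc (Suc j)))"
      "y (Suc (Suc j)) \<in> carrier (Q (Suc (Suc j)))"
      using xi that by auto
    define c where "c = \<delta> (Suc j) (x (Suc j)) \<oplus>\<^bsub>Q j\<^esub> \<delta> (Suc j) (T (Suc (Suc j)) (x (Suc (Suc j))))"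
    have c: "c \<in> carrier (Q j)"
      using in_Q by (simp add: c_def d_closed T_closed)
    have "\<delta> (Suc j) (alt_sign (Q (Suc j)) (Suc j)
        (x (Suc j) \<oplus>\<^bsub>Q (Suc j)\<^esub> T (Suc (Suc j)) (x (Suc (Suc j))))
        \<oplus>\<^bsub>Q (Suc j)\<^esub> \<delta> (Suc (Suc j)) (y (Suc (Suc j)))) = alt_sign (Q j) (Suc j) c"
      using in_Q by (simp add: d_add d_alt_sign d_d c_def d_closed T_closed Q.alt_sign_closed)
    then show ?thesis
      using in_Q c by (simp add: T_d Q.alt_sign_Suc Q.alt_sign_closed Q.M.r_neg flip: c_def)
  qed
  moreover have "\<delta> (Suc j) (\<delta> (Suc (Suc j)) (x (Suc (Suc j)))) = \<zero>\<^bsub>Q j\<^esub>" if "j \<le> k" for j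
    using xi(1)[of "Suc (Suc j)"] that by (simp add: d_d)
  ultimately show ?thesis
    unfolding z D_apply by (auto intro!: restrict_ext)
qed

lemma D0_D:
  assumes "z \<in> carrier (H (Suc 0))"
  shows "D0 (D 0 z) = \<zero>\<^bsub>tuple_module (tuple_of_module M)\<^esub>"
proof -
  obtain x y where z: "z = (x, y)" by (cases z)
  have "fst (D 0 z) \<in> carrier (P 0)"
    using mhomD(1)[OF D_mhom assms] by (auto simp del: direct_sum_simps)
  moreover have "\<delta>0 (\<delta> (Suc 0) (x (Suc 0))) = \<zero>\<^bsub>M\<^esub>"
    using assms exact0 by (auto simp: z a_kernel_def')
  ultimately show ?thesis
    using D0_apply by (simp add: z D_apply zero_module_def)
qed

text \<open>A preimage may be sought with second component \<open>0\<close>: its top entry is a preimage of \<open>x\<^sub>m\<close>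
  under \<open>\<delta>\<close>, and the lower entries are then forced from the top down by the second component.
  The vanishing of \<open>v(x) + u(y)\<close> is what makes \<open>\<delta>\<close> of each of them the prescribed entry of \<open>x\<close>.\<close>

lemma D_preimage:
  assumes x: "x \<in> carrier (P m)" and y: "y \<in> carrier (P m)" and top: "x m \<in> N m"
    and cycle: "\<And>j. j < m \<Longrightarrow> alt_sign (Q j) j (x j \<oplus>\<^bsub>Q j\<^esub> T (Suc j) (x (Suc j)))
      \<oplus>\<^bsub>Q j\<^esub> \<delta> (Suc j) (y (Suc j)) = \<zero>\<^bsub>Q j\<^esub>"
  shows "(x, y) \<in> D m ` carrier (H (Suc m))"
proof -
  have xi: "x i \<in> carrier (Q i)" "y i \<in> carrier (Q i)" if "i \<le> m" for i
    using x y that by auto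
  obtain q where q: "q \<in> carrier (Q (Suc m))" "\<delta> (Suc m) q = x m"
    using top by auto
  \<comment> \<open>\<open>Z k\<close> is the entry with index \<open>m + 1 - k\<close>.\<close>
  define Z where "Z = rec_nat q (\<lambda>k z. alt_sign (Q (m - k)) (m - k) (y (m - k))
    \<oplus>\<^bsub>Q (m - k)\<^esub> \<ominus>\<^bsub>Q (m - k)\<^esub> T (Suc (m - k)) z)"
  define z where "z i = Z (Suc m - i)" for i
  have z_top: "z (Suc m) = q"
    by (simp add: z_def Z_def)
  have z_rec: "z i = alt_sign (Q i) i (y i) \<oplus>\<^bsub>Q i\<^esub> \<ominus>\<^bsub>Q i\<^esub> T (Suc i) (z (Suc i))" if "i \<le> m" for i
  proof -
    have "Z (Suc m - i) = Z (Suc (m - i))" "m - (m - i) = i"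
      using that by (simp_all add: Suc_diff_le)
    then show ?thesis by (simp add: z_def Z_def)
  qed
  have z: "z (Suc i) \<in> carrier (Q (Suc i)) \<and> \<delta> (Suc i) (z (Suc i)) = x i" if "i \<le> m" for i
    using that
  proof (induction rule: inc_induct)
    case base
    then show ?case using q by (simp add: z_top)
  next
    case (step i)
    have [simp]: "i \<le> m" "Suc i \<le> m" using step by auto
    let ?t = "T (Suc (Suc i)) (z (Suc (Suc i)))"
    have zS: "z (Suc (Suc i)) \<in> carrier (Q (Suc (Suc i)))" and dz: "\<delta> (Suc (Suc i)) (z (Suc (Suc i))) = x (Suc i)"
      using step.IH by auto
    note in_Q = xi(1)[of i] xi[of "Suc i"] T_closed[OF zS]
    have "\<delta> (Suc i) ?t = T (Suc i) (x (Suc i))"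
      using T_d[OF zS] dz by simp
    then have "\<delta> (Suc i) (z (Suc i))
        = alt_sign (Q i) (Suc i) (\<delta> (Suc i) (y (Suc i))) \<oplus>\<^bsub>Q i\<^esub> \<ominus>\<^bsub>Q i\<^esub> T (Suc i) (x (Suc i))"
      using in_Q by (simp add: z_rec d_add d_alt_sign d_minus Q.alt_sign_closed)
    also have "\<dots> = x i"
    proof -
      let ?y = "\<delta> (Suc i) (y (Suc i))" and ?s = "x i \<oplus>\<^bsub>Q i\<^esub> T (Suc i) (x (Suc i))"
      have s: "?y \<in> carrier (Q i)" "?s \<in> carrier (Q i)" "T (Suc i) (x (Suc i)) \<in> carrier (Q i)"
        using in_Q by (simp_all add: d_closed T_closed)
      have "alt_sign (Q i) i ?s = \<ominus>\<^bsub>Q i\<^esub> ?y"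
        using cycle[of i] step.hyps s Q.M.minus_equality[of i "alt_sign (Q i) i ?s" ?y]
        by (simp add: Q.alt_sign_closed)
      then have "alt_sign (Q i) i (alt_sign (Q i) i ?s) = alt_sign (Q i) i (\<ominus>\<^bsub>Q i\<^esub> ?y)"
        by simp
      then have "?s = alt_sign (Q i) (Suc i) ?y"
        using s by (simp add: Q.alt_sign_alt_sign) (simp add: alt_sign_def)
      then have "alt_sign (Q i) (Suc i) ?y \<oplus>\<^bsub>Q i\<^esub> \<ominus>\<^bsub>Q i\<^esub> T (Suc i) (x (Suc i))
          = x i \<oplus>\<^bsub>Q i\<^esub> (T (Suc i) (x (Suc i)) \<oplus>\<^bsub>Q i\<^esub> \<ominus>\<^bsub>Q i\<^esub> T (Suc i) (x (Suc i)))"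
        using s in_Q by (simp add: Q.M.a_assoc flip: \<open>?s = _\<close>)
      then show ?thesis
        using s in_Q by (simp add: Q.M.r_neg)
    qed
    finally show ?case
      using in_Q by (simp add: z_rec Q.alt_sign_closed)
  qed
  have zQ: "z i \<in> carrier (Q i)" if "i \<le> Suc m" for i
  proof (cases i)
    case 0
    then show ?thesis using z_rec[of 0] xi[of 0] z[of 0] by (simp add: T_closed Q.alt_sign_closed)
  next
    case (Suc k)
    then show ?thesis using z[of k] that by simp
  qed
  define w where "w = ((\<lambda>i\<in>{..Suc m}. z i), \<zero>\<^bsub>P (Suc m)\<^esub>)"
  have "w \<in> carrier (H (Suc m))"
    using zQ by (simp add: w_def)
  moreover have "D m w = (x, y)"
  proof -
    have first: "(\<lambda>j\<in>{..m}. \<delta> (Suc j) (restrict z {..Suc m} (Suc j))) = x"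
      by (rule restrict_eq_PiE[OF x[unfolded direct_sum_simps]]) (use z in simp)
    have second: "(\<lambda>j\<in>{..m}. alt_sign (Q j) j (restrict z {..Suc m} j \<oplus>\<^bsub>Q j\<^esub> T (Suc j) (restrict z {..Suc m} (Suc j)))
        \<oplus>\<^bsub>Q j\<^esub> \<delta> (Suc j) (\<zero>\<^bsub>P (Suc m)\<^esub> (Suc j))) = y"
    proof (rule restrict_eq_PiE[OF y[unfolded direct_sum_simps]])
      fix j assume "j \<in> {..m}"
      then have j: "j \<le> m" by simp
      note in_Q = xi(2)[OF j] T_closed[OF z[OF j, THEN conjunct1]] zQ[of j]
      have "z j \<oplus>\<^bsub>Q j\<^esub> T (Suc j) (z (Suc j)) = alt_sign (Q j) j (y j)"
        using in_Q by (simp add: z_rec[OF j] Q.M.a_assoc Q.alt_sign_closed Q.M.l_neg)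
      then show "alt_sign (Q j) j (restrict z {..Suc m} j \<oplus>\<^bsub>Q j\<^esub> T (Suc j) (restrict z {..Suc m} (Suc j)))
        \<oplus>\<^bsub>Q j\<^esub> \<delta> (Suc j) (\<zero>\<^bsub>P (Suc m)\<^esub> (Suc j)) = y j"
        using j in_Q by (simp add: d_zero Q.alt_sign_alt_sign)
    qed
    show ?thesis
      unfolding w_def D_apply first second ..
  qed
  ultimately show ?thesis by (metis image_eqI)
qed

lemma exact_D: "D (Suc k) ` carrier (H (Suc (Suc k))) = a_kernel (H (Suc k)) (H k) (D k)"
proof
  show "D (Suc k) ` carrier (H (Suc (Suc k))) \<subseteq> a_kernel (H (Suc k)) (H k) (D k)"
    using D_D mhomD(1)[OF D_mhom] by (auto simp: a_kernel_def' simp del: tuple_module_simps)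
  show "a_kernel (H (Suc k)) (H k) (D k) \<subseteq> D (Suc k) ` carrier (H (Suc (Suc k)))"
  proof
    fix z assume "z \<in> a_kernel (H (Suc k)) (H k) (D k)"
    then obtain x y where z: "z = (x, y)" and x: "x \<in> carrier (P (Suc k))" and y: "y \<in> carrier (P (Suc k))"
      and D: "D k (x, y) = \<zero>\<^bsub>H k\<^esub>"
      by (cases z) (auto simp: a_kernel_def' simp del: direct_sum_simps)
    have 1: "\<delta> (Suc j) (x (Suc j)) = \<zero>\<^bsub>Q j\<^esub>"
      and 2: "alt_sign (Q j) j (x j \<oplus>\<^bsub>Q j\<^esub> T (Suc j) (x (Suc j))) \<oplus>\<^bsub>Q j\<^esub> \<delta> (Suc j) (y (Suc j)) = \<zero>\<^bsub>Q j\<^esub>"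
      if "j \<le> k" for j
    proof -
      have "fst (D k (x, y)) j = \<zero>\<^bsub>Q j\<^esub>" "snd (D k (x, y)) j = \<zero>\<^bsub>Q j\<^esub>"
        using that unfolding D by auto
      then show "\<delta> (Suc j) (x (Suc j)) = \<zero>\<^bsub>Q j\<^esub>"
        "alt_sign (Q j) j (x j \<oplus>\<^bsub>Q j\<^esub> T (Suc j) (x (Suc j))) \<oplus>\<^bsub>Q j\<^esub> \<delta> (Suc j) (y (Suc j)) = \<zero>\<^bsub>Q j\<^esub>"
        using that unfolding D_apply by auto
    qed
    have "x (Suc k) \<in> N (Suc k)"
      using 1[of k] x unfolding exact by (auto simp: a_kernel_def')
    then show "z \<in> D (Suc k) ` carrier (H (Suc (Suc k)))"
      unfolding z using 2 by (intro D_preimage x y) auto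
  qed
qed

lemma exact_D0: "D 0 ` carrier (H (Suc 0)) = a_kernel (H 0) (tuple_module (tuple_of_module M)) D0"
proof
  show "D 0 ` carrier (H (Suc 0)) \<subseteq> a_kernel (H 0) (tuple_module (tuple_of_module M)) D0"
    using D0_D mhomD(1)[OF D_mhom] by (auto simp: a_kernel_def' simp del: tuple_module_simps)
  show "a_kernel (H 0) (tuple_module (tuple_of_module M)) D0 \<subseteq> D 0 ` carrier (H (Suc 0))"
  proof
    fix z assume "z \<in> a_kernel (H 0) (tuple_module (tuple_of_module M)) D0"
    then obtain x y where z: "z = (x, y)" and x: "x \<in> carrier (P 0)" and y: "y \<in> carrier (P 0)"
      and D: "D0 (x, y) = \<zero>\<^bsub>tuple_module (tuple_of_module M)\<^esub>"
      by (cases z) (auto simp: a_kernel_def' simp del: direct_sum_simps)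
    have "\<delta>0 (x 0) = \<zero>\<^bsub>M\<^esub>"
      using D unfolding D0_apply[OF x] by simp
    then have "x 0 \<in> N 0"
      using x unfolding exact0 by (auto simp: a_kernel_def')
    then show "z \<in> D 0 ` carrier (H (Suc 0))"
      unfolding z by (intro D_preimage x y) auto
  qed
qed

lemma D0_onto: "D0 ` carrier (H 0) = carrier (tuple_module (tuple_of_module M))"
proof
  show "D0 ` carrier (H 0) \<subseteq> carrier (tuple_module (tuple_of_module M))"
    using mhomD(1)[OF D0_mhom] by blast
  show "carrier (tuple_module (tuple_of_module M)) \<subseteq> D0 ` carrier (H 0)"
  proof
    fix z assume "z \<in> carrier (tuple_module (tuple_of_module M))"
    then obtain \<mu> where z: "z = ((), \<mu>)" and "\<mu> \<in> carrier M"
      by (cases z) auto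
    then obtain q where q: "q \<in> carrier (Q 0)" "\<mu> = \<delta>0 q"
      using d0_onto by auto
    define x where "x = (\<lambda>i\<in>{..0::nat}. q)"
    have x: "x \<in> carrier (P 0)"
      using q by (simp add: x_def restrict_PiE_iff)
    then have "D0 (x, x) = z"
      using q by (simp only: D0_apply z) (simp add: x_def)
    moreover have "(x, x) \<in> carrier (H 0)"
      using x by (simp del: direct_sum_simps)
    ultimately show "z \<in> D0 ` carrier (H 0)" by (metis image_eqI)
  qed
qed

subsection \<open>Minimality\<close>

text \<open>The first component of a boundary has all its entries in images of \<open>\<delta>\<close>, which are superfluous by
  minimality of the given resolution; the second component lies in the radical anyway.\<close>

lemma superfluous_image_D: "superfluous Af (H m) (D m ` carrier (H (Suc m)))"
proof -
  interpret P: finite_direct_sum A "{..m}" Q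
    by (intro finite_direct_sum.intro ring_A left_module_Q) simp
  interpret H: left_module Af "H m" by (rule hat.left_module_tuple)
  let ?N = "\<Pi>\<^sub>E i\<in>{..m}. N i"
  have N: "?N \<subseteq> carrier (P m)"
    unfolding direct_sum_simps by (intro PiE_mono) (auto intro: d_closed)
  have "superfluous A (P m) ?N"
    by (intro P.superfluous_direct_sum submodule_N superfluous_N)
  then have "superfluous Af (H m) (?N \<times> carrier (P m))"
    using hat.superfluous_tuple[of m ?N] N by simp
  moreover have "?N \<times> carrier (P m) \<subseteq> carrier (H m)"
    using N by auto
  moreover have "D m ` carrier (H (Suc m)) \<subseteq> ?N \<times> carrier (P m)"
  proof
    fix z assume z: "z \<in> D m ` carrier (H (Suc m))"
    then obtain x y where "x \<in> carrier (P (Suc m))" and eq: "z = D m (x, y)"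
      by (auto simp del: direct_sum_simps)
    then have "fst z \<in> ?N"
      unfolding D_apply by (auto simp: restrict_PiE_iff)
    moreover have "z \<in> carrier (H m)"
      using z mhomD(1)[OF D_mhom] by blast
    ultimately show "z \<in> ?N \<times> carrier (P m)"
      by (simp add: mem_Times_iff del: direct_sum_simps)
  qed
  ultimately show ?thesis
    by (rule H.superfluous_subset)
qed

lemma minimal_resolution:
  "minimal_projective_resolution TYPE('n) K Af H (\<lambda>m. tuple_map (hat (m - 1)) (delta_hat Q \<delta> T m))
    D0 (tuple_module (tuple_of_module M))"
proof -
  let ?d = "\<lambda>m. tuple_map (hat (m - 1)) (delta_hat Q \<delta> T m)"
  let ?M = "tuple_module (tuple_of_module M)"
  have proj: "projective TYPE('n) Af (H m)" for m
    by (rule projective_hat)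
  have lm: "left_module Af (H m)" for m
    by (rule hat.left_module_tuple)
  have "projective_resolution TYPE('n) K Af H ?d D0 ?M"
    unfolding projective_resolution_def
  proof (intro conjI allI impI)
    show "fd_module K Af (H i)" for i by (rule hat.fd_module_tuple)
    show "projective TYPE('n) Af (H i)" for i by (rule proj)
    show "fd_module K Af ?M" by (rule Mt.fd_module_tuple)
    show "D0 \<in> mhom Af (H 0) ?M" by (rule D0_mhom)
    show "?d i \<in> mhom Af (H i) (H (i - 1))" if "0 < i" for i
      using that D_mhom by (cases i) auto
    show "D0 ` carrier (H 0) = carrier ?M" by (rule D0_onto)
    show "?d 1 ` carrier (H 1) = a_kernel (H 0) ?M D0"
      using exact_D0 by simp
    show "?d (i + 1) ` carrier (H (i + 1)) = a_kernel (H i) (H (i - 1)) (?d i)" if "0 < i" for i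
      using that exact_D by (cases i) auto
  qed
  moreover have "projective_cover TYPE('n) Af (H 0) ?M D0"
    unfolding projective_cover_def
    using proj Mt.left_module_tuple D0_mhom D0_onto superfluous_image_D[of 0] exact_D0 by simp
  moreover have "projective_cover TYPE('n) Af (H i) ((H (i - 1))\<lparr>carrier := ?d i ` carrier (H i)\<rparr>) (?d i)"
    if "0 < i" for i
  proof -
    obtain k where i: "i = Suc k" using \<open>0 < i\<close> by (cases i) auto
    have "submodule (D k ` carrier (H (Suc k))) Af (H k)"
      by (rule mhom_image_submodule[OF D_mhom lm lm carrier_submodule[OF lm]])
    then have "left_module Af ((H k)\<lparr>carrier := D k ` carrier (H (Suc k))\<rparr>)"
      by (rule left_module.left_module_submodule[OF lm])
    moreover have "superfluous Af (H (Suc k))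
        (a_kernel (H (Suc k)) ((H k)\<lparr>carrier := D k ` carrier (H (Suc k))\<rparr>) (D k))"
      using superfluous_image_D[of "Suc k"] unfolding exact_D by (simp add: a_kernel_def')
    ultimately show ?thesis
      unfolding projective_cover_def i using proj mhom_image_codomain[OF D_mhom] by simp
  qed
  ultimately show ?thesis
    unfolding minimal_projective_resolution_def by blast
qed

end

theorem theorem3p7:
  fixes K :: "'k ring" and A :: "('k, 'a) module" and f :: "'a \<Rightarrow> 'a \<Rightarrow> 'a"
    and n :: nat and e :: "nat \<Rightarrow> 'a"
    and M :: "('a, 'm) module"
    and js :: "nat \<Rightarrow> nat list" and Q :: "nat \<Rightarrow> ('a, nat \<Rightarrow> 'a) module"
    and \<delta> :: "nat \<Rightarrow> (nat \<Rightarrow> 'a) \<Rightarrow> (nat \<Rightarrow> 'a)" and \<delta>0 :: "(nat \<Rightarrow> 'a) \<Rightarrow> 'm"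
    and T :: "nat \<Rightarrow> (nat \<Rightarrow> 'a) \<Rightarrow> (nat \<Rightarrow> 'a)"
  assumes K: "algebraically_closed K"
    and A: "fd_algebra K A"
    and e: "idempotent_decomposition K A n e"
    and f: "hochschild_2cocycle K A f"
    and M: "fd_module K A M"
    and js: "\<And>i. set (js i) \<subseteq> {..<n}"
    and Q: "\<And>i. Q i = proj_sum A e (js i)"
    and res: "minimal_projective_resolution TYPE(nat \<Rightarrow> 'a) K A Q \<delta> \<delta>0 M"
    and T: "\<And>i. i > 0 \<Longrightarrow> T i \<in> mhom K (kspace A (Q i)) (kspace A (Q (i - 1)))"
    and T_act: "\<And>i a x. \<lbrakk>i > 0; a \<in> carrier A; x \<in> carrier (Q i)\<rbrakk> \<Longrightarrow>
        T i (a \<odot>\<^bsub>Q i\<^esub> x) \<ominus>\<^bsub>Q (i - 1)\<^esub> a \<odot>\<^bsub>Q (i - 1)\<^esub> T i x =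
        alt_sign (Q (i - 1)) (i + 1)
          (f_proj A f e (js (i - 1)) a (\<delta> i x) \<ominus>\<^bsub>Q (i - 1)\<^esub> \<delta> i (f_proj A f e (js i) a x))"
    and T_comm: "\<And>i x. \<lbrakk>i > 0; x \<in> carrier (Q (i + 1))\<rbrakk> \<Longrightarrow>
        T i (\<delta> (i + 1) x) = \<delta> i (T (i + 1) x)"
  shows "(\<forall>m. is_tuple K A f (hat_sum A f e js m)) \<and> is_tuple K A f (tuple_of_module M)
    \<and> (\<forall>m\<ge>1. is_tuple_mor K A (hat_sum A f e js m) (hat_sum A f e js (m - 1)) (delta_hat Q \<delta> T m))
    \<and> is_tuple_mor K A (hat_sum A f e js 0) (tuple_of_module M) (delta_hat0 M \<delta>0)
    \<and> minimal_projective_resolution TYPE('n) K (deformed_algebra A f)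
        (\<lambda>m. tuple_module (hat_sum A f e js m))
        (\<lambda>m. tuple_map (hat_sum A f e js (m - 1)) (delta_hat Q \<delta> T m))
        (tuple_map (tuple_of_module M) (delta_hat0 M \<delta>0))
        (tuple_module (tuple_of_module M))"
proof -
  have idem: "e (js i ! r) \<in> carrier A \<and> e (js i ! r) \<otimes>\<^bsub>A\<^esub> e (js i ! r) = e (js i ! r)"
    if "r < length (js i)" for i r
  proof -
    have "js i ! r < n"
      using js[of i] nth_mem[OF that] by auto
    then show ?thesis
      using e unfolding idempotent_decomposition_def primitive_idempotent_def by blast
  qed
  have "fd_module K A (Q i)" for i
    using res by (simp add: minimal_projective_resolution_def projective_resolution_def)
  moreover have "Q = (\<lambda>i. proj_sum A e (js i))"
    using Q by (rule ext)
  ultimately interpret deformed_resolution K A f e js Q M \<delta> \<delta>0 T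
    using idem by (intro deformed_resolution.intro deformed_resolution_axioms.intro hat_sums.intro
      hat_sums_axioms.intro deformation.intro A f res T T_act T_comm) blast+
  have "is_tuple_mor K A (hat m) (hat (m - 1)) (delta_hat Q \<delta> T m)" if "m \<ge> 1" for m
    using that is_tuple_mor_delta_hat by (cases m) auto
  then show ?thesis
    using is_tuple_hat is_tuple_of_module[OF M] is_tuple_mor_delta_hat0 minimal_resolution by blast
qed

end
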